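(* Let $H=\left(-\frac{d^2}{dx^2}\right)^{1/2}+x^2$ on $L^2(\mathbb{R})$, and let $\lambda_1<\lambda_2$ be its two lowest eigenvalues. Then $$\lambda_2-\lambda_1\ge\left(\frac{3\pi}{8}\right)^{2/3}\left(3^{2/3}-1\right).$$
   Context: $\left(-\frac{d^2}{dx^2}\right)^{1/2}$ is the Fourier multiplier operator with symbol $|k|$. The operator $H$ is the self-adjoint operator on $L^2(\mathbb{R})$ with $e^{-tH}=T_t$, where $(T_tf)(x)=\mathbb{E}^x\left[e^{-\int_0^t X_s^2\,ds}f(X_t)\right]$ and $(X_t)_{t\ge0}$ is the one-dimensional Cauchy process (the Lévy process with $\mathbb{E}^0[e^{i\xi X_t}]=e^{-t|\xi|}$). The operators $T_t$, $t>0$, are compact, so the spectrum of $H$ is purely discrete, with eigenvalues (counted with multiplicity) $0<\lambda_1<\lambda_2\le\lambda_3\le\dots\to\infty$. *)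

theory Defs
  imports "HOL-Probability.Probability"
begin

text \<open>
  Only the restriction of \<open>X\<close> to nonnegative times is meaningful. The process starts at \<open>0\<close>, so the
  law of the process under \<open>P\<^sup>x\<close> is that of \<open>x + X\<close>. All paths (not just almost all) are
  right-continuous with left limits; together with measurability of each \<open>X t\<close> this makes
  path functionals such as the time integral of \<open>X\<^sup>2\<close> measurable although \<open>M\<close> need not be complete.
\<close>

locale cauchy_process = prob_space M for M :: "'w measure" +
  fixes X :: "real \<Rightarrow> 'w \<Rightarrow> real"
  assumes random_variable: "\<And>t. 0 \<le> t \<Longrightarrow> X t \<in> borel_measurable M"
    and start: "AE \<omega> in M. X 0 \<omega> = 0"
    and indep_increments:
      "\<And>(n :: nat) (t :: nat \<Rightarrow> real). 0 \<le> t 0 \<Longrightarrow> (\<And>i. i < n \<Longrightarrow> t i \<le> t (Suc i)) \<Longrightarrow>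
         indep_vars (\<lambda>_. borel) (\<lambda>i \<omega>. X (t (Suc i)) \<omega> - X (t i) \<omega>) {..<n}"
    and stationary_increments:
      "\<And>s t. 0 \<le> s \<Longrightarrow> 0 \<le> t \<Longrightarrow>
         distr M borel (\<lambda>\<omega>. X (s + t) \<omega> - X s \<omega>) = distr M borel (X t)"
    and right_continuous:
      "\<And>t \<omega>. 0 \<le> t \<Longrightarrow> \<omega> \<in> space M \<Longrightarrow> continuous (at_right t) (\<lambda>s. X s \<omega>)"
    and left_limits:
      "\<And>t \<omega>. 0 < t \<Longrightarrow> \<omega> \<in> space M \<Longrightarrow> \<exists>l. ((\<lambda>s. X s \<omega>) \<longlongrightarrow> l) (at_left t)"
    and characteristic_function:
      "\<And>t \<xi>. 0 \<le> t \<Longrightarrow> char (distr M borel (X t)) \<xi> = complex_of_real (exp (- t * \<bar>\<xi>\<bar>))"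

definition feynman_kac ::
  "'w measure \<Rightarrow> (real \<Rightarrow> 'w \<Rightarrow> real) \<Rightarrow> real \<Rightarrow> (real \<Rightarrow> complex) \<Rightarrow> real \<Rightarrow> complex" where
  "feynman_kac M X t f x =
     (LINT \<omega>|M. complex_of_real (exp (- (LBINT s:{0..t}. (x + X s \<omega>)\<^sup>2))) * f (x + X t \<omega>))"

text \<open>
  Elements of \<open>L\<^sup>2(R)\<close> are represented by functions; linear operators are represented by their
  graphs, which are closed under almost-everywhere equality.
\<close>

definition L2 :: "(real \<Rightarrow> complex) set" where
  "L2 = {f \<in> borel_measurable borel. integrable lborel (\<lambda>x. (norm (f x))\<^sup>2)}"

text \<open>
  For a self-adjoint \<open>H\<close> that is bounded below, \<open>exp (- t H) = T t\<close> for all \<open>t \<ge> 0\<close> means that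
  \<open>-H\<close> is the infinitesimal generator of the strongly continuous semigroup \<open>T\<close>. Hence
  \<open>H f = g\<close> iff \<open>(f - T t f) / t\<close> tends to \<open>g\<close> in \<open>L\<^sup>2\<close> as \<open>t\<close> decreases to \<open>0\<close>, and the domain
  consists of the \<open>f\<close> for which this limit exists. For the Feynman-Kac semigroup of the Cauchy
  process with potential \<open>x\<^sup>2\<close> this operator is \<open>(-d\<^sup>2/dx\<^sup>2)\<^bsup>1/2\<^esup> + x\<^sup>2\<close>. The squared norm is taken as
  an extended nonnegative integral, so that it cannot vanish by failure of integrability.
\<close>

definition hamiltonian ::
  "'w measure \<Rightarrow> (real \<Rightarrow> 'w \<Rightarrow> real) \<Rightarrow> ((real \<Rightarrow> complex) \<times> (real \<Rightarrow> complex)) set" where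
  "hamiltonian M X = {(f, g). f \<in> L2 \<and> g \<in> L2 \<and>
     ((\<lambda>t. \<integral>\<^sup>+ x. ennreal ((norm ((f x - feynman_kac M X t f x) / of_real t - g x))\<^sup>2) \<partial>lborel)
        \<longlongrightarrow> 0) (at_right 0)}"

definition eigenspace ::
  "((real \<Rightarrow> complex) \<times> (real \<Rightarrow> complex)) set \<Rightarrow> real \<Rightarrow> (real \<Rightarrow> complex) set" where
  "eigenspace H \<mu> = {f. (f, \<lambda>x. of_real \<mu> * f x) \<in> H}"

text \<open>Linear independence of the classes of \<open>f 0, \<dots>, f (n - 1)\<close> modulo null functions.\<close>

definition L2_independent :: "nat \<Rightarrow> (nat \<Rightarrow> real \<Rightarrow> complex) \<Rightarrow> bool" where
  "L2_independent n f \<longleftrightarrow>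
     (\<forall>c :: nat \<Rightarrow> complex. (AE x in lborel. (\<Sum>i<n. c i * f i x) = 0) \<longrightarrow> (\<forall>i<n. c i = 0))"

definition eigenvalue_multiplicity ::
  "((real \<Rightarrow> complex) \<times> (real \<Rightarrow> complex)) set \<Rightarrow> real \<Rightarrow> enat" where
  "eigenvalue_multiplicity H \<mu> =
     Sup {enat n | n. \<exists>f. (\<forall>i<n. f i \<in> eigenspace H \<mu>) \<and> L2_independent n f}"

text \<open>
  \<open>lam 1 \<le> lam 2 \<le> \<dots>\<close> lists all eigenvalues of \<open>H\<close>, each repeated according to its multiplicity;
  the value \<open>lam 0\<close> is irrelevant.
\<close>

definition eigenvalue_enumeration ::
  "((real \<Rightarrow> complex) \<times> (real \<Rightarrow> complex)) set \<Rightarrow> (nat \<Rightarrow> real) \<Rightarrow> bool" where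
  "eigenvalue_enumeration H lam \<longleftrightarrow>
     (\<forall>n\<ge>1. lam n \<le> lam (Suc n)) \<and>
     filterlim lam at_top sequentially \<and>
     (\<forall>\<mu>. eigenvalue_multiplicity H \<mu> = enat (card {n. 1 \<le> n \<and> lam n = \<mu>}))"

end

theory Submission
  imports Defs "HOL-Real_Asymp.Real_Asymp"
begin

text \<open>
  In momentum space \<open>H\<close> is the Airy operator \<open>- u'' + \<bar>k\<bar> u\<close>. Let \<open>a\<close> be the decaying solution of
  \<open>a'' = x a\<close>. Then \<open>\<lambda>\<^sub>1\<close> is minus the largest zero of \<open>a'\<close>, and \<open>\<lambda>\<^sub>2\<close> is minus the largest zero of \<open>a\<close>.
  A Gaussian trial function gives \<open>\<lambda>\<^sub>1 \<le> 6/5\<close>, and a Sturm comparison starting at \<open>- \<lambda>\<^sub>1\<close> shows that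
  \<open>a\<close> is positive on \<open>[- \<lambda>\<^sub>1 - 121/100, \<infinity>)\<close>. As \<open>121/100\<close> exceeds the claimed constant, it remains
  to identify the eigenvalues below \<open>\<lambda>\<^sub>1 + 121/100\<close>.

  If \<open>\<phi>\<close> is the Fourier transform of a profile \<open>u\<close> (twice differentiable, rapidly decaying, with
  Lipschitz second derivative), then \<open>(\<phi> - T\<^sub>t \<phi>) / t\<close> converges in \<open>L\<^sup>2\<close> to the transform of
  \<open>\<bar>k\<bar> u - u''\<close>. The same holds for the adjoint of \<open>T\<^sub>t\<close>, which is the Feynman-Kac operator of the
  time-reversed process. Hence the transform of \<open>a (\<bar>k\<bar> - \<lambda>\<^sub>1)\<close> is an eigenfunction for \<open>\<lambda>\<^sub>1\<close>, and an
  eigenfunction for \<open>\<mu>\<close> is orthogonal to the transform of \<open>h\<close> whenever \<open>- u'' + (\<bar>k\<bar> - \<mu>) u = h\<close> is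
  solved by a profile. For \<open>\<mu> < \<lambda>\<^sub>1 + 121/100\<close> and every tent function \<open>h\<close>, orthogonal to the ground
  state if \<open>\<mu> = \<lambda>\<^sub>1\<close>, variation of constants provides such a solution, and transforms of tent functions
  separate points of \<open>L\<^sup>2\<close>. So there is no eigenfunction for \<open>\<mu> \<noteq> \<lambda>\<^sub>1\<close>, and \<open>\<lambda>\<^sub>1\<close> is simple.
\<close>

section \<open>Airy functions and the equation in momentum space\<close>

text \<open>No zero of an Airy function has to be computed. Seen from \<open>- l\<close>, the
  solution obeys \<open>y'' = - (l + s) y\<close> with zero slope at the start, and a larger
  \<open>l\<close> only brings the first zero closer; hence an upper bound on \<open>l\<close>
  suffices. The true gap is about 1.32 and the claimed constant about 1.205, so the rational number
  121/100 between them leaves room for polynomial certificates.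

  The main obstacle is analytic. The operator is known only through difference quotients of a
  stochastic semigroup, and \<open>x^2\<close> has infinite expectation under the Cauchy law, so the
  loss \<open>1 - exp (- A)\<close> cannot be linearised for arbitrary test functions. It can be if
  the test function decays cubically, because a path that has jumped far away must also end where
  the function is not small. The kink of \<bar>k\<bar> allows no more than a Lipschitz second
  derivative in momentum space, and this gives just such decay.

  Eigenfunctions below the threshold are excluded by solvability: if enough right-hand sides are
  attained on nice functions, an eigenfunction paired with all of them vanishes.\<close>

lemma DERIV_glue_at_0:
  fixes f g :: "real \<Rightarrow> real"
  assumes f: "\<And>x. (f has_real_derivative f' x) (at x)" and g: "\<And>x. (g has_real_derivative g' x) (at x)"
    and eq: "f 0 = g 0" "f' 0 = g' 0"
  shows "((\<lambda>x. if x \<ge> 0 then f x else g x) has_real_derivative (if x \<ge> 0 then f' x else g' x)) (at x)"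
    (is "(?h has_real_derivative _) _")
proof -
  consider "x > 0" | "x < 0" | "x = 0" by linarith
  then show ?thesis
  proof cases
    case 1
    have "(?h has_real_derivative f' x) (at x)"
      by (rule has_field_derivative_transform_within_open[OF f, where S = "{0<..}"]) (use 1 in auto)
    with 1 show ?thesis by simp
  next
    case 2
    have "(?h has_real_derivative g' x) (at x)"
      by (rule has_field_derivative_transform_within_open[OF g, where S = "{..<0}"]) (use 2 in auto)
    with 2 show ?thesis by simp
  next
    case 3
    have F: "((\<lambda>y. (f y - f 0) / (y - 0)) \<longlongrightarrow> f' 0) (at 0)"
      using f[of 0] by (simp add: has_field_derivative_iff)
    have G: "((\<lambda>y. (g y - g 0) / (y - 0)) \<longlongrightarrow> f' 0) (at 0)"
      using g[of 0] eq by (simp add: has_field_derivative_iff)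
    have "((\<lambda>y. (?h y - ?h 0) / (y - 0)) \<longlongrightarrow> f' 0) (at 0)"
    proof (rule filterlim_split_at)
      have "((\<lambda>y. (g y - g 0) / (y - 0)) \<longlongrightarrow> f' 0) (at_left 0)"
        using G filterlim_at_split by blast
      moreover have "\<forall>\<^sub>F y in at_left 0. (g y - g 0) / (y - 0) = (?h y - ?h 0) / (y - 0)"
        using eq by (auto simp: eventually_at_filter)
      ultimately show "((\<lambda>y. (?h y - ?h 0) / (y - 0)) \<longlongrightarrow> f' 0) (at_left 0)"
        by (rule Lim_transform_eventually)
      have "((\<lambda>y. (f y - f 0) / (y - 0)) \<longlongrightarrow> f' 0) (at_right 0)"
        using F filterlim_at_split by blast
      moreover have "\<forall>\<^sub>F y in at_right 0. (f y - f 0) / (y - 0) = (?h y - ?h 0) / (y - 0)"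
        using eq by (auto simp: eventually_at_filter)
      ultimately show "((\<lambda>y. (?h y - ?h 0) / (y - 0)) \<longlongrightarrow> f' 0) (at_right 0)"
        by (rule Lim_transform_eventually)
    qed
    with 3 show ?thesis by (simp add: has_field_derivative_iff)
  qed
qed

text \<open>
  The momentum-space functions whose Fourier transforms serve as test functions. The third derivative
  may jump, at \<open>0\<close> because of \<open>\<bar>k\<bar>\<close> and at the kinks of \<open>tent\<close>; hence the Lipschitz condition on \<open>u''\<close>.
\<close>

definition profile :: "(real \<Rightarrow> real) \<Rightarrow> (real \<Rightarrow> real) \<Rightarrow> (real \<Rightarrow> real) \<Rightarrow> bool" where
  "profile u u' u'' \<longleftrightarrow>
     (\<forall>k. (u has_real_derivative u' k) (at k)) \<and> (\<forall>k. (u' has_real_derivative u'' k) (at k)) \<and>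
     (\<exists>C. \<forall>k. \<bar>u k\<bar> \<le> C * exp (- \<bar>k\<bar> / 2) \<and> \<bar>u' k\<bar> \<le> C * exp (- \<bar>k\<bar> / 2) \<and>
        \<bar>u'' k\<bar> \<le> C * exp (- \<bar>k\<bar> / 2) \<and>
        (\<forall>d\<in>{0..1}. \<bar>u'' (k + d) - u'' k\<bar> \<le> C * d * exp (- \<bar>k\<bar> / 2)))"

section \<open>Linear second-order equations and their Wronskians\<close>

definition ode_solution :: "(real \<Rightarrow> real) \<Rightarrow> (real \<Rightarrow> real) \<Rightarrow> (real \<Rightarrow> real) \<Rightarrow> bool" where
  "ode_solution V y y' \<longleftrightarrow>
     (\<forall>x. (y has_real_derivative y' x) (at x)) \<and> (\<forall>x. (y' has_real_derivative V x * y x) (at x))"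

lemma ode_solutionD:
  assumes "ode_solution V y y'"
  shows "(y has_real_derivative y' x) (at x)" "(y' has_real_derivative V x * y x) (at x)"
  using assms by (auto simp: ode_solution_def)

lemma ode_solution_combine:
  assumes "ode_solution V y y'" "ode_solution V z z'"
  shows "ode_solution V (\<lambda>x. c * y x + d * z x) (\<lambda>x. c * y' x + d * z' x)"
  unfolding ode_solution_def
  by (auto intro!: derivative_eq_intros ode_solutionD[OF assms(1)] ode_solutionD[OF assms(2)]
      simp: algebra_simps)

lemma ode_solution_continuous:
  assumes "ode_solution V y y'"
  shows "continuous_on S y" "continuous_on S y'"
  by (auto intro!: continuous_at_imp_continuous_on DERIV_isCont ode_solutionD[OF assms])

lemma wronskian_constant:
  assumes "ode_solution V y y'" "ode_solution V z z'"
  shows "y x * z' x - y' x * z x = y 0 * z' 0 - y' 0 * z 0"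
proof -
  have "((\<lambda>x. y x * z' x - y' x * z x) has_real_derivative 0) (at x)" for x
    by (auto intro!: derivative_eq_intros ode_solutionD[OF assms(1)] ode_solutionD[OF assms(2)]
        simp: algebra_simps)
  then show ?thesis
    using DERIV_isconst_all[of "\<lambda>x. y x * z' x - y' x * z x"] by blast
qed

section \<open>Entire solutions of \<open>y'' = x y\<close> by power series\<close>

fun airy_coeff :: "real \<Rightarrow> real \<Rightarrow> nat \<Rightarrow> real" where
  "airy_coeff A B 0 = A"
| "airy_coeff A B (Suc 0) = B"
| "airy_coeff A B (Suc (Suc 0)) = 0"
| "airy_coeff A B (Suc (Suc (Suc n))) = airy_coeff A B n / ((real n + 3) * (real n + 2))"

text \<open>Passing from \<open>n\<close> to \<open>n + 3\<close> multiplies the term by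
  \<open>R ^ 3 / ((n + 3) * (n + 2))\<close>, which is at most 1 once \<open>n\<close> reaches
  \<open>N\<close>. The sum of the finitely many earlier terms therefore bounds all of them.\<close>

lemma airy_coeff_bound:
  assumes "R \<ge> 1"
  obtains C where "\<And>n. \<bar>airy_coeff A B n\<bar> * R ^ n \<le> C"
proof -
  obtain N :: nat where N: "R ^ 3 \<le> real N" using real_arch_simple by blast
  define C where "C = (\<Sum>i\<le>N+2. \<bar>airy_coeff A B i\<bar> * R ^ i)"
  have "\<bar>airy_coeff A B n\<bar> * R ^ n \<le> C" for n
  proof (induction n rule: less_induct)
    case (less n)
    show ?case
    proof (cases "n \<le> N + 2")
      case True
      show ?thesis unfolding C_def
        by (rule member_le_sum) (use True assms in auto)
    next
      case False
      then obtain m where m: "n = Suc (Suc (Suc m))" "m \<ge> N"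
        by (intro that[of "n - 3"]) auto
      have "R ^ 3 \<le> (real m + 3) * (real m + 2)"
      proof -
        have "real m * 1 \<le> (real m + 3) * (real m + 2)" by (rule mult_mono) auto
        then show ?thesis using N m(2) by linarith
      qed
      then have le1: "R ^ 3 / ((real m + 3) * (real m + 2)) \<le> 1" by simp
      have "\<bar>airy_coeff A B n\<bar> * R ^ n
          = (\<bar>airy_coeff A B m\<bar> * R ^ m) * (R ^ 3 / ((real m + 3) * (real m + 2)))"
        unfolding m by (simp add: abs_mult power3_eq_cube)
      also have "\<dots> \<le> (\<bar>airy_coeff A B m\<bar> * R ^ m) * 1"
        by (rule mult_left_mono[OF le1]) (use assms in auto)
      also have "\<dots> \<le> C" using less.IH[of m] m by simp
      finally show ?thesis .
    qed
  qed
  then show ?thesis using that by blast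
qed

lemma airy_coeff_summable: "summable (\<lambda>n. airy_coeff A B n * x ^ n)"
proof -
  \<comment> \<open>A radius at least 1 and larger than \<bar>x\<bar>, so that the bound at
    \<open>R\<close> dominates the series by a geometric one of ratio
    \<open>\<bar>x\<bar> / R\<close>.\<close>
  define R where "R = 2 * \<bar>x\<bar> + 1"
  have R: "R \<ge> 1" by (simp add: R_def)
  obtain C where C: "\<And>n. \<bar>airy_coeff A B n\<bar> * R ^ n \<le> C"
    using airy_coeff_bound[OF R] by blast
  have "norm (\<bar>x\<bar> / R) < 1" using R by (simp add: R_def divide_simps)
  then have s: "summable (\<lambda>n. C * (\<bar>x\<bar> / R) ^ n)"
    by (intro summable_mult summable_geometric)
  show ?thesis
  proof (rule summable_comparison_test'[OF s])
    fix n :: nat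
    have "\<bar>airy_coeff A B n\<bar> * \<bar>x\<bar> ^ n = (\<bar>airy_coeff A B n\<bar> * R ^ n) * (\<bar>x\<bar> / R) ^ n"
      using R by (simp add: power_divide)
    also have "\<dots> \<le> C * (\<bar>x\<bar> / R) ^ n"
      by (rule mult_right_mono[OF C]) (use R in simp)
    finally show "norm (airy_coeff A B n * x ^ n) \<le> C * (\<bar>x\<bar> / R) ^ n"
      by (simp add: abs_mult power_abs)
  qed
qed

lemma airy_solution_exists:
  obtains y y' where "ode_solution (\<lambda>x. x) y y'" "y 0 = A" "y' 0 = B"
proof -
  define c where "c = airy_coeff A B"
  define y where "y = (\<lambda>x. \<Sum>n. c n * x ^ n)"
  define y' where "y' = (\<lambda>x. \<Sum>n. diffs c n * x ^ n)"
  have s0: "summable (\<lambda>n. c n * x ^ n)" for x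
    unfolding c_def by (rule airy_coeff_summable)
  have s1: "summable (\<lambda>n. diffs c n * x ^ n)" for x
    using termdiff_converges_all[OF s0] by blast
  have s2: "summable (\<lambda>n. diffs (diffs c) n * x ^ n)" for x
    using termdiff_converges_all[OF s1] by blast
  have d1: "(y has_real_derivative y' x) (at x)" for x
    unfolding y_def y'_def by (rule termdiffs_strong_converges_everywhere[OF s0])
  have d2: "(y' has_real_derivative (\<Sum>n. diffs (diffs c) n * x ^ n)) (at x)" for x
    unfolding y'_def by (rule termdiffs_strong_converges_everywhere[OF s1])
  have "(\<Sum>n. diffs (diffs c) n * x ^ n) = x * y x" for x
  proof -
    have "(\<Sum>n. diffs (diffs c) n * x ^ n) =
        (\<Sum>n. diffs (diffs c) (Suc n) * x ^ Suc n) + diffs (diffs c) 0 * x ^ 0"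
      using suminf_split_head[OF s2, of x] by simp
    also have "diffs (diffs c) 0 * x ^ 0 = 0"
      by (simp add: diffs_def c_def numeral_eq_Suc)
    also have "(\<lambda>n. diffs (diffs c) (Suc n) * x ^ Suc n) = (\<lambda>n. x * (c n * x ^ n))"
    proof
      fix n
      have "diffs (diffs c) (Suc n) = (real n + 2) * ((real n + 3) * c (Suc (Suc (Suc n))))"
        by (simp add: diffs_def algebra_simps)
      also have "\<dots> = c n" by (simp add: c_def divide_simps)
      finally show "diffs (diffs c) (Suc n) * x ^ Suc n = x * (c n * x ^ n)" by simp
    qed
    also have "(\<Sum>n. x * (c n * x ^ n)) = x * y x"
      unfolding y_def by (rule suminf_mult[OF s0])
    finally show ?thesis by simp
  qed
  then have "ode_solution (\<lambda>x. x) y y'"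
    using d1 d2 by (simp add: ode_solution_def)
  moreover have "y 0 = A" "y' 0 = B"
    by (simp_all add: y_def y'_def c_def diffs_def)
  ultimately show ?thesis using that by blast
qed

text \<open>The product \<open>y * y'\<close> has derivative \<open>y' * y' + V * (y * y)\<close>,
  which is nonnegative whatever the sign of \<open>y\<close>. So \<open>y * y\<close> cannot
  decrease, \<open>y\<close> cannot reach 0, and only then is the sign of \<open>y''\<close>
  known.\<close>

lemma ode_solution_growth:
  assumes sol: "ode_solution V y y'" and V: "\<And>x. x \<ge> x0 \<Longrightarrow> V x \<ge> 0"
    and y0: "y x0 > 0" "y' x0 \<ge> 0" and x: "x \<ge> x0"
  shows "y x \<ge> y x0" "y' x \<ge> y' x0"
proof -
  note D = ode_solutionD[OF sol]
  have yy: "y x * y' x \<ge> 0" if "x \<ge> x0" for x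
  proof -
    have "y x0 * y' x0 \<le> y x * y' x"
    proof (rule DERIV_nonneg_imp_nondecreasing[OF that])
      fix t assume t: "x0 \<le> t" "t \<le> x"
      have "((\<lambda>x. y x * y' x) has_real_derivative y' t * y' t + V t * (y t * y t)) (at t)"
        by (auto intro!: derivative_eq_intros D simp: algebra_simps)
      moreover have "0 \<le> y' t * y' t + V t * (y t * y t)" using V[OF t(1)] by simp
      ultimately show "\<exists>d. ((\<lambda>x. y x * y' x) has_real_derivative d) (at t) \<and> 0 \<le> d" by blast
    qed
    moreover have "0 \<le> y x0 * y' x0" using y0 by simp
    ultimately show ?thesis by linarith
  qed
  have ysq: "y x0 * y x0 \<le> y x * y x" if "x \<ge> x0" for x
  proof (rule DERIV_nonneg_imp_nondecreasing[OF that])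
    fix t assume t: "x0 \<le> t" "t \<le> x"
    show "\<exists>d. ((\<lambda>x. y x * y x) has_real_derivative d) (at t) \<and> 0 \<le> d"
      by (rule exI[of _ "2 * (y t * y' t)"])
         (use yy[OF t(1)] in \<open>auto intro!: derivative_eq_intros D simp: algebra_simps\<close>)
  qed
  have pos: "y x > 0" if xx: "x \<ge> x0" for x
  proof (rule ccontr)
    assume "\<not> y x > 0"
    then obtain z where "x0 \<le> z" "z \<le> x" "y z = 0"
      using IVT2'[of y x 0 x0] y0 xx ode_solution_continuous(1)[OF sol] by auto
    with ysq[of z] have "y x0 * y x0 \<le> 0" by simp
    moreover have "y x0 * y x0 > 0" using y0(1) by simp
    ultimately show False by linarith
  qed
  show "y x \<ge> y x0"
    using ysq[OF x] pos[OF x] y0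
    by (metis abs_le_square_iff abs_of_pos power2_eq_square)
  show "y' x \<ge> y' x0"
  proof (rule DERIV_nonneg_imp_nondecreasing[OF x])
    fix t assume t: "x0 \<le> t" "t \<le> x"
    show "\<exists>d. (y' has_real_derivative d) (at t) \<and> 0 \<le> d"
      by (rule exI[of _ "V t * y t"]) (use D V[OF t(1)] pos[OF t(1)] in auto)
  qed
qed

text \<open>For the fundamental system \<open>f\<close>, \<open>g\<close> with Wronskian 1 the
  quotient \<open>q = g / f\<close> increases, with derivative \<open>1 / (f * f)\<close>, and is
  bounded. With \<alpha> its supremum, \<open>\<alpha> * f - g = f * (\<alpha> - q)\<close> is
  positive and becomes small compared with \<open>f\<close>: it is the recessive solution, a
  multiple of Ai.\<close>

lemma airy_decaying_exists:
  obtains a a' where "ode_solution (\<lambda>x. x) a a'"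
    "\<And>x. x \<ge> 0 \<Longrightarrow> a x > 0" "\<And>x. x \<ge> 0 \<Longrightarrow> a' x < 0"
    "\<exists>C. \<forall>x\<ge>0. a x \<le> C * exp (- x) \<and> \<bar>a' x\<bar> \<le> C * exp (- x)"
proof -
  obtain f f' where f: "ode_solution (\<lambda>x. x) f f'" and f0: "f 0 = 1" "f' 0 = 0"
    using airy_solution_exists by blast
  obtain g g' where g: "ode_solution (\<lambda>x. x) g g'" and g0: "g 0 = 0" "g' 0 = 1"
    using airy_solution_exists by blast
  note Df = ode_solutionD[OF f] and Dg = ode_solutionD[OF g]
  have f1: "f x \<ge> 1" "f' x \<ge> 0" if "x \<ge> 0" for x
    using ode_solution_growth[OF f, of 0 x] f0 that by auto
  have W: "f x * g' x - f' x * g x = 1" for x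
    using wronskian_constant[OF f g, of x] f0 g0 by simp
  define q where "q = (\<lambda>x. g x / f x)"
  have Dq: "(q has_real_derivative 1 / (f x * f x)) (at x)" if "x \<ge> 0" for x
  proof -
    have "f x \<noteq> 0" using f1(1)[OF that] by linarith
    then have "(q has_real_derivative (g' x * f x - g x * f' x) / (f x * f x)) (at x)"
      unfolding q_def by (auto intro!: derivative_eq_intros Df Dg)
    moreover have "g' x * f x - g x * f' x = 1" using W[of x] by (simp add: algebra_simps)
    ultimately show ?thesis by simp
  qed
  have q_mono: "q x < q y" if "0 \<le> x" "x < y" for x y
  proof (rule DERIV_pos_imp_increasing[OF that(2)])
    fix t assume "x \<le> t" "t \<le> y"
    with that have "t \<ge> 0" by simp
    then show "\<exists>d. (q has_real_derivative d) (at t) \<and> 0 < d"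
      using Dq[of t] f1(1)[of t] by (intro exI[of _ "1 / (f t * f t)"]) auto
  qed
  have f'1: "f' 1 \<ge> 1 / 2"
  proof -
    have "f' 0 - 0\<^sup>2 / 2 \<le> f' 1 - 1\<^sup>2 / (2::real)"
    proof (rule DERIV_nonneg_imp_nondecreasing[where f = "\<lambda>x. f' x - x\<^sup>2 / 2"])
      fix t :: real assume t: "0 \<le> t" "t \<le> 1"
      have "((\<lambda>x. f' x - x\<^sup>2 / 2) has_real_derivative t * f t - t) (at t)"
        by (auto intro!: derivative_eq_intros Df)
      moreover have "0 \<le> t * f t - t" using f1(1)[OF t(1)] t(1)
        by (simp add: mult_le_cancel_left1)
      ultimately show "\<exists>d. ((\<lambda>x. f' x - x\<^sup>2 / 2) has_real_derivative d) (at t) \<and> 0 \<le> d" by blast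
    qed simp
    then show ?thesis using f0 by simp
  qed
  \<comment> \<open>Large enough for \<open>K * f - g\<close> to start at 1 with positive value and
    nonnegative slope, so that it stays positive and \<open>q \<le> K\<close>. The start is 1
    because the slope of \<open>f\<close> vanishes at 0; at 1 it is at least 1/2, which explains the
    factor 2.\<close>
  define K where "K = \<bar>g 1\<bar> + 2 * \<bar>g' 1\<bar> + 1"
  have q_bdd: "q x \<le> K" if "x \<ge> 0" for x
  proof -
    have sol: "ode_solution (\<lambda>x. x) (\<lambda>x. K * f x + (-1) * g x) (\<lambda>x. K * f' x + (-1) * g' x)"
      by (rule ode_solution_combine[OF f g])
    have Kb: "g 1 < K" "\<bar>g' 1\<bar> * 2 \<le> K" "K > 0" by (auto simp: K_def)
    have K1: "K * 1 \<le> K * f 1" by (rule mult_left_mono) (use f1 in \<open>auto simp: K_def\<close>)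
    have K2: "K * (1 / 2) \<le> K * f' 1" by (rule mult_left_mono[OF f'1]) (auto simp: K_def)
    have big: "q x \<le> K" if "x \<ge> 1" for x
    proof -
      have "K * f x + (-1) * g x \<ge> K * f 1 + (-1) * g 1"
        by (rule ode_solution_growth(1)[OF sol _ _ _ that])
           (insert K1 K2 Kb, linarith+)
      moreover have "K * f 1 - g 1 \<ge> 0" using K1 Kb by linarith
      ultimately have "g x \<le> K * f x" by simp
      then show ?thesis unfolding q_def using f1(1)[of x] that by (simp add: divide_simps)
    qed
    show ?thesis
    proof (cases "x \<ge> 1")
      case False
      then have "q x \<le> q 1" using q_mono[of x 1] that by simp
      with big[of 1] show ?thesis by simp
    qed (rule big)
  qed
  have bdd: "bdd_above (q ` {0..})" using q_bdd by (auto intro!: bdd_aboveI)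
  define \<alpha> where "\<alpha> = (SUP x\<in>{0..}. q x)"
  have q_less: "q x < \<alpha>" if "x \<ge> 0" for x
  proof -
    have "q x < q (x + 1)" using q_mono that by simp
    also have "\<dots> \<le> \<alpha>" unfolding \<alpha>_def by (rule cSUP_upper[OF _ bdd]) (use that in auto)
    finally show ?thesis .
  qed
  have q_close: "\<exists>x\<ge>x0. q x > \<alpha> - e" if e: "e > 0" and x0: "x0 \<ge> 0" for e x0
  proof -
    have "\<alpha> - e < (SUP x\<in>{0..}. q x)" using e by (simp add: \<alpha>_def)
    then obtain z where z: "z \<ge> 0" "\<alpha> - e < q z"
      using less_cSUP_iff[OF _ bdd] by auto
    have "q z \<le> q (max z x0)" using q_mono[of z "max z x0"] z by (cases "z < x0") auto
    with z show ?thesis by (intro exI[of _ "max z x0"]) auto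
  qed
  define a where "a = (\<lambda>x. \<alpha> * f x + (-1) * g x)"
  define a' where "a' = (\<lambda>x. \<alpha> * f' x + (-1) * g' x)"
  have a: "ode_solution (\<lambda>x. x) a a'"
    unfolding a_def a'_def by (rule ode_solution_combine[OF f g])
  note Da = ode_solutionD[OF a]
  have a_q: "a x = f x * (\<alpha> - q x)" if "x \<ge> 0" for x
    using f1(1)[OF that] by (simp add: a_def q_def algebra_simps)
  have apos: "a x > 0" if "x \<ge> 0" for x
    using a_q[OF that] q_less[OF that] f1(1)[OF that] by simp
  have a_small: "\<exists>x\<ge>x0. a x < e * f x" if e: "e > 0" and x0: "x0 \<ge> 0" for e x0
  proof -
    obtain x where x: "x \<ge> x0" "q x > \<alpha> - e" using q_close[OF e x0] by blast
    then have "a x < f x * e"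
      unfolding a_q[OF order_trans[OF x0 x(1)]]
      using f1(1)[of x] x0 by (intro mult_strict_left_mono) auto
    then show ?thesis using x by (auto simp: mult.commute)
  qed
  have a'_le: "a' x0 \<le> 0" if x0: "x0 \<ge> 0" for x0
  proof (rule ccontr)
    assume n: "\<not> a' x0 \<le> 0"
    \<comment> \<open>Small enough that \<open>a - e * f\<close> still has positive value and
      nonnegative slope at \<open>x0\<close>. It would then stay positive, whereas
      \<open>a < e * f\<close> somewhere beyond every point.\<close>
    define e where "e = min (a x0 / (2 * f x0)) (a' x0 / (f' x0 + 1))"
    have e: "e > 0" using n apos[OF x0] f1[OF x0] by (auto simp: e_def)
    have "e * f x0 \<le> a x0 / (2 * f x0) * f x0"
      by (rule mult_right_mono) (use f1[OF x0] in \<open>auto simp: e_def\<close>)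
    then have e1: "a x0 - e * f x0 > 0" using apos[OF x0] f1(1)[OF x0] by simp
    have "e * (f' x0 + 1) \<le> a' x0 / (f' x0 + 1) * (f' x0 + 1)"
      by (rule mult_right_mono) (use f1[OF x0] in \<open>auto simp: e_def\<close>)
    then have "e * (f' x0 + 1) \<le> a' x0" using f1(2)[OF x0] by simp
    then have e2: "a' x0 - e * f' x0 \<ge> 0" using e by (simp add: algebra_simps)
    have sol: "ode_solution (\<lambda>x. x) (\<lambda>x. 1 * a x + (-e) * f x) (\<lambda>x. 1 * a' x + (-e) * f' x)"
      by (rule ode_solution_combine[OF a f])
    have "1 * a x + (-e) * f x > 0" if "x \<ge> x0" for x
      using ode_solution_growth(1)[OF sol, of x0 x] e1 e2 x0 that by auto
    with a_small[OF e x0] show False by force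
  qed
  have a'_mono: "a' x < a' y" if xy: "0 \<le> x" "x < y" for x y
  proof -
    obtain z where z: "x < z" "z < y" "a' y - a' x = (y - x) * (z * a z)"
      using MVT2[OF xy(2), of a' "\<lambda>z. z * a z"] Da by blast
    have "z * a z > 0" using apos[of z] z that by simp
    then show ?thesis using z that by (smt (verit) mult_pos_pos)
  qed
  have a'_neg: "a' x < 0" if "x \<ge> 0" for x
    using a'_mono[OF that, of "x + 1"] a'_le[of "x + 1"] that by simp
  have a_decr: "a x \<ge> a y" if "0 \<le> x" "x \<le> y" for x y
  proof (rule DERIV_nonpos_imp_nonincreasing[OF that(2)])
    fix t assume "x \<le> t" "t \<le> y"
    then show "\<exists>d. (a has_real_derivative d) (at t) \<and> d \<le> 0"
      using Da(1)[of t] a'_le[of t] that by auto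
  qed
  have q_le: "a' x0 + a x0 \<le> 0" if x0: "x0 \<ge> 1" for x0
  proof (rule ccontr)
    assume n: "\<not> a' x0 + a x0 \<le> 0"
    define r where "r = a' x0 + a x0"
    have r: "r > 0" using n by (simp add: r_def)
    \<comment> \<open>Chosen so that the linear lower bound of the exponential already gives
      \<open>r * (1 + (x - x0)) = r + a 0\<close>, more than \<open>a' + a \<le> a 0\<close>
      allows.\<close>
    define x where "x = x0 + a 0 / r"
    have a0: "a 0 > 0" using apos by simp
    have x: "x \<ge> x0" using a0 r by (simp add: x_def)
    have "(a' x0 + a x0) * exp (- x0) \<le> (a' x + a x) * exp (- x)"
    proof (rule DERIV_nonneg_imp_nondecreasing[OF x])
      fix t assume t: "x0 \<le> t" "t \<le> x"
      have "((\<lambda>x. (a' x + a x) * exp (- x)) has_real_derivative (t - 1) * a t * exp (- t)) (at t)"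
        by (auto intro!: derivative_eq_intros Da simp: algebra_simps)
      moreover have "(t - 1) * a t * exp (- t) \<ge> 0" using t x0 apos[of t] by simp
      ultimately show "\<exists>d. ((\<lambda>x. (a' x + a x) * exp (- x)) has_real_derivative d) (at t) \<and> 0 \<le> d"
        by blast
    qed
    then have "r * exp (x - x0) \<le> a' x + a x"
      by (simp add: r_def exp_diff exp_minus field_simps)
    moreover have "r * exp (x - x0) \<ge> r * (1 + (x - x0))"
      by (rule mult_left_mono[OF exp_ge_add_one_self]) (use r in simp)
    moreover have "r * (1 + (x - x0)) = r + a 0" using r by (simp add: x_def field_simps)
    moreover have "a' x + a x \<le> a 0" using a'_le[of x] a_decr[of 0 x] x x0 by simp
    ultimately show False using r by linarith
  qed
  have ae: "a x \<le> a 0 * exp 1 * exp (- x)" if x: "x \<ge> 0" for x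
  proof (cases "x \<ge> 1")
    case True
    have "a x * exp x \<le> a 1 * exp 1"
    proof (rule DERIV_nonpos_imp_nonincreasing[OF True])
      fix t assume t: "1 \<le> t" "t \<le> x"
      have "((\<lambda>x. a x * exp x) has_real_derivative (a' t + a t) * exp t) (at t)"
        by (auto intro!: derivative_eq_intros Da simp: algebra_simps)
      moreover have "(a' t + a t) * exp t \<le> 0" using q_le[OF t(1)] by (simp add: mult_nonpos_nonneg)
      ultimately show "\<exists>d. ((\<lambda>x. a x * exp x) has_real_derivative d) (at t) \<and> d \<le> 0" by blast
    qed
    also have "\<dots> \<le> a 0 * exp 1" using a_decr[of 0 1] by simp
    finally show ?thesis by (simp add: exp_minus divide_simps)
  next
    case False
    have "a x \<le> a 0 * 1" using a_decr[of 0 x] x by simp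
    also have "\<dots> \<le> a 0 * exp (1 - x)"
      by (rule mult_left_mono) (use False apos[of 0] in auto)
    finally show ?thesis by (simp add: exp_diff exp_minus divide_simps)
  qed
  define C where "C = a 0 * exp 1 * exp 1 + \<bar>a' 0\<bar> * exp 1"
  have C1: "a 0 * exp 1 \<le> C"
  proof -
    have "a 0 * exp 1 * 1 \<le> a 0 * exp 1 * exp 1"
      by (rule mult_left_mono) (use apos[of 0] in auto)
    then show ?thesis unfolding C_def by (smt (verit) mult_nonneg_nonneg abs_ge_zero exp_ge_zero)
  qed
  have a'e: "\<bar>a' x\<bar> \<le> C * exp (- x)" if x: "x \<ge> 0" for x
  proof (cases "x \<ge> 1")
    case True
    \<comment> \<open>As \<open>a'\<close> increases, \<open>- a' x\<close> is at most the mean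
      decrease of \<open>a\<close> over \<open>{x - 1..x}\<close>, hence at most
      \<open>a (x - 1)\<close>. The shift by 1 costs a factor \<open>exp 1\<close>.\<close>
    obtain z where z: "x - 1 < z" "z < x" "a x - a (x - 1) = (x - (x - 1)) * a' z"
      using MVT2[of "x - 1" x a a'] Da by auto
    have "- a' x \<le> - a' z" using a'_mono[of z x] z True by simp
    also have "\<dots> \<le> a (x - 1)" using z apos[OF x] by simp
    also have "\<dots> \<le> a 0 * exp 1 * exp (- (x - 1))" using ae[of "x - 1"] True by simp
    also have "\<dots> = a 0 * exp 1 * exp 1 * exp (- x)" by (simp add: exp_diff exp_minus divide_simps)
    also have "\<dots> \<le> C * exp (- x)" by (rule mult_right_mono) (auto simp: C_def)
    finally show ?thesis using a'_le[OF x] by simp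
  next
    case False
    have "\<bar>a' x\<bar> \<le> \<bar>a' 0\<bar> * 1" using a'_mono[of 0 x] a'_le[of x] a'_le[of 0] x by (cases "x = 0") auto
    also have "\<dots> \<le> \<bar>a' 0\<bar> * exp (1 - x)" by (rule mult_left_mono) (use False in auto)
    also have "\<dots> = \<bar>a' 0\<bar> * exp 1 * exp (- x)" by (simp add: exp_diff exp_minus divide_simps)
    also have "\<dots> \<le> C * exp (- x)" by (rule mult_right_mono) (use apos[of 0] in \<open>auto simp: C_def\<close>)
    finally show ?thesis .
  qed
  have "a x \<le> C * exp (- x)" if "x \<ge> 0" for x
    using ae[OF that] mult_right_mono[OF C1 exp_ge_zero[of "- x"]] by linarith
  with a'e show ?thesis using that[OF a apos a'_neg] by blast
qed

section \<open>Locating the largest zeros of \<open>a'\<close> and \<open>a\<close>\<close>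

lemma first_zero:
  fixes f :: "real \<Rightarrow> real"
  assumes f: "continuous_on {a..b} f" and fa: "f a > 0" and x: "x \<in> {a..b}" "f x \<le> 0"
  obtains z where "a < z" "z \<le> b" "f z = 0" "\<And>t. a \<le> t \<Longrightarrow> t < z \<Longrightarrow> f t > 0"
proof -
  define Z where "Z = {t \<in> {a..b}. f t = 0}"
  have "closed Z"
    unfolding Z_def by (rule continuous_closed_preimage_constant[OF f]) simp
  moreover have "bounded Z" by (rule bounded_subset[of "{a..b}"]) (auto simp: Z_def)
  ultimately have "compact Z" by (simp add: compact_eq_bounded_closed)
  have fx: "continuous_on {a..x} f" by (rule continuous_on_subset[OF f]) (use x in auto)
  obtain t where t: "a \<le> t" "t \<le> x" "f t = 0"
    using IVT2'[of f x 0 a] fa x fx by auto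
  then have "t \<in> Z" using x by (simp add: Z_def)
  then have "Z \<noteq> {}" by blast
  then obtain z where z: "z \<in> Z" "\<And>t. t \<in> Z \<Longrightarrow> z \<le> t"
    using compact_attains_inf[OF \<open>compact Z\<close>] by blast
  have "f t > 0" if t: "a \<le> t" "t < z" for t
  proof (rule ccontr)
    assume "\<not> f t > 0"
    have ft: "continuous_on {a..t} f" by (rule continuous_on_subset[OF f]) (use t z(1) in \<open>auto simp: Z_def\<close>)
    obtain r where "a \<le> r" "r \<le> t" "f r = 0"
      using IVT2'[of f t 0 a] fa \<open>\<not> f t > 0\<close> t ft by auto
    with z(2)[of r] t z(1) show False by (auto simp: Z_def)
  qed
  moreover have "a < z" using z(1) fa by (cases "a = z") (auto simp: Z_def)
  ultimately show ?thesis using that z(1) by (auto simp: Z_def)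
qed

text \<open>
  The Gaussian with exponent \<open>2/5\<close> is the trial function: it is a subsolution for the
  half-line problem \<open>- y'' + (k - 6/5) y = 0\<close> with Neumann condition at \<open>0\<close>.
\<close>

lemma airy_derivative_zero:
  assumes a: "ode_solution (\<lambda>x. x) a a'" and neg: "\<And>x. x \<ge> 0 \<Longrightarrow> a' x < 0"
    and pos: "\<And>x. x \<ge> 0 \<Longrightarrow> a x > 0"
    and decay: "\<And>x. x \<ge> 0 \<Longrightarrow> \<bar>a' x\<bar> \<le> C * exp (- x)"
  obtains l where "0 < l" "l \<le> 6 / 5" "a' (- l) = 0" "\<And>x. x > - l \<Longrightarrow> a' x < 0"
    "\<And>x. x \<ge> - l \<Longrightarrow> a x > 0"
proof -
  note D = ode_solutionD[OF a]
  have apos: "a x > 0" if m: "\<And>t. x < t \<Longrightarrow> t < 0 \<Longrightarrow> a' t < 0" for x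
  proof (cases "x \<ge> 0")
    case False
    obtain z where "x < z" "z < 0" "a 0 - a x = (0 - x) * a' z"
      using MVT2[of x 0 a a'] D False by auto
    with m[of z] False have "a 0 - a x < 0" by (simp add: mult_neg_neg mult_less_0_iff)
    with pos[of 0] show ?thesis by simp
  qed (rule pos)
  have "\<exists>s\<in>{0..6/5}. - a' (- s) \<le> 0"
  proof (rule ccontr)
    assume "\<not> ?thesis"
    then have n: "a' x < 0" if "x \<ge> - (6/5)" for x
      using that neg[of x] by (cases "x \<ge> 0") (auto dest!: bspec[of _ _ "- x"])
    then have p: "a x > 0" if "x \<ge> - (6/5)" for x
      by (rule apos) (use that in auto)
    \<comment> \<open>The Wronskian of \<open>k \<mapsto> a (k - 6/5)\<close> with the Gaussian. For
      a Gaussian of exponent \<open>b\<close> and a level \<open>c\<close> the sign condition on its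
      derivative reads \<open>c \<ge> 2 * b + 1 / (16 * b^2)\<close>. The right side is smallest
      near \<open>b = 0.397\<close>, with value about 1.19, whence 2/5 and 6/5.\<close>
    define W where "W = (\<lambda>k. (a' (k - 6/5) + 4/5 * k * a (k - 6/5)) * exp (- (2/5) * k\<^sup>2))"
    have W0: "W k \<le> W 0" if "k \<ge> 0" for k
    proof (rule DERIV_nonpos_imp_nonincreasing[OF that])
      fix t :: real assume t: "0 \<le> t"
      have 1: "((\<lambda>k. a (k - 6/5)) has_real_derivative a' (t - 6/5)) (at t)"
        using DERIV_shift[of a "a' (t - 6/5)" t "- 6/5"] D(1)[of "t - 6/5"] by simp
      have 2: "((\<lambda>k. a' (k - 6/5)) has_real_derivative (t - 6/5) * a (t - 6/5)) (at t)"
        using DERIV_shift[of a' "(t - 6/5) * a (t - 6/5)" t "- 6/5"] D(2)[of "t - 6/5"] by simp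
      have 3: "((\<lambda>k. exp (- (2/5) * k\<^sup>2)) has_real_derivative
          exp (- (2/5) * t\<^sup>2) * (- (2/5) * (2 * t))) (at t)"
        by (auto intro!: derivative_eq_intros)
      have 4: "((\<lambda>k. 4/5 * k) has_real_derivative 4/5) (at t)"
        by (auto intro!: derivative_eq_intros)
      have "(W has_real_derivative a (t - 6/5) * exp (- (2/5) * t\<^sup>2) * (t - 2/5 - 16/25 * t\<^sup>2)) (at t)"
        unfolding W_def
        by (rule DERIV_cong[OF DERIV_mult[OF DERIV_add[OF 2 DERIV_mult[OF 4 1]] 3]]) algebra
      moreover have "t - 2/5 - 16/25 * t\<^sup>2 \<le> 0"
      proof -
        have "0 \<le> (16/25) * (t - 25/32)\<^sup>2" by simp
        then show ?thesis by (simp add: power2_diff algebra_simps) (simp add: power2_eq_square)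
      qed
      then have "a (t - 6/5) * exp (- (2/5) * t\<^sup>2) * (t - 2/5 - 16/25 * t\<^sup>2) \<le> 0"
        using p[of "t - 6/5"] t by (intro mult_nonneg_nonpos) auto
      ultimately show "\<exists>d. (W has_real_derivative d) (at t) \<and> d \<le> 0" by blast
    qed
    have Wneg: "W 0 < 0" using n[of "- (6/5)"] by (simp add: W_def)
    \<comment> \<open>\<open>W\<close> stays below the negative number \<open>W 0\<close>, but its
      only negative contribution is the one of \<open>a'\<close>, which tends to 0.\<close>
    have "((\<lambda>k. C * exp (6/5 - k)) \<longlongrightarrow> 0) at_top"
      by real_asymp
    then have "\<forall>\<^sub>F k in at_top. C * exp (6/5 - k) < - W 0"
      by (rule order_tendstoD) (use Wneg in simp)
    then obtain k where k: "k \<ge> 6/5" "C * exp (6/5 - k) < - W 0"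
      by (metis (mono_tags, lifting) eventually_at_top_linorder max.cobounded1 max.cobounded2)
    have "- (C * exp (6/5 - k)) \<le> a' (k - 6/5) * 1"
      using decay[of "k - 6/5"] k(1) by (simp add: abs_le_iff)
    also have "\<dots> \<le> a' (k - 6/5) * exp (- (2/5) * k\<^sup>2)"
      by (rule mult_left_mono_neg) (use n[of "k - 6/5"] k(1) in auto)
    also have "\<dots> \<le> W k"
      unfolding W_def using p[of "k - 6/5"] k(1) by (intro mult_right_mono) auto
    also have "\<dots> \<le> W 0" using W0[of k] k(1) by simp
    finally show False using k(2) by simp
  qed
  then obtain s where s: "s \<in> {0..6/5}" "- a' (- s) \<le> 0" by blast
  have cont: "continuous_on {0..6/5} (\<lambda>s. - a' (- s))"
    by (intro continuous_intros continuous_on_compose2[OF ode_solution_continuous(2)[OF a, of UNIV]]) auto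
  obtain l where l: "0 < l" "l \<le> 6/5" "- a' (- l) = 0"
    "\<And>t. 0 \<le> t \<Longrightarrow> t < l \<Longrightarrow> - a' (- t) > 0"
    using first_zero[OF cont _ s] neg[of 0] by auto
  have neg': "a' x < 0" if "x > - l" for x
    using l(4)[of "- x"] neg[of x] that by (cases "x \<ge> 0") auto
  show ?thesis
    by (rule that[OF l(1,2) _ neg']) (use l(3) neg' apos in auto)
qed

text \<open>
  The polynomial \<open>v\<close> below is a Sturm comparison function for \<open>y'' = - (6/5 + s) y\<close>; positivity of
  \<open>v\<close> and of \<open>- v'' - (6/5 + s) v\<close> on \<open>[0, 121/100]\<close> is read off their Bernstein coefficients.
\<close>

lemma comparison_poly_pos:
  fixes s :: real
  assumes "0 \<le> s" "s \<le> 121/100"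
  shows "1 - 5/8 * s^2 - 11/50 * s^3 + 3/20 * s^4 > 0" (is ?v)
    "- 5/4 - 33/25 * s + 9/5 * s^2 + (6/5 + s) * (1 - 5/8 * s^2 - 11/50 * s^3 + 3/20 * s^4) < 0" (is ?r)
proof -
  define x where "x = s * 100 / 121"
  define y where "y = 1 - x"
  have x: "x \<ge> 0" "y \<ge> 0" and s: "s = 121/100 * x" using assms by (auto simp: x_def y_def)
  have nz: "x > 0 \<or> y > 0" using x by (auto simp: y_def)
  have "1 - 5/8 * s^2 - 11/50 * s^3 + 3/20 * s^4 =
    1/1*x^0*y^4 + 4/1*x^1*y^3 + 81359/16000*x^2*y^2 + 89006579/50000000*x^3*y^1
      + 33464803/2000000000*x^4*y^0"
    unfolding s y_def by (simp add: power_numeral_reduce field_simps)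
  also have "\<dots> > 0"
    using nz
  proof
    assume "x > 0"
    then show ?thesis by (intro add_nonneg_pos add_nonneg_nonneg) (use x in auto)
  next
    assume "y > 0"
    then show ?thesis by (intro add_pos_nonneg) (use x in auto)
  qed
  finally show ?v .
  have "- (- 5/4 - 33/25 * s + 9/5 * s^2 + (6/5 + s) * (1 - 5/8 * s^2 - 11/50 * s^3 + 3/20 * s^4)) =
    1/20*x^0*y^6 + 859/1250*x^1*y^5 + 229739/200000*x^2*y^4 + 297697729/1000000000*x^3*y^3
      + 1043333697/5000000000*x^4*y^2 + 118791784557/200000000000*x^5*y^1
      + 34298982477/200000000000*x^6*y^0"
    unfolding s y_def by (simp add: power_numeral_reduce field_simps)
  also have "\<dots> > 0"
    using nz
  proof
    assume "x > 0"
    then show ?thesis by (intro add_nonneg_pos add_nonneg_nonneg) (use x in auto)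
  next
    assume "y > 0"
    then show ?thesis by (intro add_pos_nonneg) (use x in auto)
  qed
  finally show ?r by linarith
qed

text \<open>Up to its first zero \<open>z\<close>, the reflected solution \<open>y\<close> and the
  comparison function \<open>v\<close> have an increasing Wronskian that starts at 0. At
  \<open>z\<close> it equals \<open>y' z * v z\<close>, so \<open>y' z > 0\<close>, which is
  impossible for a positive function reaching 0. Here \<open>l\<close> enters only through
  \<open>l + s \<le> 6/5 + s\<close>.\<close>

lemma airy_positive_beyond:
  assumes a: "ode_solution (\<lambda>x. x) a a'" and l: "0 < l" "l \<le> 6 / 5" "a' (- l) = 0"
    and pos: "\<And>x. x \<ge> - l \<Longrightarrow> a x > 0" and x: "x \<ge> - (l + 121/100)"
  shows "a x > 0"
proof (rule ccontr)
  assume n: "\<not> a x > 0"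
  note D = ode_solutionD[OF a]
  define y where "y = (\<lambda>s. a (- l - s))"
  define y' where "y' = (\<lambda>s. - a' (- l - s))"
  have Dy: "(y has_real_derivative y' s) (at s)" for s
    unfolding y_def y'_def by (rule DERIV_chain2[where f = a, THEN DERIV_cong, OF D(1)]) (auto intro!: derivative_eq_intros)
  have Dy': "(y' has_real_derivative - (l + s) * y s) (at s)" for s
  proof -
    have "((\<lambda>s. a' (- l - s)) has_real_derivative ((- l - s) * a (- l - s)) * (- 1)) (at s)"
      by (rule DERIV_chain2[where f = a', OF D(2)]) (auto intro!: derivative_eq_intros)
    then show ?thesis unfolding y_def y'_def by (auto intro!: derivative_eq_intros simp: algebra_simps)
  qed
  have "continuous_on {0..121/100} y"
    by (auto intro!: continuous_at_imp_continuous_on DERIV_isCont[OF Dy])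
  moreover have "x < - l" using pos[of x] n by force
  ultimately obtain z where z: "0 < z" "z \<le> 121/100" "y z = 0" "\<And>t. 0 \<le> t \<Longrightarrow> t < z \<Longrightarrow> y t > 0"
    using first_zero[of 0 "121/100" y "- l - x"] x n pos[of "- l"] by (auto simp: y_def)
  \<comment> \<open>A modification of the Taylor polynomial
    \<open>1 - 3/5 s^2 - 1/6 s^3 + 3/50 s^4\<close> of the solution of
    \<open>y'' = - (6/5 + s) y\<close> with \<open>y = 1\<close>, \<open>y' = 0\<close> at 0, bent
    downwards to make the differential inequality strict. At \<open>s = 121/100\<close> it is still
    positive, but below 0.02.\<close>
  define v where "v = (\<lambda>s::real. 1 - 5/8 * s^2 - 11/50 * s^3 + 3/20 * s^4)"
  define v' where "v' = (\<lambda>s::real. - 5/4 * s - 33/50 * s^2 + 3/5 * s^3)"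
  define v'' where "v'' = (\<lambda>s::real. - 5/4 - 33/25 * s + 9/5 * s^2)"
  have Dv: "(v has_real_derivative v' s) (at s)" for s
    unfolding v_def v'_def by (auto intro!: derivative_eq_intros simp: power_numeral_reduce)
  have Dv': "(v' has_real_derivative v'' s) (at s)" for s
    unfolding v'_def v''_def by (auto intro!: derivative_eq_intros simp: power_numeral_reduce)
  define W where "W = (\<lambda>s. y' s * v s - y s * v' s)"
  have DW: "(W has_real_derivative y s * (- (l + s) * v s - v'' s)) (at s)" for s
    unfolding W_def by (auto intro!: derivative_eq_intros Dy Dy' Dv Dv' simp: algebra_simps)
  have posd: "- (l + s) * v s - v'' s > 0" if "0 \<le> s" "s \<le> z" for s
  proof -
    have "v s > 0" "v'' s + (6/5 + s) * v s < 0"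
      using comparison_poly_pos[of s] that z by (auto simp: v_def v''_def)
    moreover have "(l + s) * v s \<le> (6/5 + s) * v s"
      by (rule mult_right_mono) (use calculation l in auto)
    moreover have "- (l + s) * v s = - ((l + s) * v s)" by (rule mult_minus_left)
    ultimately show ?thesis by linarith
  qed
  \<comment> \<open>Split at the middle: strict growth needs \<open>y > 0\<close>, which fails at
    \<open>z\<close> itself, so on the second half only weak monotonicity is claimed.\<close>
  have "W 0 < W (z / 2)"
  proof (rule DERIV_pos_imp_increasing[where f = W])
    fix t assume "0 \<le> t" "t \<le> z / 2"
    then show "\<exists>d. (W has_real_derivative d) (at t) \<and> 0 < d"
      using DW[of t] posd[of t] z(4)[of t] z(1)
      by (intro exI[of _ "y t * (- (l + t) * v t - v'' t)"] conjI mult_pos_pos) auto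
  qed (use z in simp)
  also have "W (z / 2) \<le> W z"
  proof (rule DERIV_nonneg_imp_nondecreasing[where f = W])
    fix t assume t: "z / 2 \<le> t" "t \<le> z"
    have "y t \<ge> 0" using z t by (cases "t = z") (auto simp: less_imp_le)
    then show "\<exists>d. (W has_real_derivative d) (at t) \<and> 0 \<le> d"
      using DW[of t] posd[of t] t z(1)
      by (intro exI[of _ "y t * (- (l + t) * v t - v'' t)"] conjI mult_nonneg_nonneg) auto
  qed (use z in simp)
  finally have "W z > 0" using l(3) by (simp add: W_def y'_def v'_def)
  then have "y' z > 0"
    using comparison_poly_pos(1)[of z] z by (simp add: W_def v_def zero_less_mult_iff)
  then obtain d where d: "d > 0" "\<And>h. 0 < h \<Longrightarrow> h < d \<Longrightarrow> y (z - h) < y z"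
    using DERIV_pos_inc_left[OF Dy] by blast
  define h where "h = min (d / 2) z"
  have "y (z - h) < 0" using d(2)[of h] d(1) z by (auto simp: h_def)
  moreover have "y (z - h) > 0" using z(4)[of "z - h"] z(1) d(1) by (auto simp: h_def)
  ultimately show False by simp
qed

section \<open>Solving the inhomogeneous equation on the whole line\<close>

lemma airy_ivp:
  obtains y y' where "ode_solution (\<lambda>x. x) y y'" "y x0 = A" "y' x0 = B"
proof -
  obtain f f' where f: "ode_solution (\<lambda>x. x) f f'" and f0: "f 0 = 1" "f' 0 = 0"
    using airy_solution_exists by blast
  obtain g g' where g: "ode_solution (\<lambda>x. x) g g'" and g0: "g 0 = 0" "g' 0 = 1"
    using airy_solution_exists by blast
  have W: "f x0 * g' x0 - f' x0 * g x0 = 1"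
    using wronskian_constant[OF f g, of x0] f0 g0 by simp
  define c d where "c = A * g' x0 - B * g x0" and "d = B * f x0 - A * f' x0"
  have "c * f x0 + d * g x0 = A * (f x0 * g' x0 - f' x0 * g x0)"
    "c * f' x0 + d * g' x0 = B * (f x0 * g' x0 - f' x0 * g x0)"
    by (simp_all add: c_def d_def algebra_simps)
  then show ?thesis using that[OF ode_solution_combine[OF f g, of c d]] W by simp
qed

text \<open>The potential is even, so each half-line carries a translated Airy solution, reflected
  on the left; the reflection produces the minus sign in the matching of slopes. The second
  derivatives then match by themselves, both being \<open>- \<mu>\<close> times the common value at
  0.\<close>

lemma ode_solution_glue:
  assumes p: "ode_solution (\<lambda>x. x) p p'" and q: "ode_solution (\<lambda>x. x) q q'"
    and eq: "p (- \<mu>) = q (- \<mu>)" "p' (- \<mu>) = - q' (- \<mu>)"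
  shows "ode_solution (\<lambda>k. \<bar>k\<bar> - \<mu>) (\<lambda>k. if k \<ge> 0 then p (k - \<mu>) else q (- k - \<mu>))
    (\<lambda>k. if k \<ge> 0 then p' (k - \<mu>) else - q' (- k - \<mu>))"
proof -
  note P = ode_solutionD[OF p] and Q = ode_solutionD[OF q]
  have P1: "((\<lambda>k. p (k - \<mu>)) has_real_derivative p' (k - \<mu>)) (at k)" for k
    using DERIV_shift[of p "p' (k - \<mu>)" k "- \<mu>"] P(1)[of "k - \<mu>"] by simp
  have P2: "((\<lambda>k. p' (k - \<mu>)) has_real_derivative (k - \<mu>) * p (k - \<mu>)) (at k)" for k
    using DERIV_shift[of p' "(k - \<mu>) * p (k - \<mu>)" k "- \<mu>"] P(2)[of "k - \<mu>"] by simp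
  have Q1: "((\<lambda>k. q (- k - \<mu>)) has_real_derivative - q' (- k - \<mu>)) (at k)" for k
    by (rule DERIV_chain2[where f = q, THEN DERIV_cong, OF Q(1)]) (auto intro!: derivative_eq_intros)
  have Q2: "((\<lambda>k. - q' (- k - \<mu>)) has_real_derivative (- k - \<mu>) * q (- k - \<mu>)) (at k)" for k
  proof -
    have "((\<lambda>k. q' (- k - \<mu>)) has_real_derivative ((- k - \<mu>) * q (- k - \<mu>)) * (- 1)) (at k)"
      by (rule DERIV_chain2[where f = q', OF Q(2)]) (auto intro!: derivative_eq_intros)
    then show ?thesis by (auto intro!: derivative_eq_intros)
  qed
  have "((\<lambda>k. if k \<ge> 0 then p (k - \<mu>) else q (- k - \<mu>)) has_real_derivative
      (if k \<ge> 0 then p' (k - \<mu>) else - q' (- k - \<mu>))) (at k)" for k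
    by (rule DERIV_glue_at_0[OF P1 Q1]) (use eq in simp_all)
  moreover have "((\<lambda>k. if k \<ge> 0 then p' (k - \<mu>) else - q' (- k - \<mu>)) has_real_derivative
      (if k \<ge> 0 then (k - \<mu>) * p (k - \<mu>) else (- k - \<mu>) * q (- k - \<mu>))) (at k)" for k
    by (rule DERIV_glue_at_0[OF P2 Q2]) (use eq in simp_all)
  moreover have "(if k \<ge> 0 then (k - \<mu>) * p (k - \<mu>) else (- k - \<mu>) * q (- k - \<mu>))
      = (\<bar>k\<bar> - \<mu>) * (if k \<ge> 0 then p (k - \<mu>) else q (- k - \<mu>))" for k
    by simp
  ultimately show ?thesis unfolding ode_solution_def by auto
qed

lemma antiderivative_exists:
  fixes f :: "real \<Rightarrow> real"
  assumes f: "continuous_on UNIV f"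
  obtains F where "\<And>x. (F has_real_derivative f x) (at x)"
proof -
  have "((\<lambda>u. LBINT y=0..u. f y) has_real_derivative f x) (at x)" for x
  proof -
    define R where "R = \<bar>x\<bar> + 1"
    have "((\<lambda>u. LBINT y=0..u. f y) has_vector_derivative f x) (at x within {- R..R})"
      using interval_integral_FTC2[of "- R" 0 R f x] continuous_on_subset[OF f]
      by (auto simp: R_def zero_ereal_def)
    moreover have "at x within {- R..R} = at x"
      by (rule at_within_interior) (auto simp: R_def)
    ultimately show ?thesis
      by (simp only: has_real_derivative_iff_has_vector_derivative)
  qed
  then show ?thesis using that by blast
qed

text \<open>This is Green's formula with \<open>y1\<close> decaying on the right. On the left the
  solution is a multiple of \<open>y2\<close>, with coefficient proportional to the integral of
  \<open>y1 * h\<close>. Hence the alternative in the last assumption: either \<open>y2\<close>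
  decays there, or the coefficient vanishes, as in the Fredholm alternative.\<close>

lemma variation_of_constants:
  assumes y1: "ode_solution V y1 y1'" and y2: "ode_solution V y2 y2'"
    and W: "y1' 0 * y2 0 - y1 0 * y2' 0 \<noteq> 0"
    and h: "continuous_on UNIV h" and K: "K \<ge> 0" "\<And>k. \<bar>k\<bar> \<ge> K \<Longrightarrow> h k = 0"
    and d1: "\<exists>C. \<forall>k\<ge>0. \<bar>y1 k\<bar> \<le> C * exp (- \<bar>k\<bar>) \<and> \<bar>y1' k\<bar> \<le> C * exp (- \<bar>k\<bar>)"
    and d2: "(\<exists>C. \<forall>k\<le>0. \<bar>y2 k\<bar> \<le> C * exp (- \<bar>k\<bar>) \<and> \<bar>y2' k\<bar> \<le> C * exp (- \<bar>k\<bar>))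
      \<or> (LINT k|lborel. y1 k * h k) = 0"
  obtains u u' where "\<And>k. (u has_real_derivative u' k) (at k)"
    "\<And>k. (u' has_real_derivative V k * u k - h k) (at k)"
    "\<exists>C. \<forall>k. \<bar>u k\<bar> \<le> C * exp (- \<bar>k\<bar>) \<and> \<bar>u' k\<bar> \<le> C * exp (- \<bar>k\<bar>)"
proof -
  note D1 = ode_solutionD[OF y1] and D2 = ode_solutionD[OF y2]
  define w where "w = y1' 0 * y2 0 - y1 0 * y2' 0"
  have w0: "w \<noteq> 0" using W by (simp add: w_def)
  have w: "y1' k * y2 k - y1 k * y2' k = w" for k
    using wronskian_constant[OF y1 y2, of k] by (simp add: w_def)
  have c1: "continuous_on UNIV (\<lambda>k. y1 k * h k)" and c2: "continuous_on UNIV (\<lambda>k. y2 k * h k)"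
    by (intro continuous_intros h ode_solution_continuous[OF y1] ode_solution_continuous[OF y2])+
  obtain N1 where N1: "\<And>k. (N1 has_real_derivative y1 k * h k) (at k)"
    using antiderivative_exists[OF c1] by blast
  obtain N2 where N2: "\<And>k. (N2 has_real_derivative y2 k * h k) (at k)"
    using antiderivative_exists[OF c2] by blast
  have const: "N k = N K" "N (- k) = N (- K)" if "k \<ge> K" "\<And>k. (N has_real_derivative y k * h k) (at k)" for k N y
  proof -
    note D = that(2)
    have cont: "continuous_on S N" for S
      by (auto intro!: continuous_at_imp_continuous_on DERIV_isCont[OF D])
    have "N k = N K" if "K < k"
    proof (rule DERIV_isconst_end[OF that cont])
      fix x assume "K < x" "x < k"
      then show "(N has_real_derivative 0) (at x)" using D[of x] K(2)[of x] K(1) by simp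
    qed
    then show "N k = N K" using \<open>k \<ge> K\<close> by (cases "k = K") auto
    have "N (- K) = N (- k)" if "K < k"
    proof (rule DERIV_isconst_end[OF _ cont])
      fix x assume "- k < x" "x < - K"
      then show "(N has_real_derivative 0) (at x)" using D[of x] K(2)[of x] K(1) by simp
    qed (use that in simp)
    then show "N (- k) = N (- K)" using \<open>k \<ge> K\<close> by (cases "k = K") auto
  qed
  \<comment> \<open>The constants of integration make the coefficient of \<open>y1\<close> vanish
    left of \<open>- K\<close> and that of \<open>y2\<close> vanish right of
    \<open>K\<close>.\<close>
  define u where "u = (\<lambda>k. (y1 k * (N2 k - N2 (- K)) + y2 k * (N1 K - N1 k)) / (- w))"
  define u' where "u' = (\<lambda>k. (y1' k * (N2 k - N2 (- K)) + y2' k * (N1 K - N1 k)) / (- w))"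
  have Du: "(u has_real_derivative u' k) (at k)" for k
  proof -
    have "((\<lambda>k. y1 k * (N2 k - N2 (- K)) + y2 k * (N1 K - N1 k)) has_real_derivative
        y1' k * (N2 k - N2 (- K)) + y2' k * (N1 K - N1 k)) (at k)"
      by (auto intro!: derivative_eq_intros D1 D2 N1 N2 simp: algebra_simps)
    then show ?thesis unfolding u_def u'_def by (rule DERIV_cdivide)
  qed
  have Du': "(u' has_real_derivative V k * u k - h k) (at k)" for k
  proof -
    have "((\<lambda>k. y1' k * (N2 k - N2 (- K)) + y2' k * (N1 K - N1 k)) has_real_derivative
        V k * (y1 k * (N2 k - N2 (- K)) + y2 k * (N1 K - N1 k)) + w * h k) (at k)"
      by (auto intro!: derivative_eq_intros D1 D2 N1 N2 simp: w[of k, symmetric] algebra_simps)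
    then have "(u' has_real_derivative
        (V k * (y1 k * (N2 k - N2 (- K)) + y2 k * (N1 K - N1 k)) + w * h k) / (- w)) (at k)"
      unfolding u'_def by (rule DERIV_cdivide)
    moreover have "(V k * (y1 k * (N2 k - N2 (- K)) + y2 k * (N1 K - N1 k)) + w * h k) / (- w)
        = V k * u k - h k"
      using w0 by (simp add: u_def field_simps)
    ultimately show ?thesis by simp
  qed
  have right: "\<exists>C\<ge>0. \<forall>k\<ge>K. \<bar>u k\<bar> \<le> C * exp (- \<bar>k\<bar>) \<and> \<bar>u' k\<bar> \<le> C * exp (- \<bar>k\<bar>)"
  proof -
    obtain C where C: "\<And>k. k \<ge> 0 \<Longrightarrow> \<bar>y1 k\<bar> \<le> C * exp (- \<bar>k\<bar>) \<and> \<bar>y1' k\<bar> \<le> C * exp (- \<bar>k\<bar>)"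
      using d1 by blast
    define A where "A = \<bar>(N2 K - N2 (- K)) / w\<bar>"
    have "\<bar>u k\<bar> = A * \<bar>y1 k\<bar>" "\<bar>u' k\<bar> = A * \<bar>y1' k\<bar>" if "k \<ge> K" for k
      using const(1)[OF that N1] const(1)[OF that N2] by (simp_all add: u_def u'_def A_def abs_mult)
    moreover have "A \<ge> 0" by (simp add: A_def)
    ultimately have b: "\<bar>u k\<bar> \<le> A * (C * exp (- \<bar>k\<bar>))" "\<bar>u' k\<bar> \<le> A * (C * exp (- \<bar>k\<bar>))" if "k \<ge> K" for k
      using C[of k] that K(1) by (auto intro!: mult_left_mono)
    have "C \<ge> 0" using C[of 0] order_trans[OF abs_ge_zero, of "y1 0" C] by simp
    with b show ?thesis using \<open>A \<ge> 0\<close> by (intro exI[of _ "A * C"]) (auto simp: mult.assoc)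
  qed
  have left: "\<exists>C\<ge>0. \<forall>k\<le>-K. \<bar>u k\<bar> \<le> C * exp (- \<bar>k\<bar>) \<and> \<bar>u' k\<bar> \<le> C * exp (- \<bar>k\<bar>)"
  proof -
    define A where "A = \<bar>(N1 K - N1 (- K)) / w\<bar>"
    have e: "\<bar>u k\<bar> = A * \<bar>y2 k\<bar>" "\<bar>u' k\<bar> = A * \<bar>y2' k\<bar>" if "k \<le> -K" for k
      using const(2)[OF _ N1, of "- k"] const(2)[OF _ N2, of "- k"] that
      by (simp_all add: u_def u'_def A_def abs_mult)
    have A: "A \<ge> 0" by (simp add: A_def)
    show ?thesis
      using d2
    proof
      assume "\<exists>C. \<forall>k\<le>0. \<bar>y2 k\<bar> \<le> C * exp (- \<bar>k\<bar>) \<and> \<bar>y2' k\<bar> \<le> C * exp (- \<bar>k\<bar>)"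
      then obtain C where C: "\<And>k. k \<le> 0 \<Longrightarrow> \<bar>y2 k\<bar> \<le> C * exp (- \<bar>k\<bar>) \<and> \<bar>y2' k\<bar> \<le> C * exp (- \<bar>k\<bar>)"
        by blast
      have b: "\<bar>u k\<bar> \<le> A * (C * exp (- \<bar>k\<bar>))" "\<bar>u' k\<bar> \<le> A * (C * exp (- \<bar>k\<bar>))" if "k \<le> -K" for k
        using C[of k] e[OF that] that K(1) A by (auto intro!: mult_left_mono)
      have "C \<ge> 0" using C[of 0] order_trans[OF abs_ge_zero, of "y2 0" C] by simp
      with b show ?thesis using A by (intro exI[of _ "A * C"]) (auto simp: mult.assoc)
    next
      assume 0: "(LINT k|lborel. y1 k * h k) = 0"
      have "(LINT k|lborel. y1 k * h k) = (LINT k|lborel. (y1 k * h k) * indicator {- K..K} k)"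
      proof (rule Bochner_Integration.integral_cong[OF refl])
        show "y1 k * h k = (y1 k * h k) * indicator {- K..K} k" for k
        proof (cases "k \<in> {- K..K}")
          case False
          then have "h k = 0" by (intro K(2)) auto
          then show ?thesis by simp
        qed simp
      qed
      also have "\<dots> = N1 K - N1 (- K)"
        by (rule integral_FTC_Icc_real) (use K(1) N1 c1 in \<open>auto simp: continuous_on_eq_continuous_at\<close>)
      finally have "A = 0" using 0 by (simp add: A_def)
      with e show ?thesis by (intro exI[of _ 0]) auto
    qed
  qed
  have mid: "\<exists>C\<ge>0. \<forall>k. \<bar>k\<bar> \<le> K \<longrightarrow> \<bar>u k\<bar> \<le> C * exp (- \<bar>k\<bar>) \<and> \<bar>u' k\<bar> \<le> C * exp (- \<bar>k\<bar>)"
  proof -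
    have "continuous_on {- K..K} (\<lambda>k. (\<bar>u k\<bar> + \<bar>u' k\<bar>) * exp \<bar>k\<bar>)"
      by (intro continuous_intros)
         (auto intro!: continuous_at_imp_continuous_on DERIV_isCont[OF Du] DERIV_isCont[OF Du'])
    then have "bounded ((\<lambda>k. (\<bar>u k\<bar> + \<bar>u' k\<bar>) * exp \<bar>k\<bar>) ` {- K..K})"
      by (intro compact_imp_bounded compact_continuous_image) auto
    then obtain B where "\<forall>z\<in>(\<lambda>k. (\<bar>u k\<bar> + \<bar>u' k\<bar>) * exp \<bar>k\<bar>) ` {- K..K}. norm z \<le> B"
      unfolding bounded_iff by blast
    then have B: "\<bar>(\<bar>u k\<bar> + \<bar>u' k\<bar>) * exp \<bar>k\<bar>\<bar> \<le> B" if "k \<in> {- K..K}" for k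
      using that by simp
    have "\<bar>u k\<bar> + \<bar>u' k\<bar> \<le> B * exp (- \<bar>k\<bar>)" if "\<bar>k\<bar> \<le> K" for k
      using B[of k] that by (simp add: abs_le_iff exp_minus field_simps)
    then have "\<bar>u k\<bar> \<le> B * exp (- \<bar>k\<bar>) \<and> \<bar>u' k\<bar> \<le> B * exp (- \<bar>k\<bar>)" if "\<bar>k\<bar> \<le> K" for k
      using that abs_ge_zero[of "u k"] abs_ge_zero[of "u' k"] by force
    moreover have "B \<ge> 0" using B[of 0] K(1) by simp
    ultimately show ?thesis by blast
  qed
  obtain C1 C2 C3 where C: "C1 \<ge> 0" "C2 \<ge> 0" "C3 \<ge> 0"
    "\<And>k. k \<ge> K \<Longrightarrow> \<bar>u k\<bar> \<le> C1 * exp (- \<bar>k\<bar>) \<and> \<bar>u' k\<bar> \<le> C1 * exp (- \<bar>k\<bar>)"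
    "\<And>k. k \<le> - K \<Longrightarrow> \<bar>u k\<bar> \<le> C2 * exp (- \<bar>k\<bar>) \<and> \<bar>u' k\<bar> \<le> C2 * exp (- \<bar>k\<bar>)"
    "\<And>k. \<bar>k\<bar> \<le> K \<Longrightarrow> \<bar>u k\<bar> \<le> C3 * exp (- \<bar>k\<bar>) \<and> \<bar>u' k\<bar> \<le> C3 * exp (- \<bar>k\<bar>)"
    using left right mid by metis
  have m: "Ci * exp (- \<bar>k\<bar>) \<le> (C1 + C2 + C3) * exp (- \<bar>k\<bar>)" if "Ci \<in> {C1, C2, C3}" for Ci k
    by (rule mult_right_mono) (use that C(1-3) in auto)
  have "\<bar>u k\<bar> \<le> (C1 + C2 + C3) * exp (- \<bar>k\<bar>) \<and> \<bar>u' k\<bar> \<le> (C1 + C2 + C3) * exp (- \<bar>k\<bar>)" for k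
  proof -
    consider "k \<ge> K" | "k \<le> - K" | "\<bar>k\<bar> \<le> K" by linarith
    then show ?thesis
    proof cases
      case 1
      with C(4) m[of C1 k] show ?thesis by (meson insertI1 order_trans)
    next
      case 2
      with C(5) m[of C2 k] show ?thesis by (meson insertI1 insertI2 order_trans)
    next
      case 3
      with C(6) m[of C3 k] show ?thesis by (meson insertI1 insertI2 order_trans)
    qed
  qed
  with Du Du' show ?thesis using that by blast
qed

text \<open>Half of the exponential rate is spent on absorbing the linear growth of the potential,
  so rate 1 for \<open>u\<close> and \<open>u'\<close> becomes rate 1/2 for the profile. The
  Lipschitz bound for the second derivative comes from those of \<open>u\<close>, \<bar>k\<bar> and
  \<open>h\<close>.\<close>

lemma profile_of_ode:
  assumes u: "\<And>k. (u has_real_derivative u' k) (at k)"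
    "\<And>k. (u' has_real_derivative (\<bar>k\<bar> - \<mu>) * u k - h k) (at k)"
    and b: "\<exists>C. \<forall>k. \<bar>u k\<bar> \<le> C * exp (- \<bar>k\<bar>) \<and> \<bar>u' k\<bar> \<le> C * exp (- \<bar>k\<bar>)"
    and h: "\<And>k l. \<bar>h k - h l\<bar> \<le> L * \<bar>k - l\<bar>" and K: "K \<ge> 0" "\<And>k. \<bar>k\<bar> \<ge> K \<Longrightarrow> h k = 0"
  shows "profile u u' (\<lambda>k. (\<bar>k\<bar> - \<mu>) * u k - h k)"
proof -
  obtain C where C: "\<And>k. \<bar>u k\<bar> \<le> C * exp (- \<bar>k\<bar>)" "\<And>k. \<bar>u' k\<bar> \<le> C * exp (- \<bar>k\<bar>)"
    using b by blast
  have C0: "C \<ge> 0" using C(1)[of 0] by simp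
  have L0: "L \<ge> 0" using h[of 0 1] by simp
  define E where "E = (\<lambda>k::real. exp (- \<bar>k\<bar> / 2))"
  have E0: "E k > 0" for k by (simp add: E_def)
  have eE: "exp (- \<bar>k\<bar>) = E k * E k" for k by (simp add: E_def exp_add[symmetric])
  have E1: "E k \<le> 1" for k by (simp add: E_def)
  have kE: "\<bar>k\<bar> * E k \<le> 2" for k
  proof -
    have "\<bar>k\<bar> / 2 \<le> exp (\<bar>k\<bar> / 2)" using exp_ge_add_one_self[of "\<bar>k\<bar> / 2"] by linarith
    then show ?thesis by (simp add: E_def exp_minus field_simps)
  qed
  have vE: "(\<bar>k\<bar> + \<bar>\<mu>\<bar>) * exp (- \<bar>k\<bar>) \<le> (2 + \<bar>\<mu>\<bar>) * E k" for k
  proof -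
    have "(\<bar>k\<bar> * E k) * E k \<le> 2 * E k"
      by (rule mult_right_mono[OF kE less_imp_le[OF E0]])
    moreover have "\<bar>\<mu>\<bar> * E k * E k \<le> \<bar>\<mu>\<bar> * E k * 1"
      by (rule mult_left_mono[OF E1]) (use E0[of k] in simp)
    ultimately show ?thesis unfolding eE by (simp add: algebra_simps)
  qed
  have v: "\<bar>\<bar>k\<bar> - \<mu>\<bar> \<le> \<bar>k\<bar> + \<bar>\<mu>\<bar>" for k by simp
  \<comment> \<open>\<open>L * (2 * K + 1)\<close> bounds the size of \<open>h\<close>, the extra
    \<open>L\<close> its increments. The exponential compensates the decay on \<bar>k\<bar> at most
    \<open>K + 1\<close>, one beyond the support because \<open>k + d\<close> may enter it from
    outside.\<close>
  define H where "H = (L * (2 * K + 1) + L) * exp ((K + 1) / 2)"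
  have H0: "H \<ge> 0" using L0 K by (simp add: H_def)
  have HE: "(L * (2 * K + 1) + L) \<le> H * E k" if "\<bar>k\<bar> \<le> K + 1" for k
  proof -
    have "1 \<le> exp ((K + 1) / 2) * E k"
      using that by (simp add: E_def exp_add[symmetric])
    then have "(L * (2 * K + 1) + L) * 1 \<le> (L * (2 * K + 1) + L) * (exp ((K + 1) / 2) * E k)"
      using L0 K by (intro mult_left_mono) auto
    then show ?thesis by (simp add: H_def mult.assoc)
  qed
  have hb: "\<bar>h k\<bar> \<le> H * E k" for k
  proof (cases "\<bar>k\<bar> \<le> K")
    case True
    have "\<bar>h k\<bar> = \<bar>h k - h (K + 1)\<bar>" using K by simp
    also have "\<dots> \<le> L * \<bar>k - (K + 1)\<bar>" by (rule h)
    also have "\<dots> \<le> L * (2 * K + 1)" by (rule mult_left_mono) (use True L0 in auto)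
    also have "\<dots> \<le> H * E k" using HE[of k] True L0 by simp
    finally show ?thesis .
  next
    case False
    then show ?thesis using K H0 E0[of k] by simp
  qed
  have hd: "\<bar>h (k + d) - h k\<bar> \<le> H * d * E k" if d: "d \<in> {0..1}" for k d
  proof (cases "\<bar>k\<bar> \<le> K + 1")
    case True
    have "\<bar>h (k + d) - h k\<bar> \<le> d * L" using h[of "k + d" k] d by (simp add: mult.commute)
    also have "\<dots> \<le> d * (H * E k)"
      using HE[OF True] d L0 K by (intro mult_left_mono) (smt (verit) mult_nonneg_nonneg, auto)
    finally show ?thesis by (simp add: algebra_simps)
  next
    case False
    then have "h (k + d) = 0" "h k = 0" using d by (auto intro!: K(2))
    then show ?thesis using H0 E0[of k] d by simp
  qed
  define u'' where "u'' = (\<lambda>k. (\<bar>k\<bar> - \<mu>) * u k - h k)"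
  define B where "B = C * exp 1 + C * exp 1 * (2 + \<bar>\<mu>\<bar>) + H"
  have e1: "C \<le> C * exp 1" using C0 by (simp add: mult_le_cancel_left1)
  have B1: "C \<le> B" using e1 C0 H0 by (simp add: B_def) (smt (verit) mult_nonneg_nonneg abs_ge_zero exp_ge_zero)
  have sm: "C * exp (- \<bar>k\<bar>) \<le> B * E k" for k
    unfolding eE using mult_mono[OF B1, of "E k * E k" "E k * 1"] E1[of k] E0[of k] C0 B1
    by (simp add: mult_left_mono)
  have vu: "\<bar>(\<bar>k\<bar> - \<mu>) * z\<bar> \<le> c * (2 + \<bar>\<mu>\<bar>) * E k" if "\<bar>z\<bar> \<le> c * exp (- \<bar>k\<bar>)" for k z c
  proof -
    have c: "c \<ge> 0" using that by (smt (verit) abs_ge_zero exp_gt_zero zero_le_mult_iff)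
    have "\<bar>(\<bar>k\<bar> - \<mu>) * z\<bar> \<le> (\<bar>k\<bar> + \<bar>\<mu>\<bar>) * (c * exp (- \<bar>k\<bar>))"
      unfolding abs_mult using that v[of k] by (intro mult_mono) auto
    also have "\<dots> = c * ((\<bar>k\<bar> + \<bar>\<mu>\<bar>) * exp (- \<bar>k\<bar>))" by simp
    also have "\<dots> \<le> c * ((2 + \<bar>\<mu>\<bar>) * E k)" by (rule mult_left_mono[OF vE c])
    finally show ?thesis by (simp add: mult.assoc)
  qed
  have u''b: "\<bar>u'' k\<bar> \<le> B * E k" for k
  proof -
    have "\<bar>u'' k\<bar> \<le> C * (2 + \<bar>\<mu>\<bar>) * E k + H * E k"
      unfolding u''_def using vu[OF C(1)[of k]] hb[of k] by linarith
    also have "\<dots> \<le> B * E k"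
    proof -
      have "C * (2 + \<bar>\<mu>\<bar>) \<le> C * exp 1 * (2 + \<bar>\<mu>\<bar>)" by (rule mult_right_mono[OF e1]) simp
      then have "C * (2 + \<bar>\<mu>\<bar>) + H \<le> B" using C0 by (simp add: B_def) (smt (verit) mult_nonneg_nonneg exp_ge_zero)
      then show ?thesis using E0[of k] by (simp add: distrib_right[symmetric])
    qed
    finally show ?thesis .
  qed
  have u''d: "\<bar>u'' (k + d) - u'' k\<bar> \<le> B * d * E k" if d: "d \<in> {0..1}" for k d
  proof -
    have sh: "exp (- \<bar>k + t\<bar>) \<le> exp 1 * exp (- \<bar>k\<bar>)" if "t \<in> {0..1}" for t
    proof -
      have "- \<bar>k + t\<bar> \<le> 1 + - \<bar>k\<bar>" using that by auto
      then show ?thesis by (simp only: exp_le_cancel_iff exp_add[symmetric])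
    qed
    have "\<bar>u (k + d) - u k\<bar> \<le> d * (C * exp 1 * exp (- \<bar>k\<bar>))"
    proof (cases "d = 0")
      case False
      then obtain z where z: "k < z" "z < k + d" "u (k + d) - u k = (k + d - k) * u' z"
        using MVT2[of k "k + d" u u'] u d by auto
      have "\<bar>u' z\<bar> \<le> C * exp (- \<bar>k + (z - k)\<bar>)" using C(2)[of z] by simp
      also have "\<dots> \<le> C * (exp 1 * exp (- \<bar>k\<bar>))"
        by (rule mult_left_mono[OF sh C0]) (use z d in auto)
      finally show ?thesis using z(3) d by (simp add: abs_mult mult_left_mono mult.assoc)
    qed simp
    then have 1: "\<bar>(\<bar>k\<bar> - \<mu>) * (u (k + d) - u k)\<bar> \<le> (d * C * exp 1) * (2 + \<bar>\<mu>\<bar>) * E k"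
      by (intro vu) (simp add: mult.assoc)
    have "\<bar>(\<bar>k + d\<bar> - \<bar>k\<bar>) * u (k + d)\<bar> \<le> d * (C * (exp 1 * exp (- \<bar>k\<bar>)))"
      unfolding abs_mult
    proof (rule mult_mono)
      show "\<bar>u (k + d)\<bar> \<le> C * (exp 1 * exp (- \<bar>k\<bar>))"
        using C(1)[of "k + d"] mult_left_mono[OF sh[OF d] C0] by linarith
    qed (use d in auto)
    also have "\<dots> = (d * C * exp 1) * exp (- \<bar>k\<bar>)" by simp
    also have "\<dots> \<le> (d * C * exp 1) * E k"
      unfolding eE using E1[of k] E0[of k] C0 d by (intro mult_left_mono) (auto simp: mult_le_cancel_left1)
    finally have 2: "\<bar>(\<bar>k + d\<bar> - \<bar>k\<bar>) * u (k + d)\<bar> \<le> (d * C * exp 1) * E k" .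
    have "u'' (k + d) - u'' k = (\<bar>k\<bar> - \<mu>) * (u (k + d) - u k) + (\<bar>k + d\<bar> - \<bar>k\<bar>) * u (k + d)
        - (h (k + d) - h k)"
      by (simp add: u''_def algebra_simps)
    moreover have tri: "\<bar>x + y - z\<bar> \<le> \<bar>x\<bar> + \<bar>y\<bar> + \<bar>z\<bar>" for x y z :: real by linarith
    ultimately have "\<bar>u'' (k + d) - u'' k\<bar> \<le> (d * C * exp 1) * (2 + \<bar>\<mu>\<bar>) * E k + (d * C * exp 1) * E k + H * d * E k"
      using order_trans[OF tri add_mono[OF add_mono[OF 1 2] hd[OF d, of k]]] by simp
    also have "\<dots> = B * d * E k" by (simp add: B_def algebra_simps)
    finally show ?thesis .
  qed
  have "\<forall>k. \<bar>u k\<bar> \<le> B * E k \<and> \<bar>u' k\<bar> \<le> B * E k \<and> \<bar>u'' k\<bar> \<le> B * E k \<and>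
      (\<forall>d\<in>{0..1}. \<bar>u'' (k + d) - u'' k\<bar> \<le> B * d * E k)"
    using order_trans[OF C(1) sm] order_trans[OF C(2) sm] u''b u''d by blast
  with u show ?thesis unfolding profile_def u''_def E_def by blast
qed

text \<open>The solutions decaying to the right and to the left are reflections of each other, and
  their Wronskian at 0 is \<open>2 * a (- \<mu>) * a' (- \<mu>)\<close>. A zero of \<open>a'\<close>
  is an even eigenfunction, a zero of \<open>a\<close> an odd one. In the given range the only zero
  is the one of \<open>a'\<close> at \<open>- l\<close>.\<close>

lemma airy_spectral_gap:
  obtains l u1 u1' where
    "profile u1 u1' (\<lambda>k. (\<bar>k\<bar> - l) * u1 k)" "\<And>k. u1 k > 0"
    "\<And>\<mu> h L K. \<mu> < l + 121/100 \<Longrightarrow> (\<And>x y. \<bar>h x - h y\<bar> \<le> L * \<bar>x - y\<bar>) \<Longrightarrow> K \<ge> 0 \<Longrightarrow>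
       (\<And>k. \<bar>k\<bar> \<ge> K \<Longrightarrow> h k = 0) \<Longrightarrow> \<mu> \<noteq> l \<or> (LINT k|lborel. u1 k * h k) = 0 \<Longrightarrow>
       \<exists>u u'. profile u u' (\<lambda>k. (\<bar>k\<bar> - \<mu>) * u k - h k)"
proof -
  obtain a a' where a: "ode_solution (\<lambda>x. x) a a'"
    and apos: "\<And>x. x \<ge> 0 \<Longrightarrow> a x > 0" and aneg: "\<And>x. x \<ge> 0 \<Longrightarrow> a' x < 0"
    and "\<exists>C. \<forall>x\<ge>0. a x \<le> C * exp (- x) \<and> \<bar>a' x\<bar> \<le> C * exp (- x)"
    using airy_decaying_exists by blast
  then obtain C where C: "\<And>x. x \<ge> 0 \<Longrightarrow> a x \<le> C * exp (- x)" "\<And>x. x \<ge> 0 \<Longrightarrow> \<bar>a' x\<bar> \<le> C * exp (- x)"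
    by blast
  obtain l where l: "0 < l" "l \<le> 6 / 5" "a' (- l) = 0" "\<And>x. x > - l \<Longrightarrow> a' x < 0"
    "\<And>x. x \<ge> - l \<Longrightarrow> a x > 0"
    using airy_derivative_zero[OF a aneg apos C(2)] by blast
  have pos: "a x > 0" if "x \<ge> - (l + 121/100)" for x
    using airy_positive_beyond[OF a l(1-3,5)] that by blast
  note D = ode_solutionD[OF a]
  have decay: "\<exists>B. \<forall>k\<ge>0. \<bar>a (k - \<mu>)\<bar> \<le> B * exp (- \<bar>k\<bar>) \<and> \<bar>a' (k - \<mu>)\<bar> \<le> B * exp (- \<bar>k\<bar>)" for \<mu>
  proof -
    define M where "M = \<bar>\<mu>\<bar>"
    have "continuous_on {0..M} (\<lambda>k. (\<bar>a (k - \<mu>)\<bar> + \<bar>a' (k - \<mu>)\<bar>) * exp \<bar>k\<bar>)"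
      by (intro continuous_intros continuous_on_compose2[OF ode_solution_continuous(1)[OF a, of UNIV]]
          continuous_on_compose2[OF ode_solution_continuous(2)[OF a, of UNIV]]) auto
    then have "bounded ((\<lambda>k. (\<bar>a (k - \<mu>)\<bar> + \<bar>a' (k - \<mu>)\<bar>) * exp \<bar>k\<bar>) ` {0..M})"
      by (intro compact_imp_bounded compact_continuous_image) auto
    then obtain B where "\<forall>z\<in>(\<lambda>k. (\<bar>a (k - \<mu>)\<bar> + \<bar>a' (k - \<mu>)\<bar>) * exp \<bar>k\<bar>) ` {0..M}. norm z \<le> B"
      unfolding bounded_iff by blast
    then have B: "\<bar>(\<bar>a (k - \<mu>)\<bar> + \<bar>a' (k - \<mu>)\<bar>) * exp \<bar>k\<bar>\<bar> \<le> B" if "k \<in> {0..M}" for k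
      using that by simp
    have B0: "B \<ge> 0" using B[of 0] by (simp add: M_def)
    define E where "E = max B (C * exp \<mu>)"
    have "\<bar>a (k - \<mu>)\<bar> \<le> E * exp (- \<bar>k\<bar>) \<and> \<bar>a' (k - \<mu>)\<bar> \<le> E * exp (- \<bar>k\<bar>)" if k: "k \<ge> 0" for k
    proof (cases "k \<le> M")
      case True
      have "(\<bar>a (k - \<mu>)\<bar> + \<bar>a' (k - \<mu>)\<bar>) * exp \<bar>k\<bar> \<le> E"
        using B[of k] True k by (simp add: E_def)
      then have "\<bar>a (k - \<mu>)\<bar> + \<bar>a' (k - \<mu>)\<bar> \<le> E * exp (- \<bar>k\<bar>)"
        by (simp add: exp_minus field_simps)
      then show ?thesis using abs_ge_zero[of "a (k - \<mu>)"] abs_ge_zero[of "a' (k - \<mu>)"] by linarith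
    next
      case False
      then have kk: "k - \<mu> \<ge> 0" by (simp add: M_def)
      have e: "C * exp (- (k - \<mu>)) = C * exp \<mu> * exp (- \<bar>k\<bar>)"
        using k by (simp add: exp_add[symmetric])
      have "C * exp \<mu> * exp (- \<bar>k\<bar>) \<le> E * exp (- \<bar>k\<bar>)"
        by (rule mult_right_mono) (auto simp: E_def)
      then show ?thesis using C[OF kk] apos[OF kk] unfolding e by linarith
    qed
    then show ?thesis by blast
  qed
  define u1 where "u1 = (\<lambda>k. if k \<ge> 0 then a (k - l) else a (- k - l))"
  define u1' where "u1' = (\<lambda>k. if k \<ge> 0 then a' (k - l) else - a' (- k - l))"
  have u1: "ode_solution (\<lambda>k. \<bar>k\<bar> - l) u1 u1'"
    unfolding u1_def u1'_def by (rule ode_solution_glue[OF a a]) (use l in simp_all)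
  note D1 = ode_solutionD[OF u1]
  obtain B where B: "\<And>k. k \<ge> 0 \<Longrightarrow> \<bar>a (k - l)\<bar> \<le> B * exp (- \<bar>k\<bar>) \<and> \<bar>a' (k - l)\<bar> \<le> B * exp (- \<bar>k\<bar>)"
    using decay[of l] by blast
  have u1b: "\<bar>u1 k\<bar> \<le> B * exp (- \<bar>k\<bar>) \<and> \<bar>u1' k\<bar> \<le> B * exp (- \<bar>k\<bar>)" for k
    using B[of k] B[of "- k"] by (cases "k \<ge> 0") (auto simp: u1_def u1'_def)
  have prof: "profile u1 u1' (\<lambda>k. (\<bar>k\<bar> - l) * u1 k)"
  proof -
    have "profile u1 u1' (\<lambda>k. (\<bar>k\<bar> - l) * u1 k - 0)"
      by (rule profile_of_ode[where L = 0 and K = 0]) (use D1 u1b in \<open>auto intro!: exI[of _ B]\<close>)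
    then show ?thesis by simp
  qed
  have u1pos: "u1 k > 0" for k using l(5) by (simp add: u1_def)
  have res: "\<exists>u u'. profile u u' (\<lambda>k. (\<bar>k\<bar> - \<mu>) * u k - h k)"
    if \<mu>: "\<mu> < l + 121/100" and h: "\<And>x y. \<bar>h x - h y\<bar> \<le> L * \<bar>x - y\<bar>" and K: "K \<ge> 0" "\<And>k. \<bar>k\<bar> \<ge> K \<Longrightarrow> h k = 0"
      and alt: "\<mu> \<noteq> l \<or> (LINT k|lborel. u1 k * h k) = 0" for \<mu> h L K
  proof -
    have "L-lipschitz_on UNIV h"
    proof (rule lipschitz_onI)
      show "L \<ge> 0" using h[of 0 1] by simp
    qed (use h in \<open>simp add: dist_real_def\<close>)
    then have hc: "continuous_on UNIV h" by (rule lipschitz_on_continuous_on)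
    show ?thesis
    proof (cases "\<mu> = l")
      case False
      have a'0: "a' (- \<mu>) \<noteq> 0"
      proof (cases "\<mu> < l")
        case True
        then show ?thesis using l(4)[of "- \<mu>"] by simp
      next
        case f: False
        \<comment> \<open>Between \<open>- \<mu>\<close> and \<open>- l\<close> the function
          \<open>a\<close> is positive at negative arguments, so \<open>a'' < 0\<close> and
          \<open>a'\<close> cannot vanish at both ends.\<close>
        obtain z where z: "- \<mu> < z" "z < - l" "a' (- l) - a' (- \<mu>) = (- l - - \<mu>) * (z * a z)"
          using MVT2[of "- \<mu>" "- l" a' "\<lambda>z. z * a z"] D(2) f False by auto
        have "z * a z < 0" using pos[of z] z l(1) \<mu> by (intro mult_neg_pos) auto
        then have "(- l - - \<mu>) * (z * a z) < 0" by (rule mult_pos_neg[rotated]) (use f False in linarith)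
        then show ?thesis using z(3) l(3) by simp
      qed
      \<comment> \<open>\<open>q\<close> has the reflected Cauchy data of \<open>a\<close> at
        \<open>- \<mu>\<close>, so it continues the right-decaying solution across 0; with the
        halves exchanged one gets the left-decaying solution.\<close>
      obtain q q' where q: "ode_solution (\<lambda>x. x) q q'" "q (- \<mu>) = a (- \<mu>)" "q' (- \<mu>) = - a' (- \<mu>)"
        using airy_ivp by blast
      have g1: "ode_solution (\<lambda>k. \<bar>k\<bar> - \<mu>) (\<lambda>k. if k \<ge> 0 then a (k - \<mu>) else q (- k - \<mu>))
          (\<lambda>k. if k \<ge> 0 then a' (k - \<mu>) else - q' (- k - \<mu>))"
        by (rule ode_solution_glue[OF a q(1)]) (use q in simp_all)
      have g2: "ode_solution (\<lambda>k. \<bar>k\<bar> - \<mu>) (\<lambda>k. if k \<ge> 0 then q (k - \<mu>) else a (- k - \<mu>))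
          (\<lambda>k. if k \<ge> 0 then q' (k - \<mu>) else - a' (- k - \<mu>))"
        by (rule ode_solution_glue[OF q(1) a]) (use q in simp_all)
      obtain E where E: "\<And>k. k \<ge> 0 \<Longrightarrow> \<bar>a (k - \<mu>)\<bar> \<le> E * exp (- \<bar>k\<bar>) \<and> \<bar>a' (k - \<mu>)\<bar> \<le> E * exp (- \<bar>k\<bar>)"
        using decay[of \<mu>] by blast
      have E2: "\<bar>if k \<ge> 0 then q (k - \<mu>) else a (- k - \<mu>)\<bar> \<le> E * exp (- \<bar>k\<bar>) \<and>
          \<bar>if k \<ge> 0 then q' (k - \<mu>) else - a' (- k - \<mu>)\<bar> \<le> E * exp (- \<bar>k\<bar>)" if "k \<le> 0" for k
        using E[of "- k"] that q by (cases "k = 0") auto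
      obtain u u' where u: "\<And>k. (u has_real_derivative u' k) (at k)"
        "\<And>k. (u' has_real_derivative (\<bar>k\<bar> - \<mu>) * u k - h k) (at k)"
        "\<exists>C. \<forall>k. \<bar>u k\<bar> \<le> C * exp (- \<bar>k\<bar>) \<and> \<bar>u' k\<bar> \<le> C * exp (- \<bar>k\<bar>)"
      proof (rule variation_of_constants[OF g1 g2 _ hc K])
        show "(if 0 \<le> (0::real) then a' (0 - \<mu>) else - q' (- 0 - \<mu>)) * (if 0 \<le> (0::real) then q (0 - \<mu>) else a (- 0 - \<mu>)) -
          (if 0 \<le> (0::real) then a (0 - \<mu>) else q (- 0 - \<mu>)) * (if 0 \<le> (0::real) then q' (0 - \<mu>) else - a' (- 0 - \<mu>)) \<noteq> 0"
          using q a'0 pos[of "- \<mu>"] \<mu> by simp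
        show "\<exists>C. \<forall>k\<ge>0. \<bar>if k \<ge> 0 then a (k - \<mu>) else q (- k - \<mu>)\<bar> \<le> C * exp (- \<bar>k\<bar>) \<and>
            \<bar>if k \<ge> 0 then a' (k - \<mu>) else - q' (- k - \<mu>)\<bar> \<le> C * exp (- \<bar>k\<bar>)"
          using E by (intro exI[of _ E]) simp
        show "(\<exists>C. \<forall>k\<le>0. \<bar>if k \<ge> 0 then q (k - \<mu>) else a (- k - \<mu>)\<bar> \<le> C * exp (- \<bar>k\<bar>) \<and>
            \<bar>if k \<ge> 0 then q' (k - \<mu>) else - a' (- k - \<mu>)\<bar> \<le> C * exp (- \<bar>k\<bar>))
          \<or> (LINT k|lborel. (if k \<ge> 0 then a (k - \<mu>) else q (- k - \<mu>)) * h k) = 0"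
          using E2 by (intro disjI1 exI[of _ E]) blast
      qed ((assumption | rule that)+)
      then show ?thesis using profile_of_ode[OF u h K] by blast
    next
      case True
      then have orth: "(LINT k|lborel. u1 k * h k) = 0" using alt by simp
      \<comment> \<open>At the eigenvalue the decaying solutions coincide with the even function
        \<open>u1\<close>. The odd solution completes the fundamental system, and decay on the left
        has to come from orthogonality.\<close>
      obtain q q' where q: "ode_solution (\<lambda>x. x) q q'" "q (- l) = 0" "q' (- l) = 1"
        using airy_ivp by blast
      have nq: "ode_solution (\<lambda>x. x) (\<lambda>x. (- 1) * q x + 0 * q x) (\<lambda>x. (- 1) * q' x + 0 * q' x)"
        by (rule ode_solution_combine[OF q(1) q(1)])
      have g2: "ode_solution (\<lambda>k. \<bar>k\<bar> - l) (\<lambda>k. if k \<ge> 0 then q (k - l) else (- 1) * q (- k - l) + 0 * q (- k - l))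
          (\<lambda>k. if k \<ge> 0 then q' (k - l) else - ((- 1) * q' (- k - l) + 0 * q' (- k - l)))"
        by (rule ode_solution_glue[OF q(1) nq]) (use q in simp_all)
      obtain u u' where u: "\<And>k. (u has_real_derivative u' k) (at k)"
        "\<And>k. (u' has_real_derivative (\<bar>k\<bar> - l) * u k - h k) (at k)"
        "\<exists>C. \<forall>k. \<bar>u k\<bar> \<le> C * exp (- \<bar>k\<bar>) \<and> \<bar>u' k\<bar> \<le> C * exp (- \<bar>k\<bar>)"
      proof (rule variation_of_constants[OF u1 g2 _ hc K])
        show "\<exists>C. \<forall>k\<ge>0. \<bar>u1 k\<bar> \<le> C * exp (- \<bar>k\<bar>) \<and> \<bar>u1' k\<bar> \<le> C * exp (- \<bar>k\<bar>)"
          using u1b by blast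
        show "u1' 0 * (if 0 \<le> (0::real) then q (0 - l) else - 1 * q (- 0 - l) + 0 * q (- 0 - l)) -
          u1 0 * (if 0 \<le> (0::real) then q' (0 - l) else - (- 1 * q' (- 0 - l) + 0 * q' (- 0 - l))) \<noteq> 0"
          using q l(5)[of "- l"] by (simp add: u1_def)
        show "(\<exists>C. \<forall>k\<le>0. \<bar>if k \<ge> 0 then q (k - l) else (- 1) * q (- k - l) + 0 * q (- k - l)\<bar> \<le> C * exp (- \<bar>k\<bar>) \<and>
            \<bar>if k \<ge> 0 then q' (k - l) else - ((- 1) * q' (- k - l) + 0 * q' (- k - l))\<bar> \<le> C * exp (- \<bar>k\<bar>))
          \<or> (LINT k|lborel. u1 k * h k) = 0"
          using orth by (rule disjI2)
      qed ((assumption | rule that)+)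
      then show ?thesis using profile_of_ode[OF u h K] True by blast
    qed
  qed
  show ?thesis
  proof (rule that[of u1 u1' l])
    fix \<mu> h L K
    assume "\<mu> < l + 121/100" "\<And>x y. \<bar>h x - h y\<bar> \<le> L * \<bar>x - y\<bar>" "K \<ge> 0"
      "\<And>k. \<bar>k\<bar> \<ge> K \<Longrightarrow> h k = 0" "\<mu> \<noteq> l \<or> (LINT k|lborel. u1 k * h k) = 0"
    then show "\<exists>u u'. profile u u' (\<lambda>k. (\<bar>k\<bar> - \<mu>) * u k - h k)" by (rule res)
  qed (rule prof u1pos)+
qed

section \<open>Fourier transforms of profiles\<close>

text \<open>Sign and normalisation agree with \<open>char\<close>, so averaging a transform over a
  law multiplies the profile by the characteristic function without further constants.\<close>

definition ft :: "(real \<Rightarrow> real) \<Rightarrow> real \<Rightarrow> complex" where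
  "ft u x = (LINT k|lborel. complex_of_real (u k) * iexp (k * x))"

lemma ft_integrable:
  assumes "integrable lborel u"
  shows "integrable lborel (\<lambda>k. complex_of_real (u k) * iexp (k * x))"
  by (rule Bochner_Integration.integrable_bound[OF assms]) (use assms in \<open>auto simp: norm_mult\<close>)

lemma ft_add:
  assumes "integrable lborel u" "integrable lborel v"
  shows "ft (\<lambda>k. u k + v k) x = ft u x + ft v x"
  unfolding ft_def using ft_integrable[OF assms(1), of x] ft_integrable[OF assms(2), of x]
  by (simp add: distrib_right)

lemma ft_diff:
  assumes "integrable lborel u" "integrable lborel v"
  shows "ft (\<lambda>k. u k - v k) x = ft u x - ft v x"
  unfolding ft_def using ft_integrable[OF assms(1), of x] ft_integrable[OF assms(2), of x]
  by (simp add: left_diff_distrib)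

lemma ft_cmult: "ft (\<lambda>k. c * u k) x = complex_of_real c * ft u x"
  unfolding ft_def by (simp add: mult.assoc)

lemma norm_ft_le:
  shows "norm (ft u x) \<le> (LINT k|lborel. \<bar>u k\<bar>)"
proof -
  have "norm (ft u x) \<le> (LINT k|lborel. norm (complex_of_real (u k) * iexp (k * x)))"
    unfolding ft_def by (rule integral_norm_bound)
  then show ?thesis by (simp add: norm_mult)
qed

section \<open>Integrals over the line and the transform of a two-sided exponential\<close>

lemma integral_real_line_FTC:
  fixes F :: "real \<Rightarrow> 'a :: euclidean_space"
  assumes D: "\<And>k. (F has_vector_derivative f k) (at k)" and f: "\<And>k. isCont f k" "integrable lborel f"
    and lim: "(F \<longlongrightarrow> A) at_bot" "(F \<longlongrightarrow> B) at_top"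
  shows "(LINT k|lborel. f k) = B - A"
proof -
  have "(LBINT x=-\<infinity>..\<infinity>. f x) = B - A"
  proof (rule interval_integral_FTC_integrable)
    show "set_integrable lborel (einterval (-\<infinity>) \<infinity>) f"
      using f(2) by (simp add: set_integrable_def)
    show "((F \<circ> real_of_ereal) \<longlongrightarrow> A) (at_right (-\<infinity>))" "((F \<circ> real_of_ereal) \<longlongrightarrow> B) (at_left \<infinity>)"
      using lim by (simp_all add: ereal_tendsto_simps)
  qed (use D f in auto)
  then show ?thesis by (simp add: interval_lebesgue_integral_def set_lebesgue_integral_def)
qed

lemma integral_odd:
  fixes f :: "real \<Rightarrow> real"
  assumes "\<And>k. f (- k) = - f k"
  shows "(LINT k|lborel. f k) = 0"
  using lborel_integral_real_affine[of "-1" f 0] assms by simp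

lemma integrable_exp_abs:
  assumes c: "c > 0"
  shows "integrable lborel (\<lambda>k::real. exp (- c * \<bar>k\<bar>))"
proof -
  have 1: "integrable lborel (\<lambda>k::real. indicator {0<..} k * exp (- (k * c)))"
    using integrable_I0i_exp_mscale[OF c] by (simp add: set_integrable_def)
  have 2: "integrable lborel (\<lambda>k::real. indicator {0<..} (- k) * exp (- (- k * c)))"
    using lborel_integrable_real_affine[OF 1, of "-1" 0] by simp
  show ?thesis
  proof (rule Bochner_Integration.integrable_bound[OF Bochner_Integration.integrable_add[OF 1 2]])
    show "AE k in lborel. norm (exp (- c * \<bar>k\<bar>))
        \<le> norm (indicator {0<..} k * exp (- (k * c)) + indicator {0<..} (- k) * exp (- (- k * c)))"
      using AE_lborel_singleton[of "0::real"]
      by eventually_elim (auto simp: indicator_def mult.commute abs_if)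
  qed simp
qed

lemma ft_exp_abs:
  assumes c: "c > 0"
  shows "ft (\<lambda>k. exp (- c * \<bar>k\<bar>)) x = complex_of_real (2 * c / (c\<^sup>2 + x\<^sup>2))"
proof -
  have pos: "c\<^sup>2 + x\<^sup>2 > 0" using c by (simp add: add_pos_nonneg)
  then have ne: "c\<^sup>2 + x\<^sup>2 \<noteq> 0" by linarith
  \<comment> \<open>\<open>R\<close> and \<open>L\<close> are antiderivatives of the cosine part on
    the two half-lines. The constant in \<open>R\<close> makes them agree at 0 and is itself the
    value of the integral, because \<open>L\<close> tends to 0 on the left.\<close>
  define R where "R = (\<lambda>k. 2 * c / (c\<^sup>2 + x\<^sup>2) + exp (- c * k) * (x * sin (k * x) - c * cos (k * x)) / (c\<^sup>2 + x\<^sup>2))"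
  define L where "L = (\<lambda>k. exp (c * k) * (x * sin (k * x) + c * cos (k * x)) / (c\<^sup>2 + x\<^sup>2))"
  have DR: "(R has_real_derivative exp (- c * k) * cos (k * x)) (at k)" for k
  proof -
    have "((\<lambda>k. exp (- c * k) * (x * sin (k * x) - c * cos (k * x))) has_real_derivative
        (c\<^sup>2 + x\<^sup>2) * (exp (- c * k) * cos (k * x))) (at k)"
      by (auto intro!: derivative_eq_intros simp: algebra_simps power2_eq_square)
    from DERIV_cong[OF DERIV_cdivide[OF this] nonzero_mult_div_cancel_left[OF ne]] show ?thesis
      unfolding R_def by (auto intro!: DERIV_cong[OF DERIV_add[OF DERIV_const]])
  qed
  have DL: "(L has_real_derivative exp (c * k) * cos (k * x)) (at k)" for k
  proof -
    have "((\<lambda>k. exp (c * k) * (x * sin (k * x) + c * cos (k * x))) has_real_derivative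
        (c\<^sup>2 + x\<^sup>2) * (exp (c * k) * cos (k * x))) (at k)"
      by (auto intro!: derivative_eq_intros simp: algebra_simps power2_eq_square)
    from DERIV_cong[OF DERIV_cdivide[OF this] nonzero_mult_div_cancel_left[OF ne]] show ?thesis
      unfolding L_def .
  qed
  define F where "F = (\<lambda>k. if k \<ge> 0 then R k else L k)"
  have DF: "(F has_real_derivative exp (- c * \<bar>k\<bar>) * cos (k * x)) (at k)" for k
  proof -
    have "(F has_real_derivative (if k \<ge> 0 then exp (- c * k) * cos (k * x) else exp (c * k) * cos (k * x))) (at k)"
      unfolding F_def by (rule DERIV_glue_at_0[OF DR DL]) (simp_all add: R_def L_def diff_divide_distrib[symmetric])
    then show ?thesis by (simp split: if_splits)
  qed
  have int: "integrable lborel (\<lambda>k. exp (- c * \<bar>k\<bar>) * cos (k * x))"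
    by (rule Bochner_Integration.integrable_bound[OF integrable_exp_abs[OF c]])
       (auto simp: abs_mult mult_left_le)
  have "(LINT k|lborel. exp (- c * \<bar>k\<bar>) * cos (k * x)) = 2 * c / (c\<^sup>2 + x\<^sup>2) - 0"
  proof (rule integral_real_line_FTC[OF _ _ int])
    show "(F has_vector_derivative exp (- c * \<bar>k\<bar>) * cos (k * x)) (at k)" for k
      using DF[of k] by (simp add: has_real_derivative_iff_has_vector_derivative)
    show "isCont (\<lambda>k. exp (- c * \<bar>k\<bar>) * cos (k * x)) k" for k
      by (intro continuous_intros)
    have bd: "\<bar>x * sin (k * x) + s * c * cos (k * x)\<bar> \<le> \<bar>x\<bar> + c" if "\<bar>s\<bar> = 1" for k s
    proof -
      have "\<bar>x * sin (k * x)\<bar> \<le> \<bar>x\<bar> * 1" "\<bar>s * c * cos (k * x)\<bar> \<le> \<bar>s * c\<bar> * 1"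
        unfolding abs_mult by (intro mult_left_mono; simp)+
      moreover have "\<bar>s * c\<bar> = c" using that c by (simp add: abs_mult)
      ultimately show ?thesis by linarith
    qed
    have "((\<lambda>k. exp (c * k) * ((\<bar>x\<bar> + c) / (c\<^sup>2 + x\<^sup>2))) \<longlongrightarrow> 0) at_bot"
      using c by real_asymp
    then have "(L \<longlongrightarrow> 0) at_bot"
    proof (rule Lim_null_comparison[rotated])
      show "\<forall>\<^sub>F k in at_bot. norm (L k) \<le> exp (c * k) * ((\<bar>x\<bar> + c) / (c\<^sup>2 + x\<^sup>2))"
        using bd[of 1] pos by (intro always_eventually allI) (simp add: L_def abs_mult divide_right_mono mult_left_mono)
    qed
    moreover have "\<forall>\<^sub>F k in at_bot. L k = F k"
      using eventually_gt_at_bot[of "0::real"] by eventually_elim (simp add: F_def)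
    ultimately show "(F \<longlongrightarrow> 0) at_bot" by (rule Lim_transform_eventually)
    have "((\<lambda>k. exp (- c * k) * ((\<bar>x\<bar> + c) / (c\<^sup>2 + x\<^sup>2))) \<longlongrightarrow> 0) at_top"
      using c by real_asymp
    then have "((\<lambda>k. R k - 2 * c / (c\<^sup>2 + x\<^sup>2)) \<longlongrightarrow> 0) at_top"
    proof (rule Lim_null_comparison[rotated])
      show "\<forall>\<^sub>F k in at_top. norm (R k - 2 * c / (c\<^sup>2 + x\<^sup>2)) \<le> exp (- c * k) * ((\<bar>x\<bar> + c) / (c\<^sup>2 + x\<^sup>2))"
        using bd[of "-1"] pos by (intro always_eventually allI) (simp add: R_def abs_mult divide_right_mono mult_left_mono)
    qed
    then have "(R \<longlongrightarrow> 2 * c / (c\<^sup>2 + x\<^sup>2)) at_top" by (simp add: LIM_zero_iff)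
    moreover have "\<forall>\<^sub>F k in at_top. R k = F k"
      using eventually_ge_at_top[of "0::real"] by eventually_elim (simp add: F_def)
    ultimately show "(F \<longlongrightarrow> 2 * c / (c\<^sup>2 + x\<^sup>2)) at_top" by (rule Lim_transform_eventually)
  qed
  moreover have "(LINT k|lborel. exp (- c * \<bar>k\<bar>) * sin (k * x)) = 0"
    by (rule integral_odd) simp
  moreover have "Re (ft (\<lambda>k. exp (- c * \<bar>k\<bar>)) x) = (LINT k|lborel. exp (- c * \<bar>k\<bar>) * cos (k * x))"
    "Im (ft (\<lambda>k. exp (- c * \<bar>k\<bar>)) x) = (LINT k|lborel. exp (- c * \<bar>k\<bar>) * sin (k * x))"
    unfolding ft_def
    using integral_Re[OF ft_integrable[OF integrable_exp_abs[OF c], of x]]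
      integral_Im[OF ft_integrable[OF integrable_exp_abs[OF c], of x]]
    by (simp_all add: Re_exp Im_exp)
  ultimately show ?thesis by (simp add: complex_eq_iff)
qed

lemma integral_exp_abs:
  assumes c: "c > 0"
  shows "(LINT k|lborel. exp (- c * \<bar>k\<bar>)) = 2 / (c :: real)"
proof -
  have "complex_of_real (LINT k|lborel. exp (- c * \<bar>k\<bar>)) = ft (\<lambda>k. exp (- c * \<bar>k\<bar>)) 0"
    unfolding ft_def by (simp del: of_real_exp)
  also have "\<dots> = complex_of_real (2 / c)"
    unfolding ft_exp_abs[OF c] using c by (simp add: power2_eq_square)
  finally show ?thesis using of_real_eq_iff by blast
qed

lemma integrable_exp_bound:
  assumes f: "f \<in> borel_measurable lborel" and c: "c > 0" and b: "\<And>k. \<bar>f k\<bar> \<le> C * exp (- c * \<bar>k\<bar>)"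
  shows "integrable lborel (f :: real \<Rightarrow> real)" and "(LINT k|lborel. \<bar>f k\<bar>) \<le> C * (2 / c)"
proof -
  have e: "integrable lborel (\<lambda>k. C * exp (- c * \<bar>k\<bar>))"
    using integrable_exp_abs[OF c] by simp
  show i: "integrable lborel f"
    by (rule Bochner_Integration.integrable_bound[OF e f]) (use b in \<open>auto intro: order_trans[OF _ abs_ge_self]\<close>)
  have "(LINT k|lborel. \<bar>f k\<bar>) \<le> (LINT k|lborel. C * exp (- c * \<bar>k\<bar>))"
    by (rule integral_mono) (use i e b in auto)
  also have "\<dots> = C * (2 / c)" by (simp only: integral_mult_right_zero integral_exp_abs[OF c])
  finally show "(LINT k|lborel. \<bar>f k\<bar>) \<le> C * (2 / c)" .
qed

lemma tendsto_0_exp_bound: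
  fixes f :: "real \<Rightarrow> real"
  assumes c: "c > 0" and b: "\<And>k. \<bar>f k\<bar> \<le> C * exp (- c * \<bar>k\<bar>)"
  shows "(f \<longlongrightarrow> 0) at_top" "(f \<longlongrightarrow> 0) at_bot"
proof -
  have "((\<lambda>k. C * exp (- c * k)) \<longlongrightarrow> 0) at_top" using c by real_asymp
  then show "(f \<longlongrightarrow> 0) at_top"
  proof (rule Lim_null_comparison[rotated])
    show "\<forall>\<^sub>F k in at_top. norm (f k) \<le> C * exp (- c * k)"
      using eventually_ge_at_top[of "0::real"] 
    proof eventually_elim
      case (elim k)
      then show ?case using b[of k] by simp
    qed
  qed
  have "((\<lambda>k. C * exp (c * k)) \<longlongrightarrow> 0) at_bot" using c by real_asymp
  then show "(f \<longlongrightarrow> 0) at_bot"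
  proof (rule Lim_null_comparison[rotated])
    show "\<forall>\<^sub>F k in at_bot. norm (f k) \<le> C * exp (c * k)"
      using eventually_le_at_bot[of "0::real"]
    proof eventually_elim
      case (elim k)
      then show ?case using b[of k] by simp
    qed
  qed
qed

lemma ft_deriv:
  assumes D: "\<And>k. (f has_real_derivative f' k) (at k)" and cont: "\<And>k. isCont f' k"
    and i: "integrable lborel f" "integrable lborel f'"
    and lim: "(f \<longlongrightarrow> 0) at_top" "(f \<longlongrightarrow> 0) at_bot"
  shows "ft f' x = - \<i> * complex_of_real x * ft f x"
proof -
  define F where "F = (\<lambda>k. complex_of_real (f k) * iexp (k * x))"
  define G where "G = (\<lambda>k. complex_of_real (f' k) * iexp (k * x)
      + \<i> * complex_of_real x * (complex_of_real (f k) * iexp (k * x)))"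
  have DF: "(F has_vector_derivative G k) (at k)" for k
  proof -
    have 1: "((\<lambda>k. complex_of_real (f k)) has_vector_derivative complex_of_real (f' k)) (at k)"
      using D[of k] by (intro has_vector_derivative_of_real) (simp add: has_real_derivative_iff_has_vector_derivative)
    have 2: "((\<lambda>k. iexp (k * x)) has_vector_derivative \<i> * complex_of_real x * iexp (k * x)) (at k)"
    proof -
      have "((\<lambda>k. exp (\<i> * complex_of_real x * k)) has_field_derivative \<i> * complex_of_real x * exp (\<i> * complex_of_real x * of_real k)) (at (of_real k))"
        by (auto intro!: derivative_eq_intros)
      from has_vector_derivative_real_field[OF this] show ?thesis
        by (simp add: mult_ac)
    qed
    show ?thesis unfolding F_def G_def
      by (rule has_vector_derivative_eq_rhs[OF has_vector_derivative_mult[OF 1 2]]) simp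
  qed
  have nF: "norm (F k) = \<bar>f k\<bar>" for k by (simp add: F_def norm_mult)
  have iG: "integrable lborel G"
    unfolding G_def using ft_integrable[OF i(1), of x] ft_integrable[OF i(2), of x] by simp
  have "(LINT k|lborel. G k) = 0 - 0"
  proof (rule integral_real_line_FTC[OF DF _ iG])
    show "isCont G k" for k
      unfolding G_def using cont DERIV_isCont[OF D] by (intro continuous_intros) auto
    show "(F \<longlongrightarrow> 0) at_bot" "(F \<longlongrightarrow> 0) at_top"
      using lim by (auto intro!: Lim_null_comparison[where f = F and g = "\<lambda>k. \<bar>f k\<bar>"] tendsto_rabs_zero simp: nF)
  qed
  moreover have "(LINT k|lborel. G k) = ft f' x + \<i> * complex_of_real x * ft f x"
    unfolding G_def ft_def using ft_integrable[OF i(1), of x] ft_integrable[OF i(2), of x] by simp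
  ultimately show ?thesis by (simp add: eq_neg_iff_add_eq_0)
qed

section \<open>Regularity and decay of transforms of profiles\<close>

lemma profileD:
  assumes "profile u u' u''"
  shows "(u has_real_derivative u' k) (at k)" "(u' has_real_derivative u'' k) (at k)"
  using assms by (auto simp: profile_def)

lemma profile_continuous:
  assumes "profile u u' u''"
  shows "isCont u k" "isCont u' k" "isCont u'' k"
proof -
  show "isCont u k" "isCont u' k" using DERIV_isCont[OF profileD(1)[OF assms]] DERIV_isCont[OF profileD(2)[OF assms]] by auto
  obtain C where C: "\<And>k d. d \<in> {0..1} \<Longrightarrow> \<bar>u'' (k + d) - u'' k\<bar> \<le> C * d * exp (- \<bar>k\<bar> / 2)"
    using assms unfolding profile_def by blast
  have C0: "C \<ge> 0" using C[of 1 0] abs_ge_zero[of "u'' 1 - u'' 0"] by simp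
  have up: "\<bar>u'' (a + d) - u'' a\<bar> \<le> C * d" if "d \<in> {0..1}" for a d
  proof -
    have "C * d * exp (- \<bar>a\<bar> / 2) \<le> C * d * 1"
      by (rule mult_left_mono) (use C0 that in auto)
    with C[OF that, of a] show ?thesis by linarith
  qed
  have b: "\<bar>u'' y - u'' k\<bar> \<le> C * \<bar>y - k\<bar>" if "\<bar>y - k\<bar> \<le> 1" for y
    using up[of "y - k" k] up[of "k - y" y] that by (cases "y \<ge> k") (auto simp: abs_minus_commute)
  have "((\<lambda>y. C * \<bar>y - k\<bar>) \<longlongrightarrow> C * \<bar>k - k\<bar>) (at k)" by (intro tendsto_intros)
  then have t: "((\<lambda>y. C * \<bar>y - k\<bar>) \<longlongrightarrow> 0) (at k)" by simp
  have "\<forall>\<^sub>F y in at k. dist y k < 1"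
    by (auto simp: eventually_at intro!: exI[of _ 1])
  then have "\<forall>\<^sub>F y in at k. norm (u'' y - u'' k) \<le> C * \<bar>y - k\<bar>"
    by eventually_elim (use b in \<open>simp add: dist_real_def\<close>)
  then have "((\<lambda>y. u'' y - u'' k) \<longlongrightarrow> 0) (at k)"
    by (rule Lim_null_comparison) (rule t)
  then show "isCont u'' k" by (simp add: isCont_def LIM_zero_iff)
qed

lemma profile_measurable [measurable_dest]:
  assumes "profile u u' u''"
  shows "u \<in> borel_measurable borel" "u' \<in> borel_measurable borel" "u'' \<in> borel_measurable borel"
  using profile_continuous[OF assms]
  by (auto intro!: borel_measurable_continuous_onI continuous_at_imp_continuous_on)

lemma profile_bounds:
  assumes "profile u u' u''"
  obtains C where "C \<ge> 0" "\<And>k. \<bar>u k\<bar> \<le> C * exp (- (1/2) * \<bar>k\<bar>)" "\<And>k. \<bar>u' k\<bar> \<le> C * exp (- (1/2) * \<bar>k\<bar>)"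
    "\<And>k. \<bar>u'' k\<bar> \<le> C * exp (- (1/2) * \<bar>k\<bar>)"
    "\<And>k d. d \<in> {0..1} \<Longrightarrow> \<bar>u'' (k + d) - u'' k\<bar> \<le> C * d * exp (- (1/2) * \<bar>k\<bar>)"
proof -
  obtain C where C: "\<And>k. \<bar>u k\<bar> \<le> C * exp (- \<bar>k\<bar> / 2)" "\<And>k. \<bar>u' k\<bar> \<le> C * exp (- \<bar>k\<bar> / 2)"
    "\<And>k. \<bar>u'' k\<bar> \<le> C * exp (- \<bar>k\<bar> / 2)"
    "\<And>k d. d \<in> {0..1} \<Longrightarrow> \<bar>u'' (k + d) - u'' k\<bar> \<le> C * d * exp (- \<bar>k\<bar> / 2)"
    using assms unfolding profile_def by blast
  moreover have "C \<ge> 0" using C(1)[of 0] abs_ge_zero[of "u 0"] by simp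
  moreover have "- \<bar>k\<bar> / 2 = - (1/2) * \<bar>k\<bar>" for k :: real by simp
  ultimately show ?thesis using that by metis
qed

lemma profile_integrable:
  assumes "profile u u' u''"
  shows "integrable lborel u" "integrable lborel u'" "integrable lborel u''"
proof -
  obtain C where C: "\<And>k. \<bar>u k\<bar> \<le> C * exp (- (1/2) * \<bar>k\<bar>)" "\<And>k. \<bar>u' k\<bar> \<le> C * exp (- (1/2) * \<bar>k\<bar>)"
    "\<And>k. \<bar>u'' k\<bar> \<le> C * exp (- (1/2) * \<bar>k\<bar>)"
    using profile_bounds[OF assms] by metis
  note m = profile_measurable[OF assms]
  show "integrable lborel u" "integrable lborel u'" "integrable lborel u''"
    by (rule integrable_exp_bound[where c = "1/2" and C = C]; use m C in simp)+
qed

lemma ft_profile_second: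
  assumes "profile u u' u''"
  shows "ft u'' x = - (complex_of_real x)\<^sup>2 * ft u x"
proof -
  obtain C where C: "\<And>k. \<bar>u k\<bar> \<le> C * exp (- (1/2) * \<bar>k\<bar>)" "\<And>k. \<bar>u' k\<bar> \<le> C * exp (- (1/2) * \<bar>k\<bar>)"
    using profile_bounds[OF assms] by metis
  have h: "(1/2::real) > 0" by simp
  have 1: "ft u' x = - \<i> * complex_of_real x * ft u x"
    by (rule ft_deriv[OF profileD(1)[OF assms] profile_continuous(2)[OF assms]
        profile_integrable(1,2)[OF assms] tendsto_0_exp_bound[OF h C(1)]])
  have 2: "ft u'' x = - \<i> * complex_of_real x * ft u' x"
    by (rule ft_deriv[OF profileD(2)[OF assms] profile_continuous(3)[OF assms]
        profile_integrable(2,3)[OF assms] tendsto_0_exp_bound[OF h C(2)]])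
  show ?thesis unfolding 2 1 by (simp add: power2_eq_square algebra_simps)
qed

text \<open>
  Translating the integrand by half a period \<open>pi / x\<close> changes the sign of \<open>iexp (k * x)\<close>, so the
  modulus of continuity of \<open>g\<close> gives decay of its transform without a further derivative.
\<close>

lemma ft_decay_of_lipschitz:
  assumes g: "integrable lborel g"
    and lip: "\<And>k d. d \<in> {0..1} \<Longrightarrow> \<bar>g (k + d) - g k\<bar> \<le> C * d * exp (- (1/2) * \<bar>k\<bar>)"
    and x: "\<bar>x\<bar> \<ge> pi"
  shows "norm (ft g x) \<le> 2 * pi * C / \<bar>x\<bar>"
proof -
  define d where "d = pi / \<bar>x\<bar>"
  have x0: "\<bar>x\<bar> > 0" using x pi_gt_zero by linarith
  have d: "d \<in> {0..1}" using x x0 by (simp add: d_def)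
  have e: "iexp (d * x) = -1"
  proof (cases "x > 0")
    case True
    then have "d * x = pi" by (simp add: d_def)
    then show ?thesis by simp
  next
    case False
    then have "d * x = - pi" using x0 by (simp add: d_def)
    then show ?thesis by (simp add: exp_minus)
  qed
  have gd: "integrable lborel (\<lambda>k. g (k + d))"
    using lborel_integrable_real_affine[OF g, of 1 d] by (simp add: add.commute)
  have "ft g x = (LINT k|lborel. complex_of_real (g (d + 1 * k)) * iexp ((d + 1 * k) * x))"
    unfolding ft_def by (subst lborel_integral_real_affine[of 1 _ d]) simp_all
  also have "\<dots> = (LINT k|lborel. - (complex_of_real (g (k + d)) * iexp (k * x)))"
  proof (rule Bochner_Integration.integral_cong[OF refl])
    fix k :: real
    have "iexp ((d + 1 * k) * x) = iexp (d * x) * iexp (k * x)"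
      by (simp add: distrib_right distrib_left exp_add)
    then show "complex_of_real (g (d + 1 * k)) * iexp ((d + 1 * k) * x) =
        - (complex_of_real (g (k + d)) * iexp (k * x))"
      unfolding e by (simp add: add.commute)
  qed
  also have "\<dots> = - ft (\<lambda>k. g (k + d)) x" unfolding ft_def by simp
  finally have "2 * ft g x = ft (\<lambda>k. g k - g (k + d)) x"
    by (simp add: ft_diff[OF g gd])
  then have "norm (2 * ft g x) \<le> (LINT k|lborel. \<bar>g k - g (k + d)\<bar>)"
    using norm_ft_le by metis
  also have "\<dots> \<le> (C * d) * (2 / (1/2))"
    by (rule integrable_exp_bound(2)) (use g gd lip[OF d] in \<open>auto simp: abs_minus_commute\<close>)
  finally have "norm (ft g x) \<le> 2 * C * d" by (simp add: norm_mult)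
  then show ?thesis by (simp add: d_def mult_ac)
qed

text \<open>Two powers of \<open>x\<close> come from the second derivative and one more from its
  Lipschitz bound. Cubic decay keeps \<open>x^2 * ft u x\<close> square integrable and supplies the
  weight used against the heavy Cauchy tails.\<close>

lemma ft_profile_decay:
  assumes p: "profile u u' u''"
  obtains C where "C > 0" "\<And>x. norm (ft u x) \<le> C / (1 + \<bar>x\<bar>) ^ 3"
proof -
  obtain C where C: "C \<ge> 0" "\<And>k. \<bar>u k\<bar> \<le> C * exp (- (1/2) * \<bar>k\<bar>)"
    "\<And>k d. d \<in> {0..1} \<Longrightarrow> \<bar>u'' (k + d) - u'' k\<bar> \<le> C * d * exp (- (1/2) * \<bar>k\<bar>)"
    using profile_bounds[OF p] by metis
  \<comment> \<open>The factor 512 covers both cases: \<open>8 * 8\<close> for large \<bar>x\<bar>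
    and \<open>5 ^ 3 * 4\<close> for small; adding 1 to \<open>C\<close> makes the constant
    positive.\<close>
  have "norm (ft u x) \<le> (512 * (C + 1)) / (1 + \<bar>x\<bar>) ^ 3" for x
  proof (cases "\<bar>x\<bar> \<ge> pi")
    case True
    then have x1: "\<bar>x\<bar> \<ge> 1" using pi_ge_two by linarith
    have "norm (ft u'' x) \<le> 2 * pi * C / \<bar>x\<bar>"
      by (rule ft_decay_of_lipschitz[OF profile_integrable(3)[OF p] C(3) True])
    then have "x\<^sup>2 * norm (ft u x) \<le> 2 * pi * C / \<bar>x\<bar>"
      unfolding ft_profile_second[OF p] by (simp add: norm_mult norm_power)
    then have "\<bar>x\<bar> ^ 3 * norm (ft u x) \<le> 2 * pi * C"
      using x1 by (simp add: field_simps power3_eq_cube power2_eq_square)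
    also have "\<dots> \<le> 8 * C" using pi_less_4 C(1) by (simp add: mult_right_mono)
    finally have 1: "\<bar>x\<bar> ^ 3 * norm (ft u x) \<le> 8 * C" .
    have "(1 + \<bar>x\<bar>) ^ 3 \<le> (2 * \<bar>x\<bar>) ^ 3" by (rule power_mono) (use x1 in auto)
    then have "(1 + \<bar>x\<bar>) ^ 3 * norm (ft u x) \<le> (2 * \<bar>x\<bar>) ^ 3 * norm (ft u x)"
      by (rule mult_right_mono) simp
    also have "\<dots> = 8 * (\<bar>x\<bar> ^ 3 * norm (ft u x))" by (simp add: power_mult_distrib)
    also have "\<dots> \<le> 8 * (8 * C)" using 1 by (rule mult_left_mono) simp
    also have "\<dots> \<le> 512 * (C + 1)" using C(1) by simp
    finally have "(1 + \<bar>x\<bar>) ^ 3 * norm (ft u x) \<le> 512 * (C + 1)" .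
    then show ?thesis by (simp add: field_simps)
  next
    case False
    then have "1 + \<bar>x\<bar> \<le> 5" using pi_less_4 by linarith
    then have "(1 + \<bar>x\<bar>) ^ 3 \<le> 5 ^ 3" by (intro power_mono) auto
    moreover have "norm (ft u x) \<le> C * (2 / (1/2))"
      by (rule order_trans[OF norm_ft_le integrable_exp_bound(2)]) (use C profile_measurable[OF p] in auto)
    ultimately have "(1 + \<bar>x\<bar>) ^ 3 * norm (ft u x) \<le> 5 ^ 3 * (C * (2 / (1/2)))"
      by (intro mult_mono) auto
    then have "(1 + \<bar>x\<bar>) ^ 3 * norm (ft u x) \<le> 512 * (C + 1)" using C(1) by simp
    then show ?thesis by (simp add: field_simps)
  qed
  then show ?thesis using that[of "512 * (C + 1)"] C(1) by auto
qed

lemma abs_le_exp_quarter: "\<bar>k\<bar> * exp (- (1/2) * \<bar>k\<bar>) \<le> 4 * exp (- (1/4) * \<bar>k\<bar>)" for k :: real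
proof -
  have "\<bar>k\<bar> / 4 \<le> exp (\<bar>k\<bar> / 4)" using exp_ge_add_one_self[of "\<bar>k\<bar> / 4"] by linarith
  then have "\<bar>k\<bar> * exp (- (1/2) * \<bar>k\<bar>) \<le> 4 * exp (\<bar>k\<bar> / 4) * exp (- (1/2) * \<bar>k\<bar>)"
    by (intro mult_right_mono) auto
  also have "\<dots> = 4 * exp (- (1/4) * \<bar>k\<bar>)" by (simp add: exp_add[symmetric])
  finally show ?thesis .
qed

lemma square_le_exp_quarter: "k\<^sup>2 * exp (- (1/2) * \<bar>k\<bar>) \<le> 32 * exp (- (1/4) * \<bar>k\<bar>)" for k :: real
proof -
  have "(\<bar>k\<bar> / 4)\<^sup>2 / 2 \<le> exp (\<bar>k\<bar> / 4)"
    using exp_lower_Taylor_quadratic[of "\<bar>k\<bar> / 4"] by simp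
  then have "k\<^sup>2 \<le> 32 * exp (\<bar>k\<bar> / 4)" by (simp add: power_divide)
  then have "k\<^sup>2 * exp (- (1/2) * \<bar>k\<bar>) \<le> 32 * exp (\<bar>k\<bar> / 4) * exp (- (1/2) * \<bar>k\<bar>)"
    by (intro mult_right_mono) auto
  also have "\<dots> = 32 * exp (- (1/4) * \<bar>k\<bar>)" by (simp add: exp_add[symmetric])
  finally show ?thesis .
qed

lemma norm_iexp_diff: "norm (iexp a - iexp b) \<le> \<bar>a - b\<bar>" for a b :: real
proof -
  have "iexp a - iexp b = iexp b * (iexp (a - b) - 1)"
    by (simp add: right_diff_distrib exp_add[symmetric] left_diff_distrib)
  then have "norm (iexp a - iexp b) = norm (iexp (a - b) - 1)" by (simp add: norm_mult)
  then show ?thesis using iexp_approx1[of "a - b" 0] by simp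
qed

lemma profile_abs_mult_integrable:
  assumes p: "profile u u' u''"
  shows "integrable lborel (\<lambda>k. \<bar>k\<bar> * u k)"
proof -
  obtain C where C: "C \<ge> 0" "\<And>k. \<bar>u k\<bar> \<le> C * exp (- (1/2) * \<bar>k\<bar>)"
    using profile_bounds[OF p] by metis
  have "\<bar>\<bar>k\<bar> * u k\<bar> \<le> C * 4 * exp (- (1/4) * \<bar>k\<bar>)" for k
  proof -
    have "\<bar>\<bar>k\<bar> * u k\<bar> \<le> \<bar>k\<bar> * (C * exp (- (1/2) * \<bar>k\<bar>))"
      unfolding abs_mult using C(2)[of k] by (simp add: mult_left_mono)
    also have "\<dots> = C * (\<bar>k\<bar> * exp (- (1/2) * \<bar>k\<bar>))" by simp
    also have "\<dots> \<le> C * (4 * exp (- (1/4) * \<bar>k\<bar>))"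
      by (rule mult_left_mono[OF abs_le_exp_quarter C(1)])
    finally show ?thesis by simp
  qed
  then show ?thesis
    by (intro integrable_exp_bound(1)[where c = "1/4"]) (use profile_measurable[OF p] in auto)
qed

lemma ft_profile_lipschitz:
  assumes p: "profile u u' u''"
  obtains C where "C > 0" "\<And>x y. norm (ft u x - ft u y) \<le> C * \<bar>x - y\<bar>"
proof -
  define C where "C = (LINT k|lborel. \<bar>\<bar>k\<bar> * u k\<bar>) + 1"
  have i: "integrable lborel (\<lambda>k. \<bar>k\<bar> * u k)" by (rule profile_abs_mult_integrable[OF p])
  have "norm (ft u x - ft u y) \<le> C * \<bar>x - y\<bar>" for x y
  proof -
    note I = ft_integrable[OF profile_integrable(1)[OF p]]
    have "ft u x - ft u y = (LINT k|lborel. complex_of_real (u k) * (iexp (k * x) - iexp (k * y)))"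
      unfolding ft_def using I[of x] I[of y] by (simp add: right_diff_distrib)
    also have "norm \<dots> \<le> (LINT k|lborel. \<bar>\<bar>k\<bar> * u k\<bar> * \<bar>x - y\<bar>)"
    proof (rule Bochner_Integration.integral_norm_bound_integral)
      show "integrable lborel (\<lambda>k. complex_of_real (u k) * (iexp (k * x) - iexp (k * y)))"
        using Bochner_Integration.integrable_diff[OF I[of x] I[of y]] by (simp add: right_diff_distrib)
      show "integrable lborel (\<lambda>k. \<bar>\<bar>k\<bar> * u k\<bar> * \<bar>x - y\<bar>)" using i by simp
      fix k :: real
      have "norm (iexp (k * x) - iexp (k * y)) \<le> \<bar>k\<bar> * \<bar>x - y\<bar>"
        using norm_iexp_diff[of "k * x" "k * y"] by (simp add: right_diff_distrib[symmetric] abs_mult)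
      then have "\<bar>u k\<bar> * norm (iexp (k * x) - iexp (k * y)) \<le> \<bar>u k\<bar> * (\<bar>k\<bar> * \<bar>x - y\<bar>)"
        by (rule mult_left_mono) simp
      then show "norm (complex_of_real (u k) * (iexp (k * x) - iexp (k * y))) \<le> \<bar>\<bar>k\<bar> * u k\<bar> * \<bar>x - y\<bar>"
        by (simp add: norm_mult abs_mult mult_ac)
    qed
    also have "\<dots> = (C - 1) * \<bar>x - y\<bar>" by (simp add: C_def)
    also have "\<dots> \<le> C * \<bar>x - y\<bar>" by (rule mult_right_mono) auto
    finally show ?thesis .
  qed
  moreover have "C > 0" unfolding C_def by (simp add: add_nonneg_pos integral_nonneg)
  ultimately show ?thesis using that by blast
qed

text \<open>The multiplier is of size \<open>t * k^2\<close>, and the kinks of its two parts at 0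
  cancel, so it is continuously differentiable. One integration by parts then gives the factor
  \<open>1 / (1 + \<bar>x\<bar>)\<close>, which is square integrable in \<open>x\<close>.\<close>

lemma ft_profile_generator_error:
  assumes p: "profile u u' u''"
  obtains C where "C > 0"
    "\<And>t x. 0 < t \<Longrightarrow> norm (ft (\<lambda>k. u k * ((1 - exp (- t * \<bar>k\<bar>)) / t - \<bar>k\<bar>)) x) \<le> C * t / (1 + \<bar>x\<bar>)"
proof -
  obtain C where C: "C \<ge> 0" "\<And>k. \<bar>u k\<bar> \<le> C * exp (- (1/2) * \<bar>k\<bar>)" "\<And>k. \<bar>u' k\<bar> \<le> C * exp (- (1/2) * \<bar>k\<bar>)"
    using profile_bounds[OF p] by metis
  \<comment> \<open>544 is 288 + 256, from the bounds for
    \<open>\<bar>x\<bar> * norm (ft v x)\<close> and for \<open>norm (ft v x)\<close>.\<close>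
  have main: "norm (ft (\<lambda>k. u k * ((1 - exp (- t * \<bar>k\<bar>)) / t - \<bar>k\<bar>)) x) \<le> (544 * C + 1) * t / (1 + \<bar>x\<bar>)"
    if t: "0 < t" for t x
  proof -
    \<comment> \<open>Written by cases so that the gluing lemma applies; both one-sided derivatives
      at 0 are 0.\<close>
    define m where "m = (\<lambda>k. if k \<ge> 0 then (1 - exp (- t * k)) / t - k else (1 - exp (t * k)) / t + k)"
    define m' where "m' = (\<lambda>k. if k \<ge> 0 then exp (- t * k) - 1 else 1 - exp (t * k))"
    have m_eq: "m k = (1 - exp (- t * \<bar>k\<bar>)) / t - \<bar>k\<bar>" for k by (simp add: m_def)
    have Dm: "(m has_real_derivative m' k) (at k)" for k
      unfolding m_def m'_def
      by (rule DERIV_glue_at_0) (use t in \<open>auto intro!: derivative_eq_intros\<close>)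
    have m'b: "\<bar>m' k\<bar> \<le> t * \<bar>k\<bar>" for k
    proof (cases "k \<ge> 0")
      case True
      then show ?thesis
        using exp_ge_add_one_self[of "- t * k"] t by (simp add: m'_def)
    next
      case False
      then have "t * k \<le> 0" using t by (simp add: mult_nonneg_nonpos)
      moreover have "exp (t * k) \<le> 1" using \<open>t * k \<le> 0\<close> by simp
      moreover have "t * \<bar>k\<bar> = - (t * k)" using False by simp
      ultimately have "\<bar>m' k\<bar> = 1 - exp (t * k)" "t * \<bar>k\<bar> = - (t * k)"
        using False by (simp_all add: m'_def)
      then show ?thesis using exp_ge_add_one_self[of "t * k"] by argo
    qed
    have m'c: "isCont m' k" for k
      unfolding m'_def
      by (rule DERIV_isCont[OF DERIV_glue_at_0[where f' = "\<lambda>k. - t * exp (- t * k)" and g' = "\<lambda>k. - t * exp (t * k)"]])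
         (auto intro!: derivative_eq_intros)
    have mb: "\<bar>m k\<bar> \<le> t * k\<^sup>2" for k
    proof -
      have "norm (m k - m 0) \<le> (t * \<bar>k\<bar>) * norm (k - 0)"
      proof (rule field_differentiable_bound[of "{- \<bar>k\<bar>..\<bar>k\<bar>}"])
        fix z assume "z \<in> {- \<bar>k\<bar>..\<bar>k\<bar>}"
        then have "\<bar>z\<bar> \<le> \<bar>k\<bar>" by auto
        then show "norm (m' z) \<le> t * \<bar>k\<bar>"
          unfolding real_norm_def using m'b[of z] t mult_left_mono[of "\<bar>z\<bar>" "\<bar>k\<bar>" t] by linarith
      qed (auto intro: has_field_derivative_at_within[OF Dm])
      moreover have "m 0 = 0" by (simp add: m_def)
      ultimately show ?thesis by (simp add: power2_eq_square)
    qed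
    have mc: "isCont m k" for k by (rule DERIV_isCont[OF Dm])
    define v where "v = (\<lambda>k. u k * m k)"
    define v' where "v' = (\<lambda>k. u' k * m k + m' k * u k)"
    have um: "\<bar>w k * m k\<bar> \<le> (32 * C * t) * exp (- (1/4) * \<bar>k\<bar>)" if "\<bar>w k\<bar> \<le> C * exp (- (1/2) * \<bar>k\<bar>)" for w k
    proof -
      have "\<bar>w k * m k\<bar> \<le> (C * exp (- (1/2) * \<bar>k\<bar>)) * (t * k\<^sup>2)"
        unfolding abs_mult using that mb[of k] C(1) by (intro mult_mono) auto
      also have "\<dots> = (C * t) * (k\<^sup>2 * exp (- (1/2) * \<bar>k\<bar>))" by simp
      also have "\<dots> \<le> (C * t) * (32 * exp (- (1/4) * \<bar>k\<bar>))"
        by (rule mult_left_mono[OF square_le_exp_quarter]) (use C t in simp)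
      finally show ?thesis by (simp add: mult_ac)
    qed
    have m'u: "\<bar>m' k * u k\<bar> \<le> (4 * C * t) * exp (- (1/4) * \<bar>k\<bar>)" for k
    proof -
      have "\<bar>m' k * u k\<bar> \<le> (t * \<bar>k\<bar>) * (C * exp (- (1/2) * \<bar>k\<bar>))"
        unfolding abs_mult using C(2)[of k] m'b[of k] t by (intro mult_mono) auto
      also have "\<dots> = (C * t) * (\<bar>k\<bar> * exp (- (1/2) * \<bar>k\<bar>))" by simp
      also have "\<dots> \<le> (C * t) * (4 * exp (- (1/4) * \<bar>k\<bar>))"
        by (rule mult_left_mono[OF abs_le_exp_quarter]) (use C t in simp)
      finally show ?thesis by (simp add: mult_ac)
    qed
    have vb: "\<bar>v k\<bar> \<le> (32 * C * t) * exp (- (1/4) * \<bar>k\<bar>)" for k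
      unfolding v_def by (rule um[OF C(2)])
    have v'b: "\<bar>v' k\<bar> \<le> (36 * C * t) * exp (- (1/4) * \<bar>k\<bar>)" for k
      unfolding v'_def using um[of u' k, OF C(3)] m'u[of k] by (simp add: algebra_simps)
    have Dv: "(v has_real_derivative v' k) (at k)" for k
      unfolding v_def v'_def by (rule DERIV_mult[OF profileD(1)[OF p] Dm])
    have v'c: "isCont v' k" for k
      unfolding v'_def by (intro continuous_intros profile_continuous[OF p] mc m'c)
    have vm: "v \<in> borel_measurable borel" "v' \<in> borel_measurable borel"
      using v'c DERIV_isCont[OF Dv]
      by (auto intro!: borel_measurable_continuous_onI continuous_at_imp_continuous_on)
    have q: "(1/4::real) > 0" by simp
    have vi: "integrable lborel v" "integrable lborel v'"
      by (rule integrable_exp_bound(1)[OF _ q vb] integrable_exp_bound(1)[OF _ q v'b]; use vm in simp)+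
    have "ft v' x = - \<i> * complex_of_real x * ft v x"
      by (rule ft_deriv[OF Dv v'c vi tendsto_0_exp_bound[OF q vb]])
    then have "\<bar>x\<bar> * norm (ft v x) = norm (ft v' x)" by (simp add: norm_mult)
    also have "\<dots> \<le> (36 * C * t) * (2 / (1/4))"
      by (rule order_trans[OF norm_ft_le integrable_exp_bound(2)[OF _ q v'b]]) (use vm in simp)
    finally have 1: "\<bar>x\<bar> * norm (ft v x) \<le> 288 * C * t" by simp
    have 2: "norm (ft v x) \<le> 256 * C * t"
      using order_trans[OF norm_ft_le integrable_exp_bound(2)[OF _ q vb], of x] vm by simp
    have "(1 + \<bar>x\<bar>) * norm (ft v x) \<le> (544 * C + 1) * t"
      using 1 2 t by (simp add: algebra_simps)
    then have "norm (ft v x) \<le> (544 * C + 1) * t / (1 + \<bar>x\<bar>)"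
      by (simp add: field_simps)
    then show ?thesis unfolding v_def m_eq .
  qed
  show ?thesis by (rule that[OF _ main]) (use C(1) in auto)
qed

section \<open>Uniqueness of Fourier transforms\<close>

text \<open>Frequency 0 shows that the positive and the negative part have the same mass
  \<open>m\<close>. Divided by \<open>m > 0\<close> they are probability densities with equal
  characteristic functions, and Levy's uniqueness theorem identifies them.\<close>

lemma fourier_unique_real:
  fixes f :: "real \<Rightarrow> real"
  assumes f: "integrable lborel f" and z: "\<And>a. (LINT x|lborel. complex_of_real (f x) * iexp (a * x)) = 0"
  shows "AE x in lborel. f x = 0"
proof -
  have fm [measurable]: "f \<in> borel_measurable borel" using f by auto
  define P where "P = (\<lambda>x. max 0 (f x))"
  define N where "N = (\<lambda>x. max 0 (- f x))"
  have [measurable]: "P \<in> borel_measurable borel" "N \<in> borel_measurable borel"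
    unfolding P_def N_def by measurable
  have iP: "integrable lborel P"
    unfolding P_def by (rule Bochner_Integration.integrable_bound[OF f]) auto
  have iN: "integrable lborel N"
    unfolding N_def by (rule Bochner_Integration.integrable_bound[OF f]) auto
  have fPN: "f x = P x - N x" for x by (simp add: P_def N_def max_def)
  have int: "integrable lborel (\<lambda>x. complex_of_real (g x) * iexp (a * x))"
    if "integrable lborel g" for g a
    using ft_integrable[OF that, of a] by (simp add: mult.commute)
  have eq: "(LINT x|lborel. complex_of_real (P x) * iexp (a * x)) = (LINT x|lborel. complex_of_real (N x) * iexp (a * x))" for a
  proof -
    have "(LINT x|lborel. complex_of_real (f x) * iexp (a * x)) =
        (LINT x|lborel. complex_of_real (P x) * iexp (a * x)) - (LINT x|lborel. complex_of_real (N x) * iexp (a * x))"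
      unfolding fPN using int[OF iP, of a] int[OF iN, of a] by (simp add: left_diff_distrib)
    then show ?thesis using z[of a] by simp
  qed
  define m where "m = (LINT x|lborel. P x)"
  have mN: "(LINT x|lborel. N x) = m"
    using eq[of 0] unfolding m_def by simp
  have m0: "m \<ge> 0" unfolding m_def by (rule Bochner_Integration.integral_nonneg) (simp add: P_def)
  show ?thesis
  proof (cases "m = 0")
    case True
    have "AE x in lborel. P x = 0"
      using integral_nonneg_eq_0_iff_AE[OF iP] True by (simp add: m_def P_def)
    moreover have "AE x in lborel. N x = 0"
      using integral_nonneg_eq_0_iff_AE[OF iN] True mN by (simp add: N_def)
    ultimately show ?thesis by eventually_elim (simp add: fPN)
  next
    case False
    then have mp: "m > 0" using m0 by simp
    have rd: "real_distribution (density lborel (\<lambda>x. ennreal (g x / m)))"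
      and ch: "char (density lborel (\<lambda>x. ennreal (g x / m))) a = (LINT x|lborel. complex_of_real (g x) * iexp (a * x)) / complex_of_real m"
      if g: "integrable lborel g" "\<And>x. g x \<ge> 0" "(LINT x|lborel. g x) = m" and [measurable]: "g \<in> borel_measurable borel" for g a
    proof -
      have "emeasure (density lborel (\<lambda>x. ennreal (g x / m))) UNIV = (\<integral>\<^sup>+x. ennreal (g x / m) \<partial>lborel)"
        by (simp add: emeasure_density)
      also have "\<dots> = ennreal (LINT x|lborel. g x / m)"
        by (rule nn_integral_eq_integral) (use g mp in auto)
      also have "\<dots> = 1" using g(3) mp by simp
      finally have "prob_space (density lborel (\<lambda>x. ennreal (g x / m)))"
        by (intro prob_spaceI) simp
      then show "real_distribution (density lborel (\<lambda>x. ennreal (g x / m)))"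
        by (simp add: real_distribution_def real_distribution_axioms_def)
      have "char (density lborel (\<lambda>x. ennreal (g x / m))) a = (LINT x|lborel. (g x / m) *\<^sub>R iexp (a * x))"
        unfolding char_def by (rule integral_density) (use g mp in auto)
      also have "\<dots> = (LINT x|lborel. complex_of_real (g x) * iexp (a * x) / complex_of_real m)"
        by (simp add: scaleR_conv_of_real)
      finally show "char (density lborel (\<lambda>x. ennreal (g x / m))) a = (LINT x|lborel. complex_of_real (g x) * iexp (a * x)) / complex_of_real m"
        by simp
    qed
    have P0: "P x \<ge> 0" and N0: "N x \<ge> 0" for x by (simp_all add: P_def N_def)
    have "density lborel (\<lambda>x. ennreal (P x / m)) = density lborel (\<lambda>x. ennreal (N x / m))"
    proof (rule Levy_uniqueness)
      show "char (density lborel (\<lambda>x. ennreal (P x / m))) = char (density lborel (\<lambda>x. ennreal (N x / m)))"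
        using ch[OF iP P0 m_def[symmetric]] ch[OF iN N0 mN] eq by auto
    qed (use rd[OF iP P0 m_def[symmetric]] rd[OF iN N0 mN] in auto)
    then have "AE x in lborel. ennreal (P x / m) = ennreal (N x / m)"
      by (intro sigma_finite_measure.density_unique[OF lborel.sigma_finite_measure_axioms]) auto
    then show ?thesis
    proof eventually_elim
      case (elim x)
      then have "P x / m = N x / m" using P0[of x] N0[of x] mp by simp
      then show ?case using mp by (simp add: fPN)
    qed
  qed
qed

text \<open>The transform of \<open>cnj f\<close> at \<open>a\<close> is the conjugate of that of
  \<open>f\<close> at \<open>- a\<close>, so real and imaginary part also have vanishing
  transforms.\<close>

lemma fourier_unique:
  fixes f :: "real \<Rightarrow> complex"
  assumes f: "integrable lborel f" and z: "\<And>a. (LINT x|lborel. f x * iexp (a * x)) = 0"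
  shows "AE x in lborel. f x = 0"
proof -
  have fe: "integrable lborel (\<lambda>x. f x * iexp (a * x))" for a
    by (rule Bochner_Integration.integrable_bound[OF f]) (use f in \<open>auto simp: norm_mult\<close>)
  have ce: "integrable lborel (\<lambda>x. cnj (f x) * iexp (a * x))" for a
    using integrable_cnj[OF fe[of "- a"]] by (simp add: exp_cnj)
  have cz: "(LINT x|lborel. cnj (f x) * iexp (a * x)) = 0" for a
  proof -
    have "cnj (LINT x|lborel. f x * iexp (- a * x)) = (LINT x|lborel. cnj (f x * iexp (- a * x)))"
      by (rule Bochner_Integration.integral_cnj[symmetric])
    also have "\<dots> = (LINT x|lborel. cnj (f x) * iexp (a * x))"
      by (simp add: exp_cnj)
    finally show ?thesis using z[of "- a"] by simp
  qed
  have R: "complex_of_real (Re (f x)) * e = (f x * e + cnj (f x) * e) / 2" for x e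
  proof -
    have "complex_of_real (Re (f x)) = (f x + cnj (f x)) / 2"
      by (simp add: complex_add_cnj)
    then show ?thesis by (simp only: distrib_right times_divide_eq_left)
  qed
  have I: "complex_of_real (Im (f x)) * e = (f x * e - cnj (f x) * e) / (2 * \<i>)" for x e
  proof -
    have e: "f x - cnj (f x) = complex_of_real (Im (f x)) * (2 * \<i>)"
      by (simp add: complex_diff_cnj)
    have "complex_of_real (Im (f x)) = (f x - cnj (f x)) / (2 * \<i>)"
      unfolding e by (rule nonzero_mult_div_cancel_right[symmetric]) simp
    then show ?thesis by (simp add: left_diff_distrib)
  qed
  have "AE x in lborel. Re (f x) = 0"
  proof (rule fourier_unique_real)
    show "(LINT x|lborel. complex_of_real (Re (f x)) * iexp (a * x)) = 0" for a
      unfolding R using fe[of a] ce[of a] z[of a] cz[of a] by simp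
  qed (use f in simp)
  moreover have "AE x in lborel. Im (f x) = 0"
  proof (rule fourier_unique_real)
    show "(LINT x|lborel. complex_of_real (Im (f x)) * iexp (a * x)) = 0" for a
      unfolding I using fe[of a] ce[of a] z[of a] cz[of a] by simp
  qed (use f in simp)
  ultimately show ?thesis by eventually_elim (simp add: complex_eq_iff)
qed

lemma integral_1_div_plus_square: "integrable lborel (\<lambda>x::real. 1 / (1 + x\<^sup>2))" "(LINT x|lborel. 1 / (1 + x\<^sup>2)) = pi"
proof -
  have 1: "integrable lborel (\<lambda>x::real. indicator {0<..} x * (1 / (1 + x\<^sup>2)))"
    using integrable_I0i_1_div_plus_square by (simp add: set_integrable_def interval_lebesgue_integrable_def zero_ereal_def)
  have 2: "integrable lborel (\<lambda>x::real. indicator {0<..} (- x) * (1 / (1 + (- x)\<^sup>2)))"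
    using lborel_integrable_real_affine[OF 1, of "-1" 0] by simp
  show i: "integrable lborel (\<lambda>x::real. 1 / (1 + x\<^sup>2))"
  proof (rule Bochner_Integration.integrable_bound[OF Bochner_Integration.integrable_add[OF 1 2]])
    have "norm (1 / (1 + x\<^sup>2)) \<le>
        norm (indicator {0<..} x * (1 / (1 + x\<^sup>2)) + indicator {0<..} (- x) * (1 / (1 + (- x)\<^sup>2)))"
      if "x \<noteq> 0" for x :: real
      using that by (simp add: indicator_def)
    then show "AE x::real in lborel. norm (1 / (1 + x\<^sup>2)) \<le>
        norm (indicator {0<..} x * (1 / (1 + x\<^sup>2)) + indicator {0<..} (- x) * (1 / (1 + (- x)\<^sup>2)))"
      using AE_lborel_singleton[of "0::real"] by (auto elim!: eventually_mono)
  qed simp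
  have "(LINT x|lborel. 1 / (1 + x\<^sup>2)) = pi / 2 - (- (pi / 2))"
  proof (rule integral_real_line_FTC[OF _ _ i])
    show "(arctan has_vector_derivative 1 / (1 + x\<^sup>2)) (at x)" for x
      using DERIV_arctan[of x] by (simp add: has_real_derivative_iff_has_vector_derivative inverse_eq_divide)
    show "isCont (\<lambda>x::real. 1 / (1 + x\<^sup>2)) x" for x
      by (intro continuous_intros) (smt (verit) zero_le_power2)
  qed (rule tendsto_arctan_at_bot tendsto_arctan_at_top)+
  then show "(LINT x|lborel. 1 / (1 + x\<^sup>2)) = pi" by simp
qed

lemma integrable_inverse_square: "integrable lborel (\<lambda>x::real. 1 / (1 + \<bar>x\<bar>)\<^sup>2)"
proof (rule Bochner_Integration.integrable_bound[OF integral_1_div_plus_square(1)])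
  have "1 / (1 + \<bar>x\<bar>)\<^sup>2 \<le> 1 / (1 + x\<^sup>2)" for x :: real
    by (rule divide_left_mono) (auto simp: power2_sum add_pos_nonneg intro!: mult_pos_pos)
  then show "AE x::real in lborel. norm (1 / (1 + \<bar>x\<bar>)\<^sup>2) \<le> norm (1 / (1 + x\<^sup>2))" by simp
qed simp

section \<open>Tent functions as a separating family\<close>

definition tent :: "real \<Rightarrow> real \<Rightarrow> real" where
  "tent a k = max 0 (1 - \<bar>k - a\<bar>)"

lemma tent_lipschitz: "\<bar>tent a k - tent a l\<bar> \<le> 1 * \<bar>k - l\<bar>"
  unfolding tent_def by (auto simp: max_def)

lemma tent_eq_0: "\<bar>k\<bar> \<ge> \<bar>a\<bar> + 1 \<Longrightarrow> tent a k = 0"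
  unfolding tent_def by (auto simp: max_def)

lemma tent_measurable [measurable]: "tent a \<in> borel_measurable borel"
  unfolding tent_def by measurable

lemma tent_integrable: "integrable lborel (tent a)"
proof (rule Bochner_Integration.integrable_bound[of lborel "indicator {a - 1..a + 1} :: real \<Rightarrow> real"])
  show "AE k in lborel. norm (tent a k) \<le> norm (indicator {a - 1..a + 1} k :: real)"
    by (rule AE_I2) (auto simp: tent_def max_def indicator_def)
qed auto

lemma ft_tent_shift: "ft (tent a) x = iexp (a * x) * ft (tent 0) x"
proof -
  have "ft (tent a) x = (LINT k|lborel. complex_of_real (tent a (a + 1 * k)) * iexp ((a + 1 * k) * x))"
    unfolding ft_def by (subst lborel_integral_real_affine[of 1 _ a]) simp_all
  also have "\<dots> = (LINT k|lborel. iexp (a * x) * (complex_of_real (tent 0 k) * iexp (k * x)))"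
  proof (rule Bochner_Integration.integral_cong[OF refl])
    fix k :: real
    have "iexp ((a + 1 * k) * x) = iexp (a * x) * iexp (k * x)"
      by (simp add: distrib_right distrib_left exp_add)
    moreover have "tent a (a + 1 * k) = tent 0 k" by (simp add: tent_def)
    ultimately show "complex_of_real (tent a (a + 1 * k)) * iexp ((a + 1 * k) * x)
        = iexp (a * x) * (complex_of_real (tent 0 k) * iexp (k * x))" by simp
  qed
  finally show ?thesis unfolding ft_def by simp
qed

lemma ft_tent:
  assumes x: "x \<noteq> 0"
  shows "ft (tent 0) x = complex_of_real (2 * (1 - cos x) / x\<^sup>2)"
proof -
  define g where "g = (\<lambda>k. (1 - k) * cos (k * x) * indicator {0..1} k)"
  have g1: "(LINT k|lborel. g k) = (1 - cos x) / x\<^sup>2"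
  proof -
    have "(LINT k|lborel. g k) = ((1 - 1) * sin (1 * x) / x - cos (1 * x) / x\<^sup>2) - ((1 - 0) * sin (0 * x) / x - cos (0 * x) / x\<^sup>2)"
      unfolding g_def
    proof (rule integral_FTC_Icc_real)
      fix k :: real
      show "((\<lambda>k. (1 - k) * sin (k * x) / x - cos (k * x) / x\<^sup>2) has_real_derivative (1 - k) * cos (k * x)) (at k)"
        using x by (auto intro!: derivative_eq_intros simp: field_simps power2_eq_square)
      show "isCont (\<lambda>k. (1 - k) * cos (k * x)) k" by (intro continuous_intros)
    qed simp
    then show ?thesis by (simp add: diff_divide_distrib)
  qed
  have [measurable]: "g \<in> borel_measurable borel" unfolding g_def by measurable
  have gi: "integrable lborel g"
  proof (rule Bochner_Integration.integrable_bound[of lborel "indicator {0..1} :: real \<Rightarrow> real"])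
    show "AE k in lborel. norm (g k) \<le> norm (indicator {0..1} k :: real)"
      by (rule AE_I2) (auto simp: g_def indicator_def abs_mult intro!: mult_le_one)
  qed auto
  have gi': "integrable lborel (\<lambda>k. g (- k))"
    using lborel_integrable_real_affine[OF gi, of "-1" 0] by simp
  have g2: "(LINT k|lborel. g (- k)) = (LINT k|lborel. g k)"
    using lborel_integral_real_affine[of "-1" g 0] by simp
  have "(LINT k|lborel. tent 0 k * cos (k * x)) = (LINT k|lborel. g k + g (- k))"
  proof (rule integral_cong_AE)
    \<comment> \<open>At \<open>k = 0\<close> both half-tents contribute, so the identity holds only
      almost everywhere.\<close>
    show "AE k in lborel. tent 0 k * cos (k * x) = g k + g (- k)"
    proof (rule eventually_mono[OF AE_lborel_singleton[of "0::real"]])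
      fix k :: real assume "k \<noteq> 0"
      then consider "k > 1" | "k < -1" | "0 < k" "k \<le> 1" | "-1 \<le> k" "k < 0" by linarith
      then show "tent 0 k * cos (k * x) = g k + g (- k)"
        by cases (simp_all add: g_def tent_def)
    qed
  qed (simp_all)
  also have "\<dots> = 2 * (1 - cos x) / x\<^sup>2" using gi gi' g1 g2 by simp
  finally have "(LINT k|lborel. tent 0 k * cos (k * x)) = 2 * (1 - cos x) / x\<^sup>2" .
  moreover have "(LINT k|lborel. tent 0 k * sin (k * x)) = 0"
    by (rule integral_odd) (simp add: tent_def)
  moreover have "Re (ft (tent 0) x) = (LINT k|lborel. tent 0 k * cos (k * x))"
    "Im (ft (tent 0) x) = (LINT k|lborel. tent 0 k * sin (k * x))"
    unfolding ft_def
    using integral_Re[OF ft_integrable[OF tent_integrable, of 0 x]]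
      integral_Im[OF ft_integrable[OF tent_integrable, of 0 x]]
    by (simp_all add: Re_exp Im_exp)
  ultimately show ?thesis by (simp add: complex_eq_iff)
qed

lemma norm_ft_tent_le: "norm (ft (tent a) x) \<le> 16 / (1 + \<bar>x\<bar>)\<^sup>2"
proof -
  have "norm (ft (tent 0) x) \<le> 16 / (1 + \<bar>x\<bar>)\<^sup>2"
  proof (cases "\<bar>x\<bar> \<le> 1")
    case True
    have "norm (ft (tent 0) x) \<le> (LINT k|lborel. \<bar>tent 0 k\<bar>)" by (rule norm_ft_le)
    also have "\<dots> \<le> (LINT k|lborel. indicator {-1..1::real} k)"
    proof (rule Bochner_Integration.integral_mono)
      show "integrable lborel (\<lambda>k. \<bar>tent 0 k\<bar>)" using tent_integrable by simp
      show "\<bar>tent 0 k\<bar> \<le> indicator {-1..1} k" for k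
        by (cases "\<bar>k\<bar> \<le> 1") (auto simp: tent_def max_def indicator_def abs_le_iff)
    qed simp
    also have "\<dots> = 2" by simp
    finally have "norm (ft (tent 0) x) \<le> 2" .
    moreover have "(1 + \<bar>x\<bar>)\<^sup>2 \<le> 2\<^sup>2" by (rule power_mono) (use True in auto)
    ultimately have "(1 + \<bar>x\<bar>)\<^sup>2 * norm (ft (tent 0) x) \<le> 2\<^sup>2 * 2" by (intro mult_mono) auto
    then show ?thesis by (simp add: field_simps)
  next
    case False
    then have x: "x \<noteq> 0" by auto
    have "x\<^sup>2 * norm (ft (tent 0) x) = 2 * \<bar>1 - cos x\<bar>"
      unfolding ft_tent[OF x] using x by (simp only: norm_of_real abs_divide abs_mult) simp
    also have "\<bar>1 - cos x\<bar> = 1 - cos x" by simp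
    also have "2 * (1 - cos x) \<le> 4" using cos_ge_minus_one[of x] by argo
    finally have 1: "x\<^sup>2 * norm (ft (tent 0) x) \<le> 4" .
    have "(1 + \<bar>x\<bar>)\<^sup>2 \<le> (2 * \<bar>x\<bar>)\<^sup>2" by (rule power_mono) (use False in auto)
    then have "(1 + \<bar>x\<bar>)\<^sup>2 * norm (ft (tent 0) x) \<le> (2 * \<bar>x\<bar>)\<^sup>2 * norm (ft (tent 0) x)"
      by (rule mult_right_mono) simp
    also have "\<dots> = 4 * (x\<^sup>2 * norm (ft (tent 0) x))" by (simp add: power_mult_distrib)
    also have "\<dots> \<le> 16" using 1 by simp
    finally show ?thesis by (simp add: field_simps)
  qed
  then show ?thesis by (simp add: ft_tent_shift[of a] norm_mult)
qed

lemma AE_ft_tent_nonzero: "AE x in lborel. ft (tent 0) x \<noteq> 0"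
proof -
  have "countable (range (\<lambda>n::int. of_int n * 2 * pi))" by simp
  then have "range (\<lambda>n::int. of_int n * 2 * pi) \<in> null_sets lborel"
    by (rule countable_imp_null_set_lborel)
  then have "AE x in lborel. x \<notin> range (\<lambda>n::int. of_int n * 2 * pi)" by (rule AE_not_in)
  then show ?thesis
  proof eventually_elim
    case (elim x)
    have "x \<noteq> 0" using elim by (auto intro: image_eqI[of _ _ 0])
    moreover have "cos x \<noteq> 1" using elim by (auto simp: cos_one_2pi_int)
    ultimately show ?case by (simp add: ft_tent del: of_real_divide)
  qed
qed

lemma product_integrable:
  fixes f g :: "real \<Rightarrow> complex"
  assumes [measurable]: "f \<in> borel_measurable borel" "g \<in> borel_measurable borel"
    and f: "integrable lborel (\<lambda>x. (norm (f x))\<^sup>2)" and g: "integrable lborel (\<lambda>x. (norm (g x))\<^sup>2)"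
  shows "integrable lborel (\<lambda>x. f x * g x)"
proof (rule Bochner_Integration.integrable_bound[OF Bochner_Integration.integrable_add[OF f g]])
  have "norm (f x * g x) \<le> (norm (f x))\<^sup>2 + (norm (g x))\<^sup>2" for x
  proof -
    have "0 \<le> (norm (f x) - norm (g x))\<^sup>2 + (norm (f x))\<^sup>2 + (norm (g x))\<^sup>2" by simp
    then show ?thesis by (simp add: norm_mult power2_diff)
  qed
  then show "AE x in lborel. norm (f x * g x) \<le> norm ((norm (f x))\<^sup>2 + (norm (g x))\<^sup>2)"
    by simp
qed measurable

lemma ft_measurable [measurable]:
  assumes [measurable]: "u \<in> borel_measurable borel"
  shows "ft u \<in> borel_measurable borel"
  unfolding ft_def[abs_def] by measurable

lemma square_integrable_of_bound:
  fixes f :: "real \<Rightarrow> complex"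
  assumes [measurable]: "f \<in> borel_measurable borel" and b: "\<And>x. norm (f x) \<le> C / (1 + \<bar>x\<bar>)"
  shows "integrable lborel (\<lambda>x. (norm (f x))\<^sup>2)"
proof -
  have "integrable lborel (\<lambda>x::real. C\<^sup>2 * (1 / (1 + \<bar>x\<bar>)\<^sup>2))"
    using integrable_inverse_square by (rule integrable_mult_right)
  then show ?thesis
  proof (rule Bochner_Integration.integrable_bound)
    show "AE x in lborel. norm ((norm (f x))\<^sup>2) \<le> norm (C\<^sup>2 * (1 / (1 + \<bar>x\<bar>)\<^sup>2))"
      using power_mono[OF b norm_ge_zero, of _ 2] by (auto simp: power_divide)
  qed measurable
qed

lemma ft_tent_square_integrable: "integrable lborel (\<lambda>x. (norm (ft (tent a) x))\<^sup>2)"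
proof (rule square_integrable_of_bound)
  show "norm (ft (tent a) x) \<le> 16 / (1 + \<bar>x\<bar>)" for x
  proof -
    have "(1 + \<bar>x\<bar>) * 1 \<le> (1 + \<bar>x\<bar>) * (1 + \<bar>x\<bar>)" by (rule mult_left_mono) auto
    then have "16 / (1 + \<bar>x\<bar>)\<^sup>2 \<le> 16 / (1 + \<bar>x\<bar>)"
      by (intro divide_left_mono) (auto simp: power2_eq_square)
    with norm_ft_tent_le[of a x] show ?thesis by linarith
  qed
qed (rule ft_measurable, rule tent_measurable)

text \<open>All tents are translates of one, so their transforms are \<open>ft (tent 0)\<close>
  times exponentials. The hypothesis thus says that the integrable function
  \<open>f * ft (tent 0)\<close> has vanishing Fourier transform, and \<open>ft (tent 0)\<close> is
  nonzero almost everywhere.\<close>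

lemma zero_of_tent_orthogonal:
  assumes fm [measurable]: "f \<in> borel_measurable borel" and f: "integrable lborel (\<lambda>x. (norm (f x))\<^sup>2)"
    and z: "\<And>a. (LINT x|lborel. f x * ft (tent a) x) = 0"
  shows "AE x in lborel. f x = 0"
proof -
  have "AE x in lborel. f x * ft (tent 0) x = 0"
  proof (rule fourier_unique)
    show "integrable lborel (\<lambda>x. f x * ft (tent 0) x)"
      by (rule product_integrable[OF _ _ f ft_tent_square_integrable]) auto
    show "(LINT x|lborel. f x * ft (tent 0) x * iexp (a * x)) = 0" for a
      using z[of a] by (simp add: ft_tent_shift[of a] mult_ac)
  qed
  with AE_ft_tent_nonzero show ?thesis by eventually_elim simp
qed

section \<open>The Cauchy law\<close>

lemma char_expectation_ft:
  assumes \<nu>: "real_distribution \<nu>" and u: "integrable lborel u"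
  shows "(LINT w|\<nu>. ft u (y + w)) = (LINT k|lborel. complex_of_real (u k) * iexp (k * y) * char \<nu> k)"
proof -
  interpret real_distribution \<nu> by fact
  interpret P: pair_sigma_finite lborel \<nu> ..
  have [measurable]: "u \<in> borel_measurable borel" using u by auto
  define f where "f = (\<lambda>(k, w). complex_of_real (u k) * iexp (k * (y + w)))"
  have [measurable]: "f \<in> borel_measurable (lborel \<Otimes>\<^sub>M \<nu>)"
    unfolding f_def by measurable
  have i: "integrable (lborel \<Otimes>\<^sub>M \<nu>) f"
  proof (rule P.Fubini_integrable)
    have "(\<lambda>k. LINT w|\<nu>. norm (f (k, w))) = (\<lambda>k. \<bar>u k\<bar>)"
      using prob_space by (auto simp: f_def norm_mult)
    then show "integrable lborel (\<lambda>k. LINT w|\<nu>. norm (f (k, w)))" using u by simp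
    show "AE k in lborel. integrable \<nu> (\<lambda>w. f (k, w))"
    proof (rule AE_I2)
      fix k :: real
      show "integrable \<nu> (\<lambda>w. f (k, w))"
        by (rule integrable_const_bound[of _ "\<bar>u k\<bar>"]) (auto simp: f_def norm_mult)
    qed
  qed measurable
  have "(LINT w|\<nu>. ft u (y + w)) = (LINT w|\<nu>. LINT k|lborel. f (k, w))"
    by (simp add: ft_def f_def)
  also have "\<dots> = (LINT k|lborel. LINT w|\<nu>. f (k, w))"
    using P.Fubini_integral[of "\<lambda>k w. f (k, w)"] i by (simp add: case_prod_eta)
  also have "\<dots> = (LINT k|lborel. complex_of_real (u k) * iexp (k * y) * char \<nu> k)"
  proof (rule Bochner_Integration.integral_cong[OF refl])
    fix k :: real
    have "f (k, w) = (complex_of_real (u k) * iexp (k * y)) * iexp (k * w)" for w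
      by (simp add: f_def distrib_left exp_add)
    then show "(LINT w|\<nu>. f (k, w)) = complex_of_real (u k) * iexp (k * y) * char \<nu> k"
      by (simp add: char_def)
  qed
  finally show ?thesis .
qed

lemma expectation_ft:
  assumes "real_distribution \<nu>" "\<And>k. char \<nu> k = complex_of_real (exp (- t * \<bar>k\<bar>))" "integrable lborel u"
  shows "(LINT w|\<nu>. ft u (y + w)) = ft (\<lambda>k. u k * exp (- t * \<bar>k\<bar>)) y"
proof -
  have "(LINT w|\<nu>. ft u (y + w)) = (LINT k|lborel. complex_of_real (u k) * iexp (k * y) * char \<nu> k)"
    by (rule char_expectation_ft[OF assms(1,3)])
  also have "\<dots> = ft (\<lambda>k. u k * exp (- t * \<bar>k\<bar>)) y"
    unfolding assms(2) ft_def by (rule Bochner_Integration.integral_cong) simp_all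
  finally show ?thesis .
qed

definition cauchy_density :: "real \<Rightarrow> real \<Rightarrow> real" where
  "cauchy_density t x = t / (pi * (t\<^sup>2 + x\<^sup>2))"

lemma cauchy_density_measurable [measurable]: "cauchy_density t \<in> borel_measurable borel"
  unfolding cauchy_density_def by measurable

lemma cauchy_density_nonneg: "t > 0 \<Longrightarrow> cauchy_density t x \<ge> 0"
  by (simp add: cauchy_density_def)

lemma cauchy_density_scale:
  assumes "t > 0"
  shows "t * cauchy_density t (t * x) = cauchy_density 1 x"
proof -
  have "t\<^sup>2 + (t * x)\<^sup>2 = t\<^sup>2 * (1 + x\<^sup>2)" by (simp add: power_mult_distrib distrib_left)
  then show ?thesis using assms by (simp add: cauchy_density_def power2_eq_square)
qed

lemma cauchy_density_integral:
  assumes t: "t > 0"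
  shows "integrable lborel (cauchy_density t)" "(LINT x|lborel. cauchy_density t x) = 1"
proof -
  have 1: "integrable lborel (cauchy_density 1)" "(LINT x|lborel. cauchy_density 1 x) = 1"
  proof -
    have "cauchy_density 1 = (\<lambda>x. (1 / pi) * (1 / (1 + x\<^sup>2)))" by (auto simp: cauchy_density_def)
    then show "integrable lborel (cauchy_density 1)" "(LINT x|lborel. cauchy_density 1 x) = 1"
      using integral_1_div_plus_square by (simp_all only: integrable_mult_right integral_mult_right_zero) simp
  qed
  have e: "cauchy_density t (0 + t * x) = cauchy_density 1 x / t" for x
    using cauchy_density_scale[OF t, of x] t by (simp add: field_simps)
  show "integrable lborel (cauchy_density t)"
  proof -
    have "integrable lborel (\<lambda>x. cauchy_density t (0 + t * x))" unfolding e using 1 by simp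
    then show ?thesis using lborel_integrable_real_affine_iff[of t "cauchy_density t" 0] t by simp
  qed
  show "(LINT x|lborel. cauchy_density t x) = 1"
    using lborel_integral_real_affine[of t "cauchy_density t" 0] t 1 unfolding e by simp
qed

definition cauchy_law :: "real \<Rightarrow> real measure" where
  "cauchy_law t = density lborel (\<lambda>x. ennreal (cauchy_density t x))"

lemma sets_cauchy_law [simp, measurable_cong]: "sets (cauchy_law t) = sets borel"
  and space_cauchy_law [simp]: "space (cauchy_law t) = UNIV"
  by (simp_all add: cauchy_law_def)

lemma real_distribution_cauchy_law:
  assumes t: "t > 0"
  shows "real_distribution (cauchy_law t)"
proof -
  have "emeasure (cauchy_law t) UNIV = (\<integral>\<^sup>+x. ennreal (cauchy_density t x) \<partial>lborel)"
    by (simp add: cauchy_law_def emeasure_density)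
  also have "\<dots> = ennreal (LINT x|lborel. cauchy_density t x)"
    by (rule nn_integral_eq_integral) (use cauchy_density_integral[OF t] cauchy_density_nonneg[OF t] in auto)
  finally have "prob_space (cauchy_law t)"
    using cauchy_density_integral(2)[OF t] by (intro prob_spaceI) simp
  then show ?thesis by (simp add: real_distribution_def real_distribution_axioms_def)
qed

lemma char_cauchy_law_eq:
  assumes t: "t > 0"
  shows "char (cauchy_law t) \<xi> = (LINT x|lborel. complex_of_real (cauchy_density t x) * iexp (\<xi> * x))"
  unfolding char_def cauchy_law_def
  by (subst integral_density) (use cauchy_density_nonneg[OF t] in \<open>auto simp: scaleR_conv_of_real\<close>)

lemma char_cauchy_law_scale:
  assumes t: "t > 0"
  shows "char (cauchy_law t) \<xi> = char (cauchy_law 1) (t * \<xi>)"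
proof -
  have "char (cauchy_law t) \<xi> = t *\<^sub>R (LINT x|lborel. complex_of_real (cauchy_density t (0 + t * x)) * iexp (\<xi> * (0 + t * x)))"
    unfolding char_cauchy_law_eq[OF t]
    by (subst lborel_integral_real_affine[of t _ 0]) (use t in simp_all)
  also have "\<dots> = (LINT x|lborel. t *\<^sub>R (complex_of_real (cauchy_density t (0 + t * x)) * iexp (\<xi> * (0 + t * x))))"
    by simp
  also have "\<dots> = (LINT x|lborel. complex_of_real (cauchy_density 1 x) * iexp (t * \<xi> * x))"
    by (rule Bochner_Integration.integral_cong)
       (simp_all add: cauchy_density_scale[OF t, symmetric] scaleR_conv_of_real mult_ac)
  finally show ?thesis by (simp add: char_cauchy_law_eq)
qed

text \<open>The Cauchy density of scale \<open>e\<close> is a transform of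
  \<open>exp (- e * \<bar>k\<bar>)\<close>; averaging over \<nu> multiplies this by the
  characteristic function, and the exponents add. A positive \<open>e\<close> keeps the profile
  integrable.\<close>

lemma expectation_cauchy_kernel:
  assumes \<nu>: "real_distribution \<nu>" "\<And>k. char \<nu> k = complex_of_real (exp (- t * \<bar>k\<bar>))" and t: "t > 0" and e: "e > 0"
  shows "(LINT w|\<nu>. cauchy_density e (y + w)) = cauchy_density (e + t) y"
proof -
  define E where "E = (\<lambda>k::real. exp (- e * \<bar>k\<bar>))"
  have "complex_of_real (LINT w|\<nu>. cauchy_density e (y + w)) = (LINT w|\<nu>. complex_of_real (1 / (2 * pi)) * ft E (y + w))"
    unfolding E_def ft_exp_abs[OF e] by (subst integral_complex_of_real[symmetric]) (simp add: cauchy_density_def)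
  also have "\<dots> = complex_of_real (1 / (2 * pi)) * (LINT w|\<nu>. ft E (y + w))"
    by simp
  also have "(LINT w|\<nu>. ft E (y + w)) = ft (\<lambda>k. E k * exp (- t * \<bar>k\<bar>)) y"
    by (rule expectation_ft[OF \<nu>]) (simp add: E_def integrable_exp_abs[OF e, simplified])
  also have "(\<lambda>k. E k * exp (- t * \<bar>k\<bar>)) = (\<lambda>k. exp (- (e + t) * \<bar>k\<bar>))"
    by (auto simp: E_def exp_add[symmetric] algebra_simps)
  also have "ft \<dots> y = complex_of_real (2 * (e + t) / ((e + t)\<^sup>2 + y\<^sup>2))"
    by (rule ft_exp_abs) (use e t in simp)
  also have "complex_of_real (1 / (2 * pi)) * complex_of_real (2 * (e + t) / ((e + t)\<^sup>2 + y\<^sup>2))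
      = complex_of_real (cauchy_density (e + t) y)"
  proof -
    have "1 / (2 * pi) * (2 * s / (s\<^sup>2 + y\<^sup>2)) = cauchy_density s y" for s
      by (simp add: cauchy_density_def)
    then show ?thesis unfolding of_real_mult[symmetric] by (rule arg_cong)
  qed
  finally show ?thesis using of_real_eq_iff by blast
qed

text \<open>
  Convolution with \<open>\<nu>\<close> turns the Cauchy density of scale \<open>e\<close> into that of scale \<open>e + t\<close>; on the level of
  characteristic functions one may let \<open>e\<close> tend to \<open>0\<close>.
\<close>

lemma cauchy_law_unique:
  assumes \<nu>: "real_distribution \<nu>" "\<And>k. char \<nu> k = complex_of_real (exp (- t * \<bar>k\<bar>))" and t: "t > 0"
  shows "\<nu> = cauchy_law t"
proof (rule Levy_uniqueness[OF \<nu>(1) real_distribution_cauchy_law[OF t]])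
  interpret real_distribution \<nu> by fact
  interpret P: pair_sigma_finite \<nu> lborel ..
  have key: "char (cauchy_law (e + t)) \<xi> = char (cauchy_law e) \<xi> * complex_of_real (exp (- t * \<bar>\<xi>\<bar>))"
    if e: "e > 0" for e \<xi>
  proof -
    define f where "f = (\<lambda>(w, y). complex_of_real (cauchy_density e (y + w)) * iexp (\<xi> * y))"
    have [measurable]: "f \<in> borel_measurable (\<nu> \<Otimes>\<^sub>M lborel)"
      unfolding f_def by measurable
    have shift: "integrable lborel (\<lambda>y. cauchy_density e (y + w))"
      "(LINT y|lborel. cauchy_density e (y + w)) = 1" for w
      using lborel_integrable_real_affine[OF cauchy_density_integral(1)[OF e], of 1 w]
        lborel_integral_real_affine[of 1 "cauchy_density e" w] cauchy_density_integral(2)[OF e]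
      by (simp_all add: add.commute)
    have nf: "norm (f (w, y)) = cauchy_density e (y + w)" for w y
      using cauchy_density_nonneg[OF e] by (simp add: f_def norm_mult)
    have i: "integrable (\<nu> \<Otimes>\<^sub>M lborel) f"
    proof (rule P.Fubini_integrable)
      show "integrable \<nu> (\<lambda>w. LINT y|lborel. norm (f (w, y)))" unfolding nf shift by simp
      show "AE w in \<nu>. integrable lborel (\<lambda>y. f (w, y))"
      proof (rule AE_I2)
        fix w
        show "integrable lborel (\<lambda>y. f (w, y))"
        proof (rule Bochner_Integration.integrable_bound[OF shift(1)[of w]])
          show "AE y in lborel. norm (f (w, y)) \<le> norm (cauchy_density e (y + w))" unfolding nf by simp
        qed (simp add: f_def)
      qed
    qed measurable
    have "char (cauchy_law (e + t)) \<xi> = (LINT y|lborel. complex_of_real (cauchy_density (e + t) y) * iexp (\<xi> * y))"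
      by (rule char_cauchy_law_eq) (use e t in simp)
    also have "\<dots> = (LINT y|lborel. LINT w|\<nu>. f (w, y))"
    proof (rule Bochner_Integration.integral_cong[OF refl])
      fix y
      show "complex_of_real (cauchy_density (e + t) y) * iexp (\<xi> * y) = (LINT w|\<nu>. f (w, y))"
        unfolding expectation_cauchy_kernel[OF \<nu> t e, symmetric] by (simp add: f_def)
    qed
    also have "\<dots> = (LINT w|\<nu>. LINT y|lborel. f (w, y))"
      using P.Fubini_integral[of "\<lambda>w y. f (w, y)"] i by (simp add: case_prod_eta)
    also have "\<dots> = (LINT w|\<nu>. char (cauchy_law e) \<xi> * iexp (- \<xi> * w))"
    proof (rule Bochner_Integration.integral_cong[OF refl])
      fix w
      have "(LINT y|lborel. f (w, y)) = (LINT y|lborel. f (w, - w + 1 * y))"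
        by (subst lborel_integral_real_affine[of 1 _ "- w"]) simp_all
      also have "\<dots> = (LINT y|lborel. complex_of_real (cauchy_density e y) * iexp (\<xi> * y) * iexp (- \<xi> * w))"
      proof (rule Bochner_Integration.integral_cong[OF refl])
        fix y
        have "iexp (\<xi> * (- w + 1 * y)) = iexp (\<xi> * y) * iexp (- \<xi> * w)"
          by (simp add: exp_add[symmetric] algebra_simps)
        then show "f (w, - w + 1 * y) = complex_of_real (cauchy_density e y) * iexp (\<xi> * y) * iexp (- \<xi> * w)"
          by (simp add: f_def)
      qed
      also have "\<dots> = char (cauchy_law e) \<xi> * iexp (- \<xi> * w)"
        unfolding char_cauchy_law_eq[OF e] by (rule integral_mult_left_zero)
      finally show "(LINT y|lborel. f (w, y)) = char (cauchy_law e) \<xi> * iexp (- \<xi> * w)" .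
    qed
    also have "\<dots> = char (cauchy_law e) \<xi> * char \<nu> (- \<xi>)"
      unfolding char_def[of \<nu>] by simp
    finally show ?thesis using \<nu>(2) by simp
  qed
  have c1: "isCont (char (cauchy_law 1)) x" for x
    using real_distribution.isCont_char[OF real_distribution_cauchy_law] by simp
  have c10: "char (cauchy_law 1) 0 = 1"
    using real_distribution.char_zero[OF real_distribution_cauchy_law] by simp
  show "char \<nu> = char (cauchy_law t)"
  proof
    fix \<xi>
    \<comment> \<open>By scaling, every Cauchy characteristic function is that of scale 1 at a
      dilated argument, so the limit \<open>e \<rightarrow> 0\<close> needs only continuity of that
      single function and its value 1 at 0.\<close>
    have L: "((\<lambda>e. char (cauchy_law 1) ((e + t) * \<xi>)) \<longlongrightarrow> char (cauchy_law 1) ((0 + t) * \<xi>)) (at_right 0)"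
      by (rule isCont_tendsto_compose[OF c1]) (intro tendsto_intros)
    have R: "((\<lambda>e. char (cauchy_law 1) (e * \<xi>) * complex_of_real (exp (- t * \<bar>\<xi>\<bar>))) \<longlongrightarrow>
        char (cauchy_law 1) (0 * \<xi>) * complex_of_real (exp (- t * \<bar>\<xi>\<bar>))) (at_right 0)"
      by (intro tendsto_mult isCont_tendsto_compose[OF c1] tendsto_intros)
    have "\<forall>\<^sub>F e in at_right 0. char (cauchy_law 1) ((e + t) * \<xi>) = char (cauchy_law 1) (e * \<xi>) * complex_of_real (exp (- t * \<bar>\<xi>\<bar>))"
      using eventually_at_right_less[of "0::real"]
    proof eventually_elim
      case (elim e)
      then show ?case using key[of e \<xi>] char_cauchy_law_scale[of "e + t" \<xi>] char_cauchy_law_scale[of e \<xi>] t by simp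
    qed
    from tendsto_unique[OF _ Lim_transform_eventually[OF L this] R]
    have "char (cauchy_law 1) (t * \<xi>) = complex_of_real (exp (- t * \<bar>\<xi>\<bar>))"
      using c10 by simp
    then show "char \<nu> \<xi> = char (cauchy_law t) \<xi>"
      using \<nu>(2) char_cauchy_law_scale[OF t] by simp
  qed
qed

lemma nn_integral_cauchy_law:
  assumes [measurable]: "f \<in> borel_measurable borel"
  shows "(\<integral>\<^sup>+w. f w \<partial>cauchy_law t) = (\<integral>\<^sup>+w. ennreal (cauchy_density t w) * f w \<partial>lborel)"
  unfolding cauchy_law_def by (subst nn_integral_density) auto

lemma nn_integral_cauchy_density:
  assumes "t > 0"
  shows "(\<integral>\<^sup>+w. ennreal (cauchy_density t w) \<partial>lborel) = 1"
  using cauchy_density_integral[OF assms] cauchy_density_nonneg[OF assms]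
  by (subst nn_integral_eq_integral) auto

lemma nn_integral_cauchy_law_const:
  assumes "t > 0"
  shows "(\<integral>\<^sup>+w. c \<partial>cauchy_law t) = c"
proof -
  interpret real_distribution "cauchy_law t" by (rule real_distribution_cauchy_law[OF assms])
  show ?thesis using emeasure_space_1 by simp
qed

text \<open>On the tail the density of scale \<open>t\<close> is at most \<open>2 * t / r\<close>
  times the density of scale \<open>r\<close>, whose total mass is 1.\<close>

lemma cauchy_law_tail:
  assumes t: "t > 0" and r: "r > 0"
  shows "(\<integral>\<^sup>+w. indicator {w. \<bar>w\<bar> \<ge> r} w \<partial>cauchy_law t) \<le> ennreal (2 * t / r)"
proof -
  have "(\<integral>\<^sup>+w. indicator {w. \<bar>w\<bar> \<ge> r} w \<partial>cauchy_law t)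
      = (\<integral>\<^sup>+w. ennreal (cauchy_density t w) * indicator {w. \<bar>w\<bar> \<ge> r} w \<partial>lborel)"
    by (rule nn_integral_cauchy_law) measurable
  also have "\<dots> \<le> (\<integral>\<^sup>+w. ennreal (2 * t / r) * ennreal (cauchy_density r w) \<partial>lborel)"
  proof (rule nn_integral_mono)
    fix w :: real
    have "cauchy_density t w \<le> (2 * t / r) * cauchy_density r w" if "\<bar>w\<bar> \<ge> r"
    proof -
      have w: "r\<^sup>2 \<le> w\<^sup>2" using that r by (metis abs_of_pos power2_abs power_mono less_imp_le)
      have "r\<^sup>2 > 0" using r by simp
      then have w0: "w\<^sup>2 > 0" using w by linarith
      have "t / (pi * (t\<^sup>2 + w\<^sup>2)) \<le> t / (pi * ((r\<^sup>2 + w\<^sup>2) / 2))"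
      proof (rule divide_left_mono)
        have "(r\<^sup>2 + w\<^sup>2) / 2 \<le> w\<^sup>2" using w by simp
        also have "w\<^sup>2 \<le> t\<^sup>2 + w\<^sup>2" by simp
        finally have "(r\<^sup>2 + w\<^sup>2) / 2 \<le> t\<^sup>2 + w\<^sup>2" .
        then show "pi * ((r\<^sup>2 + w\<^sup>2) / 2) \<le> pi * (t\<^sup>2 + w\<^sup>2)" by simp
        have "t\<^sup>2 + w\<^sup>2 > 0" "(r\<^sup>2 + w\<^sup>2) / 2 > 0" using w0 by (simp_all add: add_nonneg_pos)
        then show "0 < pi * (t\<^sup>2 + w\<^sup>2) * (pi * ((r\<^sup>2 + w\<^sup>2) / 2))"
          by (intro mult_pos_pos) simp_all
      qed (use t in simp)
      also have "\<dots> = (2 * t / r) * cauchy_density r w" using r by (simp add: cauchy_density_def)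
      finally show ?thesis by (simp add: cauchy_density_def)
    qed
    then show "ennreal (cauchy_density t w) * indicator {w. \<bar>w\<bar> \<ge> r} w \<le> ennreal (2 * t / r) * ennreal (cauchy_density r w)"
      using t r cauchy_density_nonneg[OF r] by (auto simp: indicator_def ennreal_mult[symmetric] intro!: ennreal_leI)
  qed
  also have "\<dots> = ennreal (2 * t / r)"
    using nn_integral_cauchy_density[OF r] by (simp add: nn_integral_cmult)
  finally show ?thesis .
qed

lemma cauchy_law_add_indicator:
  assumes s: "s > 0"
  shows "(\<integral>\<^sup>+w. ennreal c + indicator {w. \<bar>w\<bar> \<ge> r} w \<partial>cauchy_law s)
    = ennreal c + (\<integral>\<^sup>+w. indicator {w. \<bar>w\<bar> \<ge> r} w \<partial>cauchy_law s)"
proof -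
  have "(\<integral>\<^sup>+w. ennreal c + indicator {w. \<bar>w\<bar> \<ge> r} w \<partial>cauchy_law s)
    = (\<integral>\<^sup>+w. ennreal c \<partial>cauchy_law s) + (\<integral>\<^sup>+w. indicator {w. \<bar>w\<bar> \<ge> r} w \<partial>cauchy_law s)"
    by (rule nn_integral_add) measurable
  then show ?thesis by (simp only: nn_integral_cauchy_law_const[OF s])
qed

lemma cauchy_law_inverse_bound:
  assumes s: "0 < s" "s \<le> 1"
  shows "(\<integral>\<^sup>+w. ennreal (1 / (1 + \<bar>x + w\<bar>)) \<partial>cauchy_law s) \<le> ennreal (6 / (1 + \<bar>x\<bar>))"
proof -
  \<comment> \<open>For smaller displacements the integrand is at most
    \<open>2 / (1 + \<bar>x\<bar>)\<close>; the tail beyond \<open>r\<close> has mass at most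
    \<open>4 * s / (1 + \<bar>x\<bar>)\<close>. Together these give the constant 6.\<close>
  define r where "r = (1 + \<bar>x\<bar>) / 2"
  have r: "r > 0" by (simp add: r_def)
  have "(\<integral>\<^sup>+w. ennreal (1 / (1 + \<bar>x + w\<bar>)) \<partial>cauchy_law s)
      \<le> (\<integral>\<^sup>+w. ennreal (2 / (1 + \<bar>x\<bar>)) + indicator {w. \<bar>w\<bar> \<ge> r} w \<partial>cauchy_law s)"
  proof (rule nn_integral_mono)
    fix w :: real
    show "ennreal (1 / (1 + \<bar>x + w\<bar>)) \<le> ennreal (2 / (1 + \<bar>x\<bar>)) + indicator {w. \<bar>w\<bar> \<ge> r} w"
    proof (cases "\<bar>w\<bar> \<ge> r")
      case True
      have "ennreal (1 / (1 + \<bar>x + w\<bar>)) \<le> 1"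
        using ennreal_leI[of "1 / (1 + \<bar>x + w\<bar>)" 1] by simp
      also have "\<dots> \<le> ennreal (2 / (1 + \<bar>x\<bar>)) + indicator {w. \<bar>w\<bar> \<ge> r} w" using True by simp
      finally show ?thesis .
    next
      case False
      then have "\<bar>w\<bar> < (1 + \<bar>x\<bar>) / 2" by (simp add: r_def)
      moreover have "\<bar>x\<bar> \<le> \<bar>x + w\<bar> + \<bar>w\<bar>" using abs_triangle_ineq[of "x + w" "- w"] by simp
      ultimately have "(1 + \<bar>x\<bar>) / 2 \<le> 1 + \<bar>x + w\<bar>" by argo
      then have "1 / (1 + \<bar>x + w\<bar>) \<le> 1 / ((1 + \<bar>x\<bar>) / 2)"
        by (intro divide_left_mono) (auto intro!: mult_pos_pos)
      then have "1 / (1 + \<bar>x + w\<bar>) \<le> 2 / (1 + \<bar>x\<bar>)" by simp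
      with False show ?thesis by (simp add: ennreal_leI)
    qed
  qed
  also have "\<dots> = ennreal (2 / (1 + \<bar>x\<bar>)) + (\<integral>\<^sup>+w. indicator {w. \<bar>w\<bar> \<ge> r} w \<partial>cauchy_law s)"
    by (rule cauchy_law_add_indicator[OF s(1)])
  also have "\<dots> \<le> ennreal (2 / (1 + \<bar>x\<bar>)) + ennreal (2 * s / r)"
    by (intro add_left_mono cauchy_law_tail[OF s(1) r])
  also have "\<dots> = ennreal (2 / (1 + \<bar>x\<bar>) + 2 * s / r)"
    using s r by (intro ennreal_plus[symmetric]) auto
  also have "\<dots> \<le> ennreal (6 / (1 + \<bar>x\<bar>))"
  proof (rule ennreal_leI)
    have "2 * s / r = 4 * s / (1 + \<bar>x\<bar>)" by (simp add: r_def)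
    also have "\<dots> \<le> 4 / (1 + \<bar>x\<bar>)" by (rule divide_right_mono) (use s in auto)
    finally show "2 / (1 + \<bar>x\<bar>) + 2 * s / r \<le> 6 / (1 + \<bar>x\<bar>)"
      by (simp add: add_divide_distrib[symmetric])
  qed
  finally show ?thesis .
qed

text \<open>The first moment is infinite, hence the cut at 1. Splitting at \<open>sqrt s\<close>
  balances the two contributions \<open>sqrt s\<close> and \<open>2 * s / sqrt s\<close>; any rate
  that vanishes with \<open>s\<close> serves the later limit.\<close>

lemma cauchy_law_min_bound:
  assumes s: "0 < s"
  shows "(\<integral>\<^sup>+w. ennreal (min 1 \<bar>w\<bar>) \<partial>cauchy_law s) \<le> ennreal (3 * sqrt s)"
proof -
  have r: "sqrt s > 0" using s by simp
  have "(\<integral>\<^sup>+w. ennreal (min 1 \<bar>w\<bar>) \<partial>cauchy_law s)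
      \<le> (\<integral>\<^sup>+w. ennreal (sqrt s) + indicator {w. \<bar>w\<bar> \<ge> sqrt s} w \<partial>cauchy_law s)"
  proof (rule nn_integral_mono)
    fix w :: real
    show "ennreal (min 1 \<bar>w\<bar>) \<le> ennreal (sqrt s) + indicator {w. \<bar>w\<bar> \<ge> sqrt s} w"
    proof (cases "\<bar>w\<bar> \<ge> sqrt s")
      case True
      have "ennreal (min 1 \<bar>w\<bar>) \<le> 1"
        using ennreal_leI[of "min 1 \<bar>w\<bar>" 1] by simp
      also have "\<dots> \<le> ennreal (sqrt s) + indicator {w. \<bar>w\<bar> \<ge> sqrt s} w" using True by simp
      finally show ?thesis .
    next
      case False
      then show ?thesis by (simp add: ennreal_leI)
    qed
  qed
  also have "\<dots> = ennreal (sqrt s) + (\<integral>\<^sup>+w. indicator {w. \<bar>w\<bar> \<ge> sqrt s} w \<partial>cauchy_law s)"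
    by (rule cauchy_law_add_indicator[OF s])
  also have "\<dots> \<le> ennreal (sqrt s) + ennreal (2 * s / sqrt s)"
    by (intro add_left_mono cauchy_law_tail[OF s r])
  also have "\<dots> = ennreal (sqrt s + 2 * s / sqrt s)"
    using s by (intro ennreal_plus[symmetric]) auto
  also have "sqrt s + 2 * s / sqrt s = 3 * sqrt s"
  proof -
    have "2 * s / sqrt s = 2 * (s / sqrt s)" by (rule times_divide_eq_right[symmetric])
    also have "s / sqrt s = sqrt s" by (rule real_div_sqrt) (use s in simp)
    finally show ?thesis by simp
  qed
  finally show ?thesis .
qed

section \<open>The cubic weight against the Cauchy law\<close>

definition weight :: "real \<Rightarrow> real" where
  "weight z = 1 / (1 + \<bar>z\<bar>) ^ 3"

lemma weight_measurable [measurable]: "weight \<in> borel_measurable borel"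
  unfolding weight_def by measurable

lemma weight_pos: "weight z > 0"
  unfolding weight_def by (auto intro!: zero_less_power add_pos_nonneg)

lemma weight_le_1: "weight z \<le> 1"
  unfolding weight_def by simp

lemma nn_integral_weight_le: "(\<integral>\<^sup>+w. ennreal (weight (y + w)) \<partial>lborel) \<le> ennreal pi"
proof -
  have "(\<integral>\<^sup>+w. ennreal (weight (y + w)) \<partial>lborel) = (\<integral>\<^sup>+w. ennreal (weight w) \<partial>lborel)"
    using nn_integral_real_affine[of "\<lambda>w. ennreal (weight w)" 1 y] by simp
  also have "\<dots> \<le> (\<integral>\<^sup>+w. ennreal (1 / (1 + w\<^sup>2)) \<partial>lborel)"
  proof (intro nn_integral_mono ennreal_leI)
    fix w :: real
    have "1 + w\<^sup>2 \<le> (1 + \<bar>w\<bar>) ^ 2" by (simp add: power2_sum)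
    also have "\<dots> \<le> (1 + \<bar>w\<bar>) ^ 3" by (rule power_increasing) auto
    finally show "weight w \<le> 1 / (1 + w\<^sup>2)"
      unfolding weight_def by (intro divide_left_mono) (auto intro!: mult_pos_pos add_pos_nonneg)
  qed
  also have "\<dots> = ennreal pi"
    using integral_1_div_plus_square by (subst nn_integral_eq_integral) auto
  finally show ?thesis .
qed

text \<open>If the jump is at most half of \<bar>y\<bar>, the weight is at most
  \<open>8 / (1 + \<bar>y\<bar>) ^ 3\<close> and absorbs \<open>y^2\<close>. If it is larger, the
  density is at most \<open>t / (pi * w^2)\<close> with \<open>y^2 \<le> 4 * w^2\<close>, leaving
  \<open>4 * t / pi\<close> times the weight, whose integral is at most \<pi>.\<close>

lemma cauchy_law_weight_bound:
  assumes t: "t > 0"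
  shows "(\<integral>\<^sup>+w. ennreal (y\<^sup>2 * weight (y + w)) \<partial>cauchy_law t) \<le> ennreal (8 / (1 + \<bar>y\<bar>) + 4 * t)"
proof -
  have "(\<integral>\<^sup>+w. ennreal (y\<^sup>2 * weight (y + w)) \<partial>cauchy_law t)
      = (\<integral>\<^sup>+w. ennreal (cauchy_density t w) * ennreal (y\<^sup>2 * weight (y + w)) \<partial>lborel)"
    by (rule nn_integral_cauchy_law) measurable
  also have "\<dots> \<le> (\<integral>\<^sup>+w. ennreal (8 / (1 + \<bar>y\<bar>)) * ennreal (cauchy_density t w) + ennreal (4 * t / pi) * ennreal (weight (y + w)) \<partial>lborel)"
  proof (rule nn_integral_mono)
    fix w :: real
    have q: "cauchy_density t w \<ge> 0" by (rule cauchy_density_nonneg[OF t])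
    have W: "weight (y + w) > 0" by (rule weight_pos)
    have "cauchy_density t w * (y\<^sup>2 * weight (y + w)) \<le> 8 / (1 + \<bar>y\<bar>) * cauchy_density t w + 4 * t / pi * weight (y + w)"
    proof (cases "\<bar>w\<bar> \<le> \<bar>y\<bar> / 2")
      case True
      have "\<bar>y\<bar> \<le> \<bar>y + w\<bar> + \<bar>w\<bar>" using abs_triangle_ineq[of "y + w" "- w"] by simp
      then have "(1 + \<bar>y\<bar>) / 2 \<le> 1 + \<bar>y + w\<bar>" using True by argo
      then have "((1 + \<bar>y\<bar>) / 2) ^ 3 \<le> (1 + \<bar>y + w\<bar>) ^ 3" by (intro power_mono) auto
      then have "weight (y + w) \<le> 1 / ((1 + \<bar>y\<bar>) / 2) ^ 3"
        unfolding weight_def by (intro divide_left_mono) (auto intro!: mult_pos_pos)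
      then have "y\<^sup>2 * weight (y + w) \<le> (1 + \<bar>y\<bar>)\<^sup>2 * (1 / ((1 + \<bar>y\<bar>) / 2) ^ 3)"
        using W by (intro mult_mono) (auto simp: power2_sum)
      also have "\<dots> = 8 / (1 + \<bar>y\<bar>)"
      proof -
        have "1 + \<bar>y\<bar> > 0" by simp
        then show ?thesis by (simp add: power_divide power2_eq_square power3_eq_cube)
      qed
      finally have "cauchy_density t w * (y\<^sup>2 * weight (y + w)) \<le> cauchy_density t w * (8 / (1 + \<bar>y\<bar>))"
        by (rule mult_left_mono[OF _ q])
      moreover have "0 \<le> 4 * t / pi * weight (y + w)" using t W by simp
      ultimately show ?thesis by (simp add: mult.commute)
    next
      case False
      then have w0: "w \<noteq> 0" by auto
      have "\<bar>y\<bar>\<^sup>2 \<le> (2 * \<bar>w\<bar>)\<^sup>2" by (rule power_mono) (use False in auto)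
      then have yw: "y\<^sup>2 \<le> 4 * w\<^sup>2" by (simp add: power_mult_distrib)
      have "cauchy_density t w * y\<^sup>2 \<le> t / (pi * w\<^sup>2) * (4 * w\<^sup>2)"
      proof (rule mult_mono)
        show "cauchy_density t w \<le> t / (pi * w\<^sup>2)"
          unfolding cauchy_density_def using t w0
          by (intro divide_left_mono) (auto intro!: mult_pos_pos add_pos_nonneg)
      qed (use yw t in auto)
      also have "\<dots> = 4 * t / pi" using w0 by simp
      finally have "cauchy_density t w * y\<^sup>2 * weight (y + w) \<le> 4 * t / pi * weight (y + w)"
        by (rule mult_right_mono) (use W in simp)
      moreover have "0 \<le> 8 / (1 + \<bar>y\<bar>) * cauchy_density t w" using q by simp
      ultimately show ?thesis by (simp add: mult.assoc)
    qed
    then have "ennreal (cauchy_density t w * (y\<^sup>2 * weight (y + w)))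
        \<le> ennreal (8 / (1 + \<bar>y\<bar>) * cauchy_density t w + 4 * t / pi * weight (y + w))"
      by (rule ennreal_leI)
    then show "ennreal (cauchy_density t w) * ennreal (y\<^sup>2 * weight (y + w))
        \<le> ennreal (8 / (1 + \<bar>y\<bar>)) * ennreal (cauchy_density t w) + ennreal (4 * t / pi) * ennreal (weight (y + w))"
      using q W t by (simp add: ennreal_mult[symmetric] ennreal_plus[symmetric] del: ennreal_plus)
  qed
  also have "\<dots> = ennreal (8 / (1 + \<bar>y\<bar>)) * (\<integral>\<^sup>+w. ennreal (cauchy_density t w) \<partial>lborel)
      + ennreal (4 * t / pi) * (\<integral>\<^sup>+w. ennreal (weight (y + w)) \<partial>lborel)"
    by (subst nn_integral_add) (auto simp: nn_integral_cmult)
  also have "\<dots> \<le> ennreal (8 / (1 + \<bar>y\<bar>)) * 1 + ennreal (4 * t / pi) * ennreal pi"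
    unfolding nn_integral_cauchy_density[OF t] by (intro add_left_mono mult_left_mono nn_integral_weight_le) simp
  also have "\<dots> = ennreal (8 / (1 + \<bar>y\<bar>) + 4 * t)"
    using t by (simp add: ennreal_mult[symmetric] ennreal_plus[symmetric] del: ennreal_plus)
  finally show ?thesis .
qed

section \<open>Feynman-Kac functionals of Cauchy paths\<close>

text \<open>
  All that is needed of the Cauchy process up to time \<open>t\<close>; it holds both for the process itself
  and for its reversal at time \<open>t\<close>.
\<close>

definition cauchy_path :: "'w measure \<Rightarrow> real \<Rightarrow> (real \<Rightarrow> 'w \<Rightarrow> real) \<Rightarrow> bool" where
  "cauchy_path M t Y \<longleftrightarrow> prob_space M \<and>
     (\<lambda>p. Y (fst p) (snd p)) \<in> borel_measurable (borel \<Otimes>\<^sub>M M) \<and>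
     distr M borel (Y t) = cauchy_law t \<and>
     (\<forall>s. 0 < s \<and> s < t \<longrightarrow>
        distr M (borel \<Otimes>\<^sub>M borel) (\<lambda>\<omega>. (Y s \<omega>, Y t \<omega> - Y s \<omega>)) = cauchy_law s \<Otimes>\<^sub>M cauchy_law (t - s))"

lemma cauchy_path_measurable:
  assumes "cauchy_path M t Y" and [measurable]: "f \<in> borel_measurable N" "g \<in> measurable N M"
  shows "(\<lambda>x. Y (f x) (g x)) \<in> borel_measurable N"
proof -
  have m: "(\<lambda>p. Y (fst p) (snd p)) \<in> borel_measurable (borel \<Otimes>\<^sub>M M)"
    using assms(1) by (simp add: cauchy_path_def)
  have "(\<lambda>x. (f x, g x)) \<in> measurable N (borel \<Otimes>\<^sub>M M)" by measurable
  from measurable_compose[OF this m] show ?thesis by simp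
qed

lemma cauchy_path_measurable':
  assumes "cauchy_path M t Y"
  shows "Y s \<in> borel_measurable M"
  using cauchy_path_measurable[OF assms, of "\<lambda>_. s" M "\<lambda>\<omega>. \<omega>"] by simp

lemma cauchy_path_nn_integral:
  assumes p: "cauchy_path M t Y" and s: "0 < s" "s < t"
    and G [measurable]: "case_prod G \<in> borel_measurable (borel \<Otimes>\<^sub>M borel)"
  shows "(\<integral>\<^sup>+\<omega>. G (Y s \<omega>) (Y t \<omega> - Y s \<omega>) \<partial>M) = (\<integral>\<^sup>+u. (\<integral>\<^sup>+w. G u w \<partial>cauchy_law (t - s)) \<partial>cauchy_law s)"
proof -
  have [measurable]: "Y r \<in> borel_measurable M" for r by (rule cauchy_path_measurable'[OF p])
  interpret real_distribution "cauchy_law (t - s)" by (rule real_distribution_cauchy_law) (use s in simp)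
  have Gm: "case_prod G \<in> borel_measurable (cauchy_law s \<Otimes>\<^sub>M cauchy_law (t - s))"
    by measurable
  have "(\<integral>\<^sup>+\<omega>. G (Y s \<omega>) (Y t \<omega> - Y s \<omega>) \<partial>M)
      = (\<integral>\<^sup>+z. case_prod G z \<partial>distr M (borel \<Otimes>\<^sub>M borel) (\<lambda>\<omega>. (Y s \<omega>, Y t \<omega> - Y s \<omega>)))"
    by (subst nn_integral_distr) auto
  also have "\<dots> = (\<integral>\<^sup>+z. case_prod G z \<partial>(cauchy_law s \<Otimes>\<^sub>M cauchy_law (t - s)))"
    using p s by (simp add: cauchy_path_def)
  also have "\<dots> = (\<integral>\<^sup>+u. (\<integral>\<^sup>+w. case_prod G (u, w) \<partial>cauchy_law (t - s)) \<partial>cauchy_law s)"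
    by (rule nn_integral_fst[symmetric, OF Gm])
  finally show ?thesis by simp
qed

text \<open>The increment after time \<open>s\<close> is integrated out first, which replaces the
  unbounded square by \<open>8 / (1 + \<bar>x + u\<bar>) + 4 * t\<close>. Averaging over the
  position at time \<open>s\<close> gives \<open>8 * 6 = 48\<close>.\<close>

lemma cauchy_path_weighted_bound:
  assumes p: "cauchy_path M t Y" and s: "0 < s" "s < t" and t: "t \<le> 1"
  shows "(\<integral>\<^sup>+\<omega>. ennreal ((x + Y s \<omega>)\<^sup>2 * weight (x + Y t \<omega>)) \<partial>M) \<le> ennreal (48 / (1 + \<bar>x\<bar>) + 4 * t)"
proof -
  have "(\<integral>\<^sup>+\<omega>. ennreal ((x + Y s \<omega>)\<^sup>2 * weight (x + Y t \<omega>)) \<partial>M)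
      = (\<integral>\<^sup>+\<omega>. ennreal ((x + Y s \<omega>)\<^sup>2 * weight (x + Y s \<omega> + (Y t \<omega> - Y s \<omega>))) \<partial>M)" by simp
  also have "\<dots> = (\<integral>\<^sup>+u. (\<integral>\<^sup>+w. ennreal ((x + u)\<^sup>2 * weight (x + u + w)) \<partial>cauchy_law (t - s)) \<partial>cauchy_law s)"
    by (rule cauchy_path_nn_integral[OF p s]) measurable
  also have "\<dots> \<le> (\<integral>\<^sup>+u. ennreal (8 * (1 / (1 + \<bar>x + u\<bar>))) + ennreal (4 * t) \<partial>cauchy_law s)"
  proof (rule nn_integral_mono)
    fix u
    have "(\<integral>\<^sup>+w. ennreal ((x + u)\<^sup>2 * weight (x + u + w)) \<partial>cauchy_law (t - s)) \<le> ennreal (8 / (1 + \<bar>x + u\<bar>) + 4 * (t - s))"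
      by (rule cauchy_law_weight_bound) (use s in simp)
    also have "\<dots> \<le> ennreal (8 * (1 / (1 + \<bar>x + u\<bar>)) + 4 * t)"
      by (rule ennreal_leI) (use s in simp)
    also have "\<dots> = ennreal (8 * (1 / (1 + \<bar>x + u\<bar>))) + ennreal (4 * t)"
      by (rule ennreal_plus) (use s in auto)
    finally show "(\<integral>\<^sup>+w. ennreal ((x + u)\<^sup>2 * weight (x + u + w)) \<partial>cauchy_law (t - s))
        \<le> ennreal (8 * (1 / (1 + \<bar>x + u\<bar>))) + ennreal (4 * t)" .
  qed
  also have "\<dots> = (\<integral>\<^sup>+u. ennreal (8 * (1 / (1 + \<bar>x + u\<bar>))) \<partial>cauchy_law s) + (\<integral>\<^sup>+u. ennreal (4 * t) \<partial>cauchy_law s)"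
    by (rule nn_integral_add) measurable
  also have "(\<integral>\<^sup>+u. ennreal (8 * (1 / (1 + \<bar>x + u\<bar>))) \<partial>cauchy_law s) = 8 * (\<integral>\<^sup>+u. ennreal (1 / (1 + \<bar>x + u\<bar>)) \<partial>cauchy_law s)"
    by (subst nn_integral_cmult[symmetric]) (auto simp: ennreal_mult[symmetric] simp flip: ennreal_numeral)
  also have "\<dots> \<le> 8 * ennreal (6 / (1 + \<bar>x\<bar>))"
    by (rule mult_left_mono[OF cauchy_law_inverse_bound]) (use s t in auto)
  also have "8 * ennreal (6 / (1 + \<bar>x\<bar>)) = ennreal (48 / (1 + \<bar>x\<bar>))"
    by (simp add: ennreal_mult[symmetric] flip: ennreal_numeral)
  also have "(\<integral>\<^sup>+u. ennreal (4 * t) \<partial>cauchy_law s) = ennreal (4 * t)"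
    by (rule nn_integral_cauchy_law_const[OF s(1)])
  also have "ennreal (48 / (1 + \<bar>x\<bar>)) + ennreal (4 * t) = ennreal (48 / (1 + \<bar>x\<bar>) + 4 * t)"
    by (rule ennreal_plus[symmetric]) (use s in auto)
  finally show ?thesis by (simp add: add_right_mono)
qed

text \<open>The excess over \<open>K\<close> is present only where
  \<open>\<bar>x + u\<bar> > sqrt K\<close>, and there the term
  \<open>8 / (1 + \<bar>x + u\<bar>)\<close> is already below \<open>8 / sqrt K\<close>.\<close>

lemma cauchy_path_truncation_bound:
  assumes p: "cauchy_path M t Y" and s: "0 < s" "s < t" and K: "K > 0"
  shows "(\<integral>\<^sup>+\<omega>. ennreal (max 0 ((x + Y s \<omega>)\<^sup>2 - K) * weight (x + Y t \<omega>)) \<partial>M) \<le> ennreal (8 / sqrt K + 4 * t)"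
proof -
  have "(\<integral>\<^sup>+\<omega>. ennreal (max 0 ((x + Y s \<omega>)\<^sup>2 - K) * weight (x + Y t \<omega>)) \<partial>M)
      = (\<integral>\<^sup>+\<omega>. ennreal (max 0 ((x + Y s \<omega>)\<^sup>2 - K) * weight (x + Y s \<omega> + (Y t \<omega> - Y s \<omega>))) \<partial>M)" by simp
  also have "\<dots> = (\<integral>\<^sup>+u. (\<integral>\<^sup>+w. ennreal (max 0 ((x + u)\<^sup>2 - K) * weight (x + u + w)) \<partial>cauchy_law (t - s)) \<partial>cauchy_law s)"
    by (rule cauchy_path_nn_integral[OF p s]) measurable
  also have "\<dots> \<le> (\<integral>\<^sup>+u. ennreal (8 / sqrt K + 4 * t) \<partial>cauchy_law s)"
  proof (rule nn_integral_mono)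
    fix u
    show "(\<integral>\<^sup>+w. ennreal (max 0 ((x + u)\<^sup>2 - K) * weight (x + u + w)) \<partial>cauchy_law (t - s)) \<le> ennreal (8 / sqrt K + 4 * t)"
    proof (cases "(x + u)\<^sup>2 \<le> K")
      case True
      then have "max 0 ((x + u)\<^sup>2 - K) = 0" by simp
      then show ?thesis by simp
    next
      case False
      have "(\<integral>\<^sup>+w. ennreal (max 0 ((x + u)\<^sup>2 - K) * weight (x + u + w)) \<partial>cauchy_law (t - s))
          \<le> (\<integral>\<^sup>+w. ennreal ((x + u)\<^sup>2 * weight (x + u + w)) \<partial>cauchy_law (t - s))"
        by (intro nn_integral_mono ennreal_leI mult_right_mono) (use False K weight_pos[THEN less_imp_le] in auto)
      also have "\<dots> \<le> ennreal (8 / (1 + \<bar>x + u\<bar>) + 4 * (t - s))"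
        by (rule cauchy_law_weight_bound) (use s in simp)
      also have "\<dots> \<le> ennreal (8 / sqrt K + 4 * t)"
      proof (rule ennreal_leI)
        have "sqrt K \<le> \<bar>x + u\<bar>" using False real_sqrt_le_mono[of K "(x + u)\<^sup>2"] by simp
        then have "8 / (1 + \<bar>x + u\<bar>) \<le> 8 / sqrt K"
          using K by (intro divide_left_mono) (auto intro!: mult_pos_pos)
        then show "8 / (1 + \<bar>x + u\<bar>) + 4 * (t - s) \<le> 8 / sqrt K + 4 * t" using s by simp
      qed
      finally show ?thesis .
    qed
  qed
  also have "\<dots> = ennreal (8 / sqrt K + 4 * t)" by (rule nn_integral_cauchy_law_const[OF s(1)])
  finally show ?thesis .
qed

lemma cauchy_path_min_bound:
  assumes p: "cauchy_path M t Y" and s: "0 < s" "s \<le> t"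
  shows "(\<integral>\<^sup>+\<omega>. ennreal (min 1 \<bar>Y s \<omega>\<bar>) \<partial>M) \<le> ennreal (3 * sqrt t)"
proof -
  have [measurable]: "Y r \<in> borel_measurable M" for r by (rule cauchy_path_measurable'[OF p])
  have "(\<integral>\<^sup>+\<omega>. ennreal (min 1 \<bar>Y s \<omega>\<bar>) \<partial>M) = (\<integral>\<^sup>+w. ennreal (min 1 \<bar>w\<bar>) \<partial>cauchy_law s)"
  proof (cases "s = t")
    case True
    have "(\<integral>\<^sup>+w. ennreal (min 1 \<bar>w\<bar>) \<partial>distr M borel (Y t)) = (\<integral>\<^sup>+\<omega>. ennreal (min 1 \<bar>Y t \<omega>\<bar>) \<partial>M)"
      by (rule nn_integral_distr) measurable
    then show ?thesis using p True by (simp add: cauchy_path_def)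
  next
    case False
    have "(\<integral>\<^sup>+\<omega>. ennreal (min 1 \<bar>Y s \<omega>\<bar>) \<partial>M) = (\<integral>\<^sup>+u. (\<integral>\<^sup>+w. ennreal (min 1 \<bar>u\<bar>) \<partial>cauchy_law (t - s)) \<partial>cauchy_law s)"
      by (rule cauchy_path_nn_integral[OF p, where G = "\<lambda>u w. ennreal (min 1 \<bar>u\<bar>)"]) (use s False in auto)
    also have "\<dots> = (\<integral>\<^sup>+u. ennreal (min 1 \<bar>u\<bar>) \<partial>cauchy_law s)"
      by (rule nn_integral_cong, rule nn_integral_cauchy_law_const) (use s False in auto)
    finally show ?thesis .
  qed
  also have "\<dots> \<le> ennreal (3 * sqrt s)" by (rule cauchy_law_min_bound[OF s(1)])
  also have "\<dots> \<le> ennreal (3 * sqrt t)" by (rule ennreal_leI) (use s in simp)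
  finally show ?thesis .
qed

lemma cauchy_path_weight_final:
  assumes p: "cauchy_path M t Y" and t: "0 < t"
  shows "(\<integral>\<^sup>+\<omega>. ennreal (x\<^sup>2 * weight (x + Y t \<omega>)) \<partial>M) \<le> ennreal (8 / (1 + \<bar>x\<bar>) + 4 * t)"
proof -
  have [measurable]: "Y r \<in> borel_measurable M" for r by (rule cauchy_path_measurable'[OF p])
  have "(\<integral>\<^sup>+w. ennreal (x\<^sup>2 * weight (x + w)) \<partial>distr M borel (Y t)) = (\<integral>\<^sup>+\<omega>. ennreal (x\<^sup>2 * weight (x + Y t \<omega>)) \<partial>M)"
    by (rule nn_integral_distr) measurable
  then show ?thesis using p cauchy_law_weight_bound[OF t, of x] by (simp add: cauchy_path_def)
qed

lemma cauchy_path_time_integral_bound: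
  assumes p: "cauchy_path M t Y" and t: "0 < t"
    and g [measurable]: "case_prod g \<in> borel_measurable (borel \<Otimes>\<^sub>M M)"
    and b: "\<And>s. 0 < s \<Longrightarrow> s < t \<Longrightarrow> (\<integral>\<^sup>+\<omega>. g s \<omega> \<partial>M) \<le> ennreal B" and B: "B \<ge> 0"
  shows "(\<integral>\<^sup>+\<omega>. (\<integral>\<^sup>+s. g s \<omega> * indicator {0..t} s \<partial>lborel) \<partial>M) \<le> ennreal (t * B)"
proof -
  interpret prob_space M using p by (simp add: cauchy_path_def)
  interpret P: pair_sigma_finite lborel M ..
  have gm [measurable]: "(\<lambda>z. g (fst z) (snd z) * indicator {0..t} (fst z)) \<in> borel_measurable (lborel \<Otimes>\<^sub>M M)"
  proof -
    have [measurable]: "(\<lambda>z. g (fst z) (snd z)) \<in> borel_measurable (lborel \<Otimes>\<^sub>M M)"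
      using g by (simp add: case_prod_beta')
    show ?thesis by measurable
  qed
  have "(\<integral>\<^sup>+\<omega>. (\<integral>\<^sup>+s. g s \<omega> * indicator {0..t} s \<partial>lborel) \<partial>M) = (\<integral>\<^sup>+s. (\<integral>\<^sup>+\<omega>. g s \<omega> * indicator {0..t} s \<partial>M) \<partial>lborel)"
    using P.Fubini[of "\<lambda>z. g (fst z) (snd z) * indicator {0..t} (fst z)"] by simp
  also have "\<dots> \<le> (\<integral>\<^sup>+s. ennreal B * indicator {0..t} s \<partial>lborel)"
  proof (rule nn_integral_mono_AE)
    show "AE s in lborel. (\<integral>\<^sup>+\<omega>. g s \<omega> * indicator {0..t} s \<partial>M) \<le> ennreal B * indicator {0..t} s"
      using AE_lborel_singleton[of 0] AE_lborel_singleton[of t]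
    proof eventually_elim
      case (elim s)
      then consider "0 < s" "s < t" | "s \<notin> {0..t}" by fastforce
      then show ?case
      proof cases
        case 1
        then show ?thesis using b[OF 1] by (simp add: indicator_def)
      next
        case 2
        then show ?thesis by simp
      qed
    qed
  qed
  also have "\<dots> = ennreal B * ennreal t" using t by (subst nn_integral_cmult_indicator) auto
  also have "\<dots> = ennreal (t * B)" using t B by (simp add: ennreal_mult[symmetric] mult.commute)
  finally show ?thesis .
qed

text \<open>A nonintegrable function has Bochner integral 0, so the inequality holds in either case.
  It is applied to the action along a single path, which then may be infinite.\<close>

lemma ennreal_integral_le_nn_integral:
  assumes "\<And>x. 0 \<le> (f x :: real)"
  shows "ennreal (LINT x|M. f x) \<le> (\<integral>\<^sup>+x. ennreal (f x) \<partial>M)"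
proof (cases "integrable M f")
  case True
  then show ?thesis using nn_integral_eq_integral[OF True] assms by simp
next
  case False
  then show ?thesis by (simp add: not_integrable_integral_eq)
qed

text \<open>To be read with \<open>a\<close> the full action and \<open>b\<close> its truncated
  part: \<open>1 - exp (- a)\<close> lies between \<open>b - b^2 / 2\<close> and
  \<open>a\<close>.\<close>

lemma one_minus_exp_bounds:
  fixes a b :: real
  assumes "0 \<le> b" "b \<le> a"
  shows "\<bar>(1 - exp (- a)) - b\<bar> \<le> (a - b) + b\<^sup>2 / 2"
proof -
  have 1: "1 - exp (- a) \<le> a" using exp_ge_add_one_self[of "- a"] by simp
  have "exp (- b) \<le> 1 - b + b\<^sup>2 / 2"
  proof -
    have "1 - b + b\<^sup>2 / 2 - exp (- b) \<ge> 1 - 0 + 0\<^sup>2 / 2 - exp (- (0::real))"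
    proof (rule DERIV_nonneg_imp_nondecreasing[OF assms(1), where f = "\<lambda>b. 1 - b + b\<^sup>2 / 2 - exp (- b)"])
      fix x :: real
      have "((\<lambda>b. 1 - b + b\<^sup>2 / 2 - exp (- b)) has_real_derivative - 1 + x + exp (- x)) (at x)"
        by (auto intro!: derivative_eq_intros)
      moreover have "0 \<le> - 1 + x + exp (- x)" using exp_ge_add_one_self[of "- x"] by simp
      ultimately show "\<exists>d. ((\<lambda>b. 1 - b + b\<^sup>2 / 2 - exp (- b)) has_real_derivative d) (at x) \<and> 0 \<le> d"
        by blast
    qed
    then show ?thesis by simp
  qed
  moreover have "exp (- a) \<le> exp (- b)" using assms by simp
  ultimately have 2: "1 - exp (- a) - b \<ge> - (b\<^sup>2 / 2)" by linarith
  have 3: "0 \<le> b\<^sup>2 / 2" by simp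
  show ?thesis unfolding abs_le_iff using 1 2 3 assms by linarith
qed

text \<open>The square truncated at \<open>K\<close> is the square of \<bar>x + y\<bar> truncated at
  \<open>sqrt K\<close>. Its difference from \<open>x^2\<close> factors into a sum bounded by
  \<open>2 * sqrt K \<le> 2 * K\<close> and a difference bounded by \<bar>y\<bar>.\<close>

lemma square_truncation_lipschitz:
  fixes x y K :: real
  assumes K: "K \<ge> 1" "x\<^sup>2 \<le> K"
  shows "\<bar>min ((x + y)\<^sup>2) K - x\<^sup>2\<bar> \<le> 2 * K * min 1 \<bar>y\<bar>"
proof (cases "\<bar>y\<bar> \<ge> 1")
  case True
  have "0 \<le> x\<^sup>2" "0 \<le> (x + y)\<^sup>2" by simp_all
  moreover have "\<bar>min a K - b\<bar> \<le> 2 * K" if "0 \<le> b" "0 \<le> a" "b \<le> K" for a b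
    using that K(1) by (auto simp: min_def)
  ultimately have "\<bar>min ((x + y)\<^sup>2) K - x\<^sup>2\<bar> \<le> 2 * K" using K(2) by blast
  then show ?thesis using True by simp
next
  case False
  define r where "r = sqrt K"
  have r: "r \<ge> 0" "r\<^sup>2 = K" using K by (simp_all add: r_def)
  have rK: "r \<le> K" using K unfolding r_def by (intro real_le_lsqrt) (auto simp: power2_eq_square mult_le_cancel_left1)
  have xr: "\<bar>x\<bar> \<le> r" using K real_sqrt_le_mono[of "x\<^sup>2" K] by (simp add: r_def)
  define z where "z = min \<bar>x + y\<bar> r"
  have z2: "min ((x + y)\<^sup>2) K = z\<^sup>2"
  proof (cases "\<bar>x + y\<bar> \<le> r")
    case True
    then have "\<bar>x + y\<bar>\<^sup>2 \<le> r\<^sup>2" by (intro power_mono) auto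
    then show ?thesis using True r by (simp add: z_def min_def)
  next
    case False
    then have "r\<^sup>2 \<le> \<bar>x + y\<bar>\<^sup>2" using r by (intro power_mono) auto
    then show ?thesis using False r by (simp add: z_def min_def)
  qed
  have zx: "\<bar>z - \<bar>x\<bar>\<bar> \<le> \<bar>y\<bar>" using xr by (auto simp: z_def min_def)
  have zs: "\<bar>z + \<bar>x\<bar>\<bar> \<le> 2 * K" using xr r rK by (auto simp: z_def min_def)
  have "z\<^sup>2 - x\<^sup>2 = (z + \<bar>x\<bar>) * (z - \<bar>x\<bar>)" by (simp add: power2_eq_square algebra_simps)
  then have "\<bar>z\<^sup>2 - x\<^sup>2\<bar> \<le> (2 * K) * \<bar>y\<bar>"
    unfolding abs_mult using mult_mono[OF zs zx] K by (simp add: abs_mult)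
  then show ?thesis unfolding z2 using False by simp
qed

text \<open>Separates the free evolution, which is explicit in momentum space, from the loss caused
  by the potential.\<close>

lemma feynman_kac_difference:
  assumes p: "cauchy_path M t Y" and \<phi> [measurable]: "\<phi> \<in> borel_measurable borel"
    and b: "\<And>z. norm (\<phi> z) \<le> C"
  shows "(LINT \<omega>|M. \<phi> (x + Y t \<omega>)) - feynman_kac M Y t \<phi> x
    = (LINT \<omega>|M. complex_of_real (1 - exp (- (LBINT s:{0..t}. (x + Y s \<omega>)\<^sup>2))) * \<phi> (x + Y t \<omega>))"
    "(\<lambda>\<omega>. LBINT s:{0..t}. (x + Y s \<omega>)\<^sup>2) \<in> borel_measurable M"
    "integrable M (\<lambda>\<omega>. complex_of_real (1 - exp (- (LBINT s:{0..t}. (x + Y s \<omega>)\<^sup>2))) * \<phi> (x + Y t \<omega>))"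
proof -
  interpret prob_space M using p by (simp add: cauchy_path_def)
  note [measurable (raw)] = cauchy_path_measurable[OF p]
  have [measurable]: "Y r \<in> borel_measurable M" for r by (rule cauchy_path_measurable'[OF p])
  show A [measurable]: "(\<lambda>\<omega>. LBINT s:{0..t}. (x + Y s \<omega>)\<^sup>2) \<in> borel_measurable M"
    unfolding set_lebesgue_integral_def by measurable
  have A0: "(LBINT s:{0..t}. (x + Y s \<omega>)\<^sup>2) \<ge> 0" for \<omega>
    unfolding set_lebesgue_integral_def by (rule Bochner_Integration.integral_nonneg) simp
  have C0: "C \<ge> 0" using b[of 0] norm_ge_zero[of "\<phi> 0"] by linarith
  have i1: "integrable M (\<lambda>\<omega>. \<phi> (x + Y t \<omega>))"
    by (rule integrable_const_bound[of _ C]) (use b in auto)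
  have i2: "integrable M (\<lambda>\<omega>. complex_of_real (exp (- (LBINT s:{0..t}. (x + Y s \<omega>)\<^sup>2))) * \<phi> (x + Y t \<omega>))"
  proof (rule integrable_const_bound[of _ C])
    have "norm (complex_of_real (exp (- (LBINT s:{0..t}. (x + Y s \<omega>)\<^sup>2))) * \<phi> (x + Y t \<omega>)) \<le> 1 * C" for \<omega>
      unfolding norm_mult using b C0 A0[of \<omega>] by (intro mult_mono) auto
    then show "AE \<omega> in M. norm (complex_of_real (exp (- (LBINT s:{0..t}. (x + Y s \<omega>)\<^sup>2))) * \<phi> (x + Y t \<omega>)) \<le> C"
      by simp
  qed measurable
  show "(LINT \<omega>|M. \<phi> (x + Y t \<omega>)) - feynman_kac M Y t \<phi> x
    = (LINT \<omega>|M. complex_of_real (1 - exp (- (LBINT s:{0..t}. (x + Y s \<omega>)\<^sup>2))) * \<phi> (x + Y t \<omega>))"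
    unfolding feynman_kac_def using i1 i2 by (simp add: left_diff_distrib)
  show "integrable M (\<lambda>\<omega>. complex_of_real (1 - exp (- (LBINT s:{0..t}. (x + Y s \<omega>)\<^sup>2))) * \<phi> (x + Y t \<omega>))"
    using Bochner_Integration.integrable_diff[OF i1 i2] by (simp add: left_diff_distrib)
qed

text \<open>
  For \<open>t x\<^sup>2 \<le> 1\<close> the loss \<open>1 - exp (- A)\<close> is estimated by the action \<open>A\<close>, whose expectation is finite
  only thanks to the weight at the endpoint; for \<open>t x\<^sup>2 > 1\<close> the trivial estimate by \<open>1\<close> is better.
\<close>

lemma feynman_kac_dominated:
  assumes p: "cauchy_path M t Y" and t: "0 < t" "t \<le> 1" and \<phi> [measurable]: "\<phi> \<in> borel_measurable borel"
    and b: "\<And>z. norm (\<phi> z) \<le> C * weight z" and C: "C > 0"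
  shows "norm ((LINT \<omega>|M. \<phi> (x + Y t \<omega>)) - feynman_kac M Y t \<phi> x) \<le> t * (56 * C / (1 + \<bar>x\<bar>))"
proof -
  interpret prob_space M using p by (simp add: cauchy_path_def)
  note [measurable (raw)] = cauchy_path_measurable[OF p]
  have [measurable]: "Y r \<in> borel_measurable M" for r by (rule cauchy_path_measurable'[OF p])
  have b1: "norm (\<phi> z) \<le> C" for z
    using b[of z] mult_left_mono[OF weight_le_1[of z] less_imp_le[OF C]] by simp
  note fk = feynman_kac_difference[OF p \<phi> b1, of x]
  define A where "A = (\<lambda>\<omega>. LBINT s:{0..t}. (x + Y s \<omega>)\<^sup>2)"
  have A0: "A \<omega> \<ge> 0" for \<omega>
    unfolding A_def set_lebesgue_integral_def by (rule Bochner_Integration.integral_nonneg) simp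
  define f where "f = (\<lambda>\<omega>. complex_of_real (1 - exp (- A \<omega>)) * \<phi> (x + Y t \<omega>))"
  have "ennreal (norm (LINT \<omega>|M. f \<omega>)) \<le> (\<integral>\<^sup>+\<omega>. ennreal (norm (f \<omega>)) \<partial>M)"
    by (rule integral_norm_bound_ennreal) (use fk(3) in \<open>simp add: f_def A_def\<close>)
  also have "\<dots> \<le> ennreal (t * (56 * C / (1 + \<bar>x\<bar>)))"
  proof (cases "t * x\<^sup>2 \<le> 1")
    case True
    have "(\<integral>\<^sup>+\<omega>. ennreal (norm (f \<omega>)) \<partial>M)
        \<le> (\<integral>\<^sup>+\<omega>. (\<integral>\<^sup>+s. ennreal (C * ((x + Y s \<omega>)\<^sup>2 * weight (x + Y t \<omega>))) * indicator {0..t} s \<partial>lborel) \<partial>M)"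
    proof (rule nn_integral_mono)
      fix \<omega>
      have "norm (f \<omega>) \<le> A \<omega> * (C * weight (x + Y t \<omega>))"
        unfolding f_def norm_mult
      proof (rule mult_mono)
        show "norm (complex_of_real (1 - exp (- A \<omega>))) \<le> A \<omega>"
          unfolding norm_of_real using A0[of \<omega>] exp_ge_add_one_self[of "- A \<omega>"] by simp
      qed (use b A0 in auto)
      also have "\<dots> = (LINT s|lborel. indicator {0..t} s * (C * ((x + Y s \<omega>)\<^sup>2 * weight (x + Y t \<omega>))))"
        unfolding A_def set_lebesgue_integral_def
        by (subst integral_mult_left_zero[symmetric]) (simp add: mult_ac)
      finally have "ennreal (norm (f \<omega>)) \<le> ennreal (LINT s|lborel. indicator {0..t} s * (C * ((x + Y s \<omega>)\<^sup>2 * weight (x + Y t \<omega>))))"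
        by (rule ennreal_leI)
      also have "\<dots> \<le> (\<integral>\<^sup>+s. ennreal (indicator {0..t} s * (C * ((x + Y s \<omega>)\<^sup>2 * weight (x + Y t \<omega>)))) \<partial>lborel)"
        by (rule ennreal_integral_le_nn_integral) (use C weight_pos[THEN less_imp_le] in auto)
      also have "\<dots> = (\<integral>\<^sup>+s. ennreal (C * ((x + Y s \<omega>)\<^sup>2 * weight (x + Y t \<omega>))) * indicator {0..t} s \<partial>lborel)"
        by (rule nn_integral_cong) (auto simp: indicator_def)
      finally show "ennreal (norm (f \<omega>)) \<le> \<dots>" .
    qed
    also have "\<dots> \<le> ennreal (t * (C * (48 / (1 + \<bar>x\<bar>) + 4 * t)))"
    proof (rule cauchy_path_time_integral_bound[OF p t(1)])
      fix s assume s: "0 < s" "s < t"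
      have "(\<integral>\<^sup>+\<omega>. ennreal (C * ((x + Y s \<omega>)\<^sup>2 * weight (x + Y t \<omega>))) \<partial>M)
          = ennreal C * (\<integral>\<^sup>+\<omega>. ennreal ((x + Y s \<omega>)\<^sup>2 * weight (x + Y t \<omega>)) \<partial>M)"
        using C weight_pos[THEN less_imp_le] by (subst nn_integral_cmult[symmetric]) (auto simp: ennreal_mult[symmetric])
      also have "\<dots> \<le> ennreal C * ennreal (48 / (1 + \<bar>x\<bar>) + 4 * t)"
        by (intro mult_left_mono cauchy_path_weighted_bound[OF p s t(2)]) simp
      also have "\<dots> = ennreal (C * (48 / (1 + \<bar>x\<bar>) + 4 * t))"
        using C t by (simp add: ennreal_mult)
      finally show "(\<integral>\<^sup>+\<omega>. ennreal (C * ((x + Y s \<omega>)\<^sup>2 * weight (x + Y t \<omega>))) \<partial>M) \<le> ennreal (C * (48 / (1 + \<bar>x\<bar>) + 4 * t))" .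
    next
      show "(\<lambda>(s, \<omega>). ennreal (C * ((x + Y s \<omega>)\<^sup>2 * weight (x + Y t \<omega>)))) \<in> borel_measurable (borel \<Otimes>\<^sub>M M)"
        unfolding case_prod_beta' by measurable
      show "0 \<le> C * (48 / (1 + \<bar>x\<bar>) + 4 * t)" using C t by simp
    qed
    also have "\<dots> \<le> ennreal (t * (56 * C / (1 + \<bar>x\<bar>)))"
    proof (intro ennreal_leI mult_left_mono)
      \<comment> \<open>In the regime \<open>t * x\<^sup>2 \<le> 1\<close> the term
        \<open>4 * t\<close> is itself at most \<open>8 / (1 + \<bar>x\<bar>)\<close>; hence 56 = 48
        + 8.\<close>
      have "t * (1 + \<bar>x\<bar>) \<le> 2"
      proof (cases "\<bar>x\<bar> \<le> 1")
        case True
        have "t * (1 + \<bar>x\<bar>) \<le> 1 * 2" by (rule mult_mono) (use t True in auto)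
        then show ?thesis by simp
      next
        case False
        then have "1 * \<bar>x\<bar> \<le> \<bar>x\<bar> * \<bar>x\<bar>" by (intro mult_right_mono) auto
        then have "\<bar>x\<bar> \<le> x\<^sup>2" by (simp add: power2_eq_square)
        then have "t * \<bar>x\<bar> \<le> t * x\<^sup>2" using t by (intro mult_left_mono) auto
        then show ?thesis using \<open>t * x\<^sup>2 \<le> 1\<close> t(2) unfolding distrib_left by linarith
      qed
      then have "4 * t \<le> 8 / (1 + \<bar>x\<bar>)" by (simp add: field_simps)
      moreover have "48 / (1 + \<bar>x\<bar>) + 8 / (1 + \<bar>x\<bar>) = 56 / (1 + \<bar>x\<bar>)"
        by (simp add: add_divide_distrib[symmetric])
      ultimately have "48 / (1 + \<bar>x\<bar>) + 4 * t \<le> 56 / (1 + \<bar>x\<bar>)" by linarith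
      then have "C * (48 / (1 + \<bar>x\<bar>) + 4 * t) \<le> C * (56 / (1 + \<bar>x\<bar>))" using C by (intro mult_left_mono) auto
      then show "C * (48 / (1 + \<bar>x\<bar>) + 4 * t) \<le> 56 * C / (1 + \<bar>x\<bar>)" by (simp add: mult.commute)
    qed (use t in auto)
    finally show ?thesis .
  next
    case False
    then have x0: "x\<^sup>2 > 0" by auto
    \<comment> \<open>Here the factor \<open>t\<close> of the conclusion comes from
      \<open>1 / x\<^sup>2\<close>, as the loss is bounded by 1 only.\<close>
    have tx: "1 / x\<^sup>2 \<le> t" using False x0 by (simp add: field_simps)
    have x1: "1 \<le> \<bar>x\<bar>"
    proof (rule ccontr)
      assume "\<not> 1 \<le> \<bar>x\<bar>"
      then have "\<bar>x\<bar>\<^sup>2 \<le> 1" by (intro power_le_one) auto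
      then have "t * x\<^sup>2 \<le> 1 * 1" using t by (intro mult_mono) auto
      with False show False by simp
    qed
    have "(\<integral>\<^sup>+\<omega>. ennreal (norm (f \<omega>)) \<partial>M) \<le> (\<integral>\<^sup>+\<omega>. ennreal (C / x\<^sup>2) * ennreal (x\<^sup>2 * weight (x + Y t \<omega>)) \<partial>M)"
    proof (rule nn_integral_mono)
      fix \<omega>
      have "norm (f \<omega>) \<le> 1 * (C * weight (x + Y t \<omega>))"
        unfolding f_def norm_mult
      proof (rule mult_mono)
        show "norm (complex_of_real (1 - exp (- A \<omega>))) \<le> 1"
          unfolding norm_of_real using A0[of \<omega>] by simp
      qed (use b in auto)
      also have "\<dots> = (C / x\<^sup>2) * (x\<^sup>2 * weight (x + Y t \<omega>))" using x0 by simp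
      finally have "ennreal (norm (f \<omega>)) \<le> ennreal ((C / x\<^sup>2) * (x\<^sup>2 * weight (x + Y t \<omega>)))" by (rule ennreal_leI)
      then show "ennreal (norm (f \<omega>)) \<le> ennreal (C / x\<^sup>2) * ennreal (x\<^sup>2 * weight (x + Y t \<omega>))"
        using C weight_pos[THEN less_imp_le] by (subst ennreal_mult[symmetric]) auto
    qed
    also have "\<dots> = ennreal (C / x\<^sup>2) * (\<integral>\<^sup>+\<omega>. ennreal (x\<^sup>2 * weight (x + Y t \<omega>)) \<partial>M)"
      by (rule nn_integral_cmult) measurable
    also have "\<dots> \<le> ennreal (C / x\<^sup>2) * ennreal (8 / (1 + \<bar>x\<bar>) + 4 * t)"
      by (intro mult_left_mono cauchy_path_weight_final[OF p t(1)]) simp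
    also have "\<dots> = ennreal (C / x\<^sup>2 * (8 / (1 + \<bar>x\<bar>) + 4 * t))"
      using C t by (subst ennreal_mult[symmetric]) auto
    also have "\<dots> \<le> ennreal (t * (56 * C / (1 + \<bar>x\<bar>)))"
    proof (rule ennreal_leI)
      have e1: "1 / x\<^sup>2 * (8 / (1 + \<bar>x\<bar>)) \<le> t * (8 / (1 + \<bar>x\<bar>))"
        by (rule mult_right_mono[OF tx]) simp
      have "4 / x\<^sup>2 \<le> 8 / (1 + \<bar>x\<bar>)"
      proof -
        have "(1 + \<bar>x\<bar>) / 2 \<le> \<bar>x\<bar> * 1" using x1 by simp
        also have "\<dots> \<le> \<bar>x\<bar> * \<bar>x\<bar>" by (rule mult_left_mono) (use x1 in auto)
        also have "\<dots> = x\<^sup>2" by (simp add: power2_eq_square)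
        finally have "4 / x\<^sup>2 \<le> 4 / ((1 + \<bar>x\<bar>) / 2)"
          using x0 by (intro divide_left_mono) (auto intro!: mult_pos_pos)
        then show ?thesis by simp
      qed
      then have e2: "t * (4 / x\<^sup>2) \<le> t * (8 / (1 + \<bar>x\<bar>))" using t by (intro mult_left_mono) auto
      have "C / x\<^sup>2 * (8 / (1 + \<bar>x\<bar>) + 4 * t) = C * (1 / x\<^sup>2 * (8 / (1 + \<bar>x\<bar>)) + t * (4 / x\<^sup>2))"
        by (simp add: algebra_simps)
      moreover have "C * (1 / x\<^sup>2 * (8 / (1 + \<bar>x\<bar>)) + t * (4 / x\<^sup>2)) \<le> C * (t * (56 / (1 + \<bar>x\<bar>)))"
      proof (rule mult_left_mono)
        have "t * (16 / (1 + \<bar>x\<bar>)) \<le> t * (56 / (1 + \<bar>x\<bar>))"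
          using t by (intro mult_left_mono divide_right_mono) auto
        moreover have "t * (8 / (1 + \<bar>x\<bar>)) + t * (8 / (1 + \<bar>x\<bar>)) = t * (16 / (1 + \<bar>x\<bar>))"
          by (simp add: distrib_left[symmetric] add_divide_distrib[symmetric])
        ultimately show "1 / x\<^sup>2 * (8 / (1 + \<bar>x\<bar>)) + t * (4 / x\<^sup>2) \<le> t * (56 / (1 + \<bar>x\<bar>))"
          using e1 e2 by linarith
      qed (use C in simp)
      ultimately show "C / x\<^sup>2 * (8 / (1 + \<bar>x\<bar>) + 4 * t) \<le> t * (56 * C / (1 + \<bar>x\<bar>))"
        by (simp add: mult_ac)
    qed
    finally show ?thesis .
  qed
  finally have "norm (LINT \<omega>|M. f \<omega>) \<le> t * (56 * C / (1 + \<bar>x\<bar>))"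
    using C t by (subst (asm) ennreal_le_iff) auto
  then show ?thesis unfolding fk(1) f_def A_def .
qed

text \<open>
  The potential has infinite expectation under the Cauchy law, so it is truncated at level \<open>K\<close>,
  to be chosen large before \<open>t\<close> is chosen small.
\<close>

lemma feynman_kac_pointwise:
  assumes p: "cauchy_path M t Y" and t: "0 < t" and \<phi> [measurable]: "\<phi> \<in> borel_measurable borel"
    and b: "\<And>z. norm (\<phi> z) \<le> C * weight z" and lip: "\<And>y z. norm (\<phi> y - \<phi> z) \<le> C * \<bar>y - z\<bar>"
    and C: "C > 0" and K: "K \<ge> 1" "x\<^sup>2 \<le> K"
  shows "norm (((LINT \<omega>|M. \<phi> (x + Y t \<omega>)) - feynman_kac M Y t \<phi> x) / of_real t - of_real (x\<^sup>2) * \<phi> x)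
    \<le> C * (8 / sqrt K + 4 * t) + C * K\<^sup>2 * t / 2 + 12 * C * K * sqrt t"
proof -
  interpret prob_space M using p by (simp add: cauchy_path_def)
  note [measurable (raw)] = cauchy_path_measurable[OF p]
  have [measurable]: "Y r \<in> borel_measurable M" for r by (rule cauchy_path_measurable'[OF p])
  have b1: "norm (\<phi> z) \<le> C" for z
    using b[of z] mult_left_mono[OF weight_le_1[of z] less_imp_le[OF C]] by simp
  note fk = feynman_kac_difference[OF p \<phi> b1, of x]
  define A where "A = (\<lambda>\<omega>. LBINT s:{0..t}. (x + Y s \<omega>)\<^sup>2)"
  define f where "f = (\<lambda>\<omega>. complex_of_real (1 - exp (- A \<omega>)) * \<phi> (x + Y t \<omega>) - of_real (t * x\<^sup>2) * \<phi> x)"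
  define h where "h = (\<lambda>s \<omega>. max 0 ((x + Y s \<omega>)\<^sup>2 - K))"
  \<comment> \<open>Its time integral over \<open>{0..t}\<close> dominates the error. In order, the
    terms account for the potential above \<open>K\<close>, the quadratic term of the exponential,
    the displacement of the endpoint, and the variation of the truncated potential along the
    path.\<close>
  define g where "g = (\<lambda>s \<omega>. C * (h s \<omega> * weight (x + Y t \<omega>)) + C * K\<^sup>2 * t / 2
      + 2 * C * K * min 1 \<bar>Y t \<omega>\<bar> + 2 * C * K * min 1 \<bar>Y s \<omega>\<bar>)"
  define I where "I = (indicator {0..t} :: real \<Rightarrow> real)"
  have I0: "I s \<ge> 0" for s by (simp add: I_def)
  have Im [measurable]: "I \<in> borel_measurable borel" unfolding I_def by measurable
  have II: "integrable lborel I" "(LINT s|lborel. I s) = t"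
    using t by (simp_all add: I_def)
  have h0: "h s \<omega> \<ge> 0" for s \<omega> by (simp add: h_def)
  have g0: "g s \<omega> \<ge> 0" for s \<omega>
    unfolding g_def using C K t h0 weight_pos[THEN less_imp_le] by simp
  \<comment> \<open>If the time integral is infinite there is nothing to show. If it is finite, its
    finiteness makes the excess \<open>h\<close> integrable along the path, so the action can be
    split.\<close>
  have pointwise: "ennreal (norm (f \<omega>)) \<le> (\<integral>\<^sup>+s. ennreal (g s \<omega>) * indicator {0..t} s \<partial>lborel)" if [measurable]: "\<omega> \<in> space M" for \<omega>
  proof (cases "(\<integral>\<^sup>+s. ennreal (g s \<omega>) * indicator {0..t} s \<partial>lborel) = \<infinity>")
    case False
    have [measurable]: "(\<lambda>s. Y s \<omega>) \<in> borel_measurable borel"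
      by (rule cauchy_path_measurable[OF p]) (use that in auto)
    have [measurable]: "(\<lambda>s. h s \<omega>) \<in> borel_measurable borel" "(\<lambda>s. g s \<omega>) \<in> borel_measurable borel"
      unfolding g_def h_def by measurable
    have eqI: "(\<integral>\<^sup>+s. ennreal (g s \<omega>) * indicator {0..t} s \<partial>lborel) = (\<integral>\<^sup>+s. ennreal (I s * g s \<omega>) \<partial>lborel)"
      by (rule nn_integral_cong) (auto simp: I_def indicator_def)
    have gi: "integrable lborel (\<lambda>s. I s * g s \<omega>)"
      by (rule integrableI_nonneg) (use False I0 g0 eqI in \<open>auto simp: less_top\<close>)
    define w where "w = weight (x + Y t \<omega>)"
    have w: "w > 0" unfolding w_def by (rule weight_pos)
    have hi: "integrable lborel (\<lambda>s. I s * h s \<omega>)"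
    proof (rule Bochner_Integration.integrable_bound)
      show "integrable lborel (\<lambda>s. (1 / (C * w)) * (I s * g s \<omega>))" using gi by simp
      have "h s \<omega> \<le> (1 / (C * w)) * g s \<omega>" for s
      proof -
        have "C * (h s \<omega> * w) \<le> g s \<omega>" unfolding g_def w_def using C K t by simp
        then show ?thesis using C w by (simp add: field_simps)
      qed
      then have "I s * h s \<omega> \<le> (1 / (C * w)) * (I s * g s \<omega>)" for s
        using mult_left_mono[OF _ I0[of s], of "h s \<omega>" "(1 / (C * w)) * g s \<omega>"] by (simp add: mult_ac)
      moreover have "norm (I s * h s \<omega>) = I s * h s \<omega>" for s using I0[of s] h0[of s] by simp
      ultimately have "norm (I s * h s \<omega>) \<le> norm ((1 / (C * w)) * (I s * g s \<omega>))" for s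
        by (metis abs_ge_self order_trans real_norm_def)
      then show "AE s in lborel. norm (I s * h s \<omega>) \<le> norm ((1 / (C * w)) * (I s * g s \<omega>))"
        by simp
    qed measurable
    have ki: "integrable lborel (\<lambda>s. I s * min ((x + Y s \<omega>)\<^sup>2) K)"
    proof (rule Bochner_Integration.integrable_bound)
      show "integrable lborel (\<lambda>s. I s * K)" using II by simp
      show "AE s in lborel. norm (I s * min ((x + Y s \<omega>)\<^sup>2) K) \<le> norm (I s * K)"
        using I0 K by (intro AE_I2) (auto simp: abs_mult intro!: mult_left_mono)
    qed measurable
    have mi: "integrable lborel (\<lambda>s. I s * min 1 \<bar>Y s \<omega>\<bar>)"
    proof (rule Bochner_Integration.integrable_bound)
      show "AE s in lborel. norm (I s * min 1 \<bar>Y s \<omega>\<bar>) \<le> norm (I s)"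
        using I0 by (intro AE_I2) (auto simp: abs_mult intro!: mult_left_le)
    qed (use II in auto)
    \<comment> \<open>\<open>a\<close> is the part of the action above the truncation level and
      \<open>k\<close> the part below; only \<open>a\<close> needs the weight at the
      endpoint.\<close>
    define a where "a = (LINT s|lborel. I s * h s \<omega>)"
    define k where "k = (LINT s|lborel. I s * min ((x + Y s \<omega>)\<^sup>2) K)"
    define m where "m = (LINT s|lborel. I s * min 1 \<bar>Y s \<omega>\<bar>)"
    have "A \<omega> = (LINT s|lborel. I s * h s \<omega> + I s * min ((x + Y s \<omega>)\<^sup>2) K)"
      unfolding A_def set_lebesgue_integral_def
      by (rule Bochner_Integration.integral_cong) (auto simp: I_def h_def indicator_def)
    then have A: "A \<omega> = a + k" unfolding a_def k_def using hi ki by simp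
    have a0: "a \<ge> 0" unfolding a_def by (rule Bochner_Integration.integral_nonneg) (use I0 h0 in simp)
    have k0: "k \<ge> 0" unfolding k_def by (rule Bochner_Integration.integral_nonneg) (use I0 K in simp)
    have kK: "k \<le> K * t"
    proof -
      have "k \<le> (LINT s|lborel. I s * K)"
        unfolding k_def by (rule Bochner_Integration.integral_mono[OF ki]) (use II I0 in \<open>auto intro!: mult_left_mono\<close>)
      then show ?thesis using II by (simp add: mult.commute)
    qed
    have kt: "\<bar>k - t * x\<^sup>2\<bar> \<le> 2 * K * m"
    proof -
      have "k - t * x\<^sup>2 = (LINT s|lborel. I s * min ((x + Y s \<omega>)\<^sup>2) K - I s * x\<^sup>2)"
        unfolding k_def using ki II by simp
      also have "\<bar>\<dots>\<bar> \<le> (LINT s|lborel. (2 * K) * (I s * min 1 \<bar>Y s \<omega>\<bar>))"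
      proof (rule integral_abs_bound_integral)
        fix s :: real
        have "\<bar>I s * min ((x + Y s \<omega>)\<^sup>2) K - I s * x\<^sup>2\<bar> = I s * \<bar>min ((x + Y s \<omega>)\<^sup>2) K - x\<^sup>2\<bar>"
          using I0[of s] by (simp add: right_diff_distrib[symmetric] abs_mult)
        also have "\<dots> \<le> I s * (2 * K * min 1 \<bar>Y s \<omega>\<bar>)"
          by (rule mult_left_mono[OF square_truncation_lipschitz[OF K] I0])
        finally show "\<bar>I s * min ((x + Y s \<omega>)\<^sup>2) K - I s * x\<^sup>2\<bar> \<le> (2 * K) * (I s * min 1 \<bar>Y s \<omega>\<bar>)"
          by (simp add: mult_ac)
      qed (use ki II mi in auto)
      also have "\<dots> = 2 * K * m" unfolding m_def by simp
      finally show ?thesis .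
    qed
    have e: "\<bar>(1 - exp (- A \<omega>)) - k\<bar> \<le> a + k\<^sup>2 / 2"
      using one_minus_exp_bounds[of k "A \<omega>"] k0 a0 A by simp
    have k2: "k\<^sup>2 / 2 \<le> K\<^sup>2 * t\<^sup>2 / 2"
      using power_mono[OF kK k0, of 2] by (simp add: power_mult_distrib)
    have d: "norm (\<phi> (x + Y t \<omega>) - \<phi> x) \<le> 2 * C * min 1 \<bar>Y t \<omega>\<bar>"
    proof -
      have "norm (\<phi> (x + Y t \<omega>) - \<phi> x) \<le> C + C"
        by (rule order_trans[OF norm_triangle_ineq4 add_mono[OF b1 b1]])
      moreover have "norm (\<phi> (x + Y t \<omega>) - \<phi> x) \<le> C * \<bar>Y t \<omega>\<bar>"
        using lip[of "x + Y t \<omega>" x] by simp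
      moreover have "C * \<bar>Y t \<omega>\<bar> \<le> 2 * C * \<bar>Y t \<omega>\<bar>" using C by simp
      ultimately show ?thesis by (cases "\<bar>Y t \<omega>\<bar> \<le> 1") (auto simp: min_def)
    qed
    \<comment> \<open>Three successive replacements: the loss by \<open>k\<close>, the endpoint
      value by \<open>\<phi> x\<close>, and \<open>k\<close> by
      \<open>t * x\<^sup>2\<close>.\<close>
    have "f \<omega> = complex_of_real ((1 - exp (- A \<omega>)) - k) * \<phi> (x + Y t \<omega>)
        + complex_of_real k * (\<phi> (x + Y t \<omega>) - \<phi> x) + complex_of_real (k - t * x\<^sup>2) * \<phi> x"
      by (simp add: f_def algebra_simps)
    also have "norm \<dots> \<le> \<bar>(1 - exp (- A \<omega>)) - k\<bar> * norm (\<phi> (x + Y t \<omega>))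
        + k * norm (\<phi> (x + Y t \<omega>) - \<phi> x) + \<bar>k - t * x\<^sup>2\<bar> * norm (\<phi> x)"
    proof -
      have tri: "norm (u + v + z) \<le> norm u + norm v + norm z" for u v z :: complex
        by (meson norm_triangle_mono norm_triangle_ineq order_refl)
      show ?thesis by (rule order_trans[OF tri]) (simp only: norm_mult norm_of_real abs_of_nonneg[OF k0] order_refl)
    qed
    also have "\<dots> \<le> (C * w * a + (C * K\<^sup>2 * t / 2) * t) + (2 * C * K * min 1 \<bar>Y t \<omega>\<bar>) * t + 2 * C * K * m"
    proof (intro add_mono)
      have "\<bar>(1 - exp (- A \<omega>)) - k\<bar> * norm (\<phi> (x + Y t \<omega>)) \<le> (a + k\<^sup>2 / 2) * norm (\<phi> (x + Y t \<omega>))"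
        by (rule mult_right_mono[OF e]) simp
      also have "\<dots> \<le> a * (C * w) + (K\<^sup>2 * t\<^sup>2 / 2) * C"
        unfolding distrib_right
        by (intro add_mono mult_mono) (use b[of "x + Y t \<omega>"] b1 a0 k2 in \<open>auto simp: w_def\<close>)
      also have "\<dots> = C * w * a + (C * K\<^sup>2 * t / 2) * t" by (simp add: power2_eq_square algebra_simps)
      finally show "\<bar>(1 - exp (- A \<omega>)) - k\<bar> * norm (\<phi> (x + Y t \<omega>)) \<le> C * w * a + (C * K\<^sup>2 * t / 2) * t" .
      have "k * norm (\<phi> (x + Y t \<omega>) - \<phi> x) \<le> (K * t) * (2 * C * min 1 \<bar>Y t \<omega>\<bar>)"
        by (rule mult_mono[OF kK d]) (use K t in auto)
      then show "k * norm (\<phi> (x + Y t \<omega>) - \<phi> x) \<le> (2 * C * K * min 1 \<bar>Y t \<omega>\<bar>) * t"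
        by (simp add: mult_ac)
      have "\<bar>k - t * x\<^sup>2\<bar> * norm (\<phi> x) \<le> (2 * K * m) * C"
        by (rule mult_mono[OF kt b1]) (use order_trans[OF abs_ge_zero kt] in auto)
      then show "\<bar>k - t * x\<^sup>2\<bar> * norm (\<phi> x) \<le> 2 * C * K * m" by (simp add: mult_ac)
    qed
    also have "\<dots> = (LINT s|lborel. I s * g s \<omega>)"
    proof -
      have "(LINT s|lborel. I s * g s \<omega>) = (LINT s|lborel. (C * w) * (I s * h s \<omega>) + (C * K\<^sup>2 * t / 2) * I s
          + (2 * C * K * min 1 \<bar>Y t \<omega>\<bar>) * I s + (2 * C * K) * (I s * min 1 \<bar>Y s \<omega>\<bar>))"
        by (rule Bochner_Integration.integral_cong) (simp_all add: g_def w_def algebra_simps)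
      also have "\<dots> = (C * w) * a + (C * K\<^sup>2 * t / 2) * t + (2 * C * K * min 1 \<bar>Y t \<omega>\<bar>) * t + (2 * C * K) * m"
      proof -
        note J = integrable_mult_right[OF hi, of "C * w"] integrable_mult_right[OF II(1), of "C * K\<^sup>2 * t / 2"]
          integrable_mult_right[OF II(1), of "2 * C * K * min 1 \<bar>Y t \<omega>\<bar>"] integrable_mult_right[OF mi, of "2 * C * K"]
        show ?thesis
          by (simp only: Bochner_Integration.integral_add[OF Bochner_Integration.integrable_add[OF Bochner_Integration.integrable_add[OF J(1,2)] J(3)] J(4)]
              Bochner_Integration.integral_add[OF Bochner_Integration.integrable_add[OF J(1,2)] J(3)]
              Bochner_Integration.integral_add[OF J(1,2)] integral_mult_right_zero II(2) a_def m_def)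
      qed
      finally show ?thesis by simp
    qed
    finally have "ennreal (norm (f \<omega>)) \<le> ennreal (LINT s|lborel. I s * g s \<omega>)" by (rule ennreal_leI)
    also have "\<dots> = (\<integral>\<^sup>+s. ennreal (I s * g s \<omega>) \<partial>lborel)"
      by (rule nn_integral_eq_integral[symmetric, OF gi]) (use I0 g0 in simp)
    finally show ?thesis unfolding eqI .
  qed simp
  \<comment> \<open>The factor 12 is twice \<open>2 * 3\<close>: two displacement terms with
    coefficient \<open>2 * C * K\<close>, each of expectation at most
    \<open>3 * sqrt t\<close>.\<close>
  define B where "B = C * (8 / sqrt K + 4 * t) + C * K\<^sup>2 * t / 2 + 12 * C * K * sqrt t"
  have B0: "B \<ge> 0" unfolding B_def using C K t by simp
  have Eg: "(\<integral>\<^sup>+\<omega>. ennreal (g s \<omega>) \<partial>M) \<le> ennreal B" if s: "0 < s" "s < t" for s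
  proof -
    have "(\<integral>\<^sup>+\<omega>. ennreal (g s \<omega>) \<partial>M) = (\<integral>\<^sup>+\<omega>. ennreal C * ennreal (h s \<omega> * weight (x + Y t \<omega>)) + ennreal (C * K\<^sup>2 * t / 2)
        + ennreal (2 * C * K) * ennreal (min 1 \<bar>Y t \<omega>\<bar>) + ennreal (2 * C * K) * ennreal (min 1 \<bar>Y s \<omega>\<bar>) \<partial>M)"
      unfolding g_def using C K t h0 weight_pos[THEN less_imp_le]
      by (intro nn_integral_cong) (simp add: ennreal_mult)
    also have "\<dots> = ennreal C * (\<integral>\<^sup>+\<omega>. ennreal (h s \<omega> * weight (x + Y t \<omega>)) \<partial>M) + ennreal (C * K\<^sup>2 * t / 2)
        + ennreal (2 * C * K) * (\<integral>\<^sup>+\<omega>. ennreal (min 1 \<bar>Y t \<omega>\<bar>) \<partial>M) + ennreal (2 * C * K) * (\<integral>\<^sup>+\<omega>. ennreal (min 1 \<bar>Y s \<omega>\<bar>) \<partial>M)"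
      unfolding h_def by (simp add: nn_integral_add nn_integral_cmult emeasure_space_1)
    also have "\<dots> \<le> ennreal C * ennreal (8 / sqrt K + 4 * t) + ennreal (C * K\<^sup>2 * t / 2)
        + ennreal (2 * C * K) * ennreal (3 * sqrt t) + ennreal (2 * C * K) * ennreal (3 * sqrt t)"
      unfolding h_def
      by (intro add_mono mult_left_mono cauchy_path_truncation_bound[OF p s] cauchy_path_min_bound[OF p]) (use s t K in auto)
    also have "\<dots> = ennreal B"
    proof -
      have "ennreal C * ennreal (8 / sqrt K + 4 * t) = ennreal (C * (8 / sqrt K + 4 * t))"
        "ennreal (2 * C * K) * ennreal (3 * sqrt t) = ennreal (2 * C * K * (3 * sqrt t))"
        by (rule ennreal_mult[symmetric]; use C K t in simp)+
      moreover have "B = C * (8 / sqrt K + 4 * t) + C * K\<^sup>2 * t / 2 + 2 * C * K * (3 * sqrt t) + 2 * C * K * (3 * sqrt t)"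
        by (simp add: B_def)
      ultimately show ?thesis using C K t by (simp only:) (simp add: ennreal_plus[symmetric] del: ennreal_plus)
    qed
    finally show ?thesis .
  qed
  have "(LINT \<omega>|M. f \<omega>) = ((LINT \<omega>|M. \<phi> (x + Y t \<omega>)) - feynman_kac M Y t \<phi> x) - of_real (t * x\<^sup>2) * \<phi> x"
    unfolding fk(1) f_def A_def using fk(3) by (subst Bochner_Integration.integral_diff) (auto simp: prob_space)
  then have eq: "((LINT \<omega>|M. \<phi> (x + Y t \<omega>)) - feynman_kac M Y t \<phi> x) / of_real t - of_real (x\<^sup>2) * \<phi> x
      = (LINT \<omega>|M. f \<omega>) / of_real t"
    using t by (simp add: field_simps)
  have "ennreal (norm (LINT \<omega>|M. f \<omega>)) \<le> (\<integral>\<^sup>+\<omega>. ennreal (norm (f \<omega>)) \<partial>M)"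
    by (rule integral_norm_bound_ennreal) (use fk(3) in \<open>simp add: f_def A_def\<close>)
  also have "\<dots> \<le> (\<integral>\<^sup>+\<omega>. (\<integral>\<^sup>+s. ennreal (g s \<omega>) * indicator {0..t} s \<partial>lborel) \<partial>M)"
    by (rule nn_integral_mono[OF pointwise])
  also have "\<dots> \<le> ennreal (t * B)"
  proof (rule cauchy_path_time_integral_bound[OF p t])
    show "(\<lambda>(s, \<omega>). ennreal (g s \<omega>)) \<in> borel_measurable (borel \<Otimes>\<^sub>M M)"
      unfolding g_def h_def case_prod_beta' by measurable
  qed (use Eg B0 in auto)
  finally have "norm (LINT \<omega>|M. f \<omega>) \<le> t * B"
    using t B0 by (subst (asm) ennreal_le_iff) auto
  then have "norm ((LINT \<omega>|M. f \<omega>) / of_real t) \<le> B"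
    using t by (simp add: norm_divide field_simps)
  then show ?thesis unfolding eq B_def .
qed

section \<open>Cauchy paths, generator and duality\<close>

lemma cauchy_path_expectation_ft:
  assumes p: "cauchy_path M t Y" and ch: "\<And>k. char (cauchy_law t) k = complex_of_real (exp (- t * \<bar>k\<bar>))"
    and t: "0 < t" and u: "integrable lborel u"
  shows "(LINT \<omega>|M. ft u (x + Y t \<omega>)) = ft (\<lambda>k. u k * exp (- t * \<bar>k\<bar>)) x"
proof -
  have [measurable]: "Y r \<in> borel_measurable M" for r by (rule cauchy_path_measurable'[OF p])
  have [measurable]: "ft u \<in> borel_measurable borel" using u by (intro ft_measurable) auto
  have "(LINT \<omega>|M. ft u (x + Y t \<omega>)) = (LINT w|distr M borel (Y t). ft u (x + w))"
    by (rule integral_distr[symmetric]) measurable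
  also have "\<dots> = (LINT w|cauchy_law t. ft u (x + w))" using p by (simp add: cauchy_path_def)
  also have "\<dots> = ft (\<lambda>k. u k * exp (- t * \<bar>k\<bar>)) x"
    by (rule expectation_ft[OF real_distribution_cauchy_law[OF t] ch u])
  finally show ?thesis .
qed

text \<open>Adding 1 puts the grid point to the right of \<open>s\<close>, the only side from which
  the paths are continuous.\<close>

lemma floor_grid_bounds:
  "s < (of_int \<lfloor>real (Suc n) * s\<rfloor> + 1) / real (Suc n)"
  "(of_int \<lfloor>real (Suc n) * s\<rfloor> + 1) / real (Suc n) \<le> s + 1 / real (Suc n)"
proof -
  have "real (Suc n) * s < of_int \<lfloor>real (Suc n) * s\<rfloor> + 1" by linarith
  then show "s < (of_int \<lfloor>real (Suc n) * s\<rfloor> + 1) / real (Suc n)"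
    by (simp add: pos_less_divide_eq mult.commute)
  have "of_int \<lfloor>real (Suc n) * s\<rfloor> + 1 \<le> real (Suc n) * s + 1" by linarith
  then have "(of_int \<lfloor>real (Suc n) * s\<rfloor> + 1) / real (Suc n) \<le> (real (Suc n) * s + 1) / real (Suc n)"
    by (rule divide_right_mono) simp
  also have "\<dots> = s + 1 / real (Suc n)" by (simp add: add_divide_distrib)
  finally show "(of_int \<lfloor>real (Suc n) * s\<rfloor> + 1) / real (Suc n) \<le> s + 1 / real (Suc n)" .
qed

section \<open>The process and its time reversal as Cauchy paths\<close>

context cauchy_process
begin

lemma real_distribution_X: "0 \<le> t \<Longrightarrow> real_distribution (distr M borel (X t))"
  using random_variable by (intro real_distribution_distr) auto

lemma distr_X: "0 < t \<Longrightarrow> distr M borel (X t) = cauchy_law t"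
  using characteristic_function by (intro cauchy_law_unique real_distribution_X) auto

text \<open>The process itself evaluates the transform of the Cauchy density: a variable with this
  characteristic function exists, and by \<open>cauchy_law_unique\<close> its law has that
  density.\<close>

lemma char_cauchy_law: "0 < t \<Longrightarrow> char (cauchy_law t) k = complex_of_real (exp (- t * \<bar>k\<bar>))"
  using distr_X[of t] characteristic_function[of t k] by simp

lemma distr_uminus_cauchy:
  assumes t: "0 < t" and [measurable]: "Z \<in> borel_measurable M" and Z: "distr M borel Z = cauchy_law t"
  shows "distr M borel (\<lambda>\<omega>. - Z \<omega>) = cauchy_law t"
proof (rule cauchy_law_unique[OF _ _ t])
  show "real_distribution (distr M borel (\<lambda>\<omega>. - Z \<omega>))"
    by (rule real_distribution_distr) measurable
  fix k
  have "char (distr M borel (\<lambda>\<omega>. - Z \<omega>)) k = char (distr M borel Z) (- k)"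
    by (simp add: char_def integral_distr)
  then show "char (distr M borel (\<lambda>\<omega>. - Z \<omega>)) k = complex_of_real (exp (- t * \<bar>k\<bar>))"
    unfolding Z using char_cauchy_law[OF t, of "- k"] by simp
qed

text \<open>Freezing the path before time \<open>0\<close> allows joint measurability to be stated on all of \<open>R\<close>.\<close>

definition path :: "real \<Rightarrow> 'w \<Rightarrow> real" where "path s \<omega> = X (max 0 s) \<omega>"

text \<open>With time rounded up to a grid only countably many variables occur, so every
  approximation is jointly measurable; right continuity on all of \<open>space M\<close> gives the
  pointwise limit.\<close>

lemma path_measurable: "(\<lambda>p. path (fst p) (snd p)) \<in> borel_measurable (borel \<Otimes>\<^sub>M M)"
proof (rule borel_measurable_LIMSEQ_real)
  define r where "r = (\<lambda>(n::nat) s::real. (of_int \<lfloor>real (Suc n) * s\<rfloor> + 1) / real (Suc n))"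
  show "(\<lambda>p. path (r n (fst p)) (snd p)) \<in> borel_measurable (borel \<Otimes>\<^sub>M M)" for n
  proof -
    have "(\<lambda>p. X (max 0 ((of_int \<lfloor>real (Suc n) * fst p\<rfloor> + 1) / real (Suc n))) (snd p)) \<in> borel_measurable (borel \<Otimes>\<^sub>M M)"
    proof (rule measurable_compose_countable[where f = "\<lambda>i p. X (max 0 ((of_int i + 1) / real (Suc n))) (snd p)"])
      fix i :: int
      have [measurable]: "X (max 0 ((of_int i + 1) / real (Suc n))) \<in> borel_measurable M"
        by (rule random_variable) simp
      show "(\<lambda>p. X (max 0 ((of_int i + 1) / real (Suc n))) (snd p)) \<in> borel_measurable (borel \<Otimes>\<^sub>M M)"
        by measurable
      show "(\<lambda>p. \<lfloor>real (Suc n) * fst p\<rfloor>) \<in> measurable (borel \<Otimes>\<^sub>M M) (count_space UNIV)"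
        by (rule measurable_compose[OF _ measurable_real_floor]) measurable
    qed
    then show ?thesis by (simp add: r_def path_def)
  qed
  fix p :: "real \<times> 'w" assume "p \<in> space (borel \<Otimes>\<^sub>M M)"
  then have w: "snd p \<in> space M" by (auto simp: space_pair_measure)
  define s where "s = max 0 (fst p)"
  have r: "fst p < r n (fst p)" "r n (fst p) \<le> fst p + 1 / real (Suc n)" for n
    unfolding r_def by (rule floor_grid_bounds)+
  have "(\<lambda>n. r n (fst p)) \<longlonglongrightarrow> fst p"
  proof (rule real_tendsto_sandwich[where f = "\<lambda>_. fst p" and h = "\<lambda>n. fst p + 1 / real (Suc n)"])
    show "(\<lambda>n. fst p + 1 / real (Suc n)) \<longlonglongrightarrow> fst p"
      using tendsto_add[OF tendsto_const[of "fst p"] LIMSEQ_inverse_real_of_nat] by (simp add: inverse_eq_divide)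
  qed (use r in \<open>auto intro!: always_eventually less_imp_le\<close>)
  then have lim: "(\<lambda>n. max 0 (r n (fst p))) \<longlonglongrightarrow> s" unfolding s_def by (intro tendsto_intros)
  have ge: "s \<le> max 0 (r n (fst p))" for n using r(1)[of n] by (simp add: s_def max_def)
  have "continuous (at s within {s..}) (\<lambda>v. X v (snd p))"
    unfolding at_within_Ici_at_right by (rule right_continuous[OF _ w]) (simp add: s_def)
  then have "(\<lambda>n. X (max 0 (r n (fst p))) (snd p)) \<longlonglongrightarrow> X s (snd p)"
    by (rule continuous_within_tendsto_compose) (use ge lim in auto)
  then show "(\<lambda>n. path (r n (fst p)) (snd p)) \<longlonglongrightarrow> path (fst p) (snd p)"
    by (simp add: path_def s_def)
qed

lemma indep_increments_two:
  assumes s: "0 \<le> s" "s \<le> t"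
  shows "indep_var borel (\<lambda>\<omega>. X s \<omega> - X 0 \<omega>) borel (\<lambda>\<omega>. X t \<omega> - X s \<omega>)"
    and "indep_var borel (\<lambda>\<omega>. X t \<omega> - X s \<omega>) borel (\<lambda>\<omega>. X s \<omega> - X 0 \<omega>)"
proof -
  define r where "r = (\<lambda>i::nat. if i = 0 then 0 else if i = 1 then s else t)"
  have iv: "indep_vars (\<lambda>_. borel) (\<lambda>i \<omega>. X (r (Suc i)) \<omega> - X (r i) \<omega>) {..<2}"
    by (rule indep_increments) (use s in \<open>auto simp: r_def\<close>)
  \<comment> \<open>The two-point index set is written in both orders because
    \<open>indep_vars_sum\<close> separates the inserted index from the sum over the rest, here a
    single increment.\<close>
  have e1: "{..<2} = insert 0 {1::nat}" and e2: "{..<2} = insert 1 {0::nat}" by auto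
  note 1 = iv[unfolded e1] and 2 = iv[unfolded e2]
  show "indep_var borel (\<lambda>\<omega>. X s \<omega> - X 0 \<omega>) borel (\<lambda>\<omega>. X t \<omega> - X s \<omega>)"
    using indep_vars_sum[OF _ _ 1] by (simp add: r_def)
  show "indep_var borel (\<lambda>\<omega>. X t \<omega> - X s \<omega>) borel (\<lambda>\<omega>. X s \<omega> - X 0 \<omega>)"
    using indep_vars_sum[OF _ _ 2] by (simp add: r_def)
qed

lemma distr_increment:
  assumes "0 \<le> s" "s < t"
  shows "distr M borel (\<lambda>\<omega>. X t \<omega> - X s \<omega>) = cauchy_law (t - s)"
  using stationary_increments[of s "t - s"] distr_X[of "t - s"] assms by simp

lemma forward_path:
  assumes t: "0 < t"
  shows "cauchy_path M t path"
proof -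
  have "distr M borel (path t) = cauchy_law t"
    using distr_X[OF t] t by (simp add: path_def[abs_def])
  moreover have "distr M (borel \<Otimes>\<^sub>M borel) (\<lambda>\<omega>. (path s \<omega>, path t \<omega> - path s \<omega>)) = cauchy_law s \<Otimes>\<^sub>M cauchy_law (t - s)"
    if s: "0 < s" "s < t" for s
  proof -
    have [measurable]: "X 0 \<in> borel_measurable M" "X s \<in> borel_measurable M" "X t \<in> borel_measurable M"
      using random_variable s by auto
    have "distr M (borel \<Otimes>\<^sub>M borel) (\<lambda>\<omega>. (path s \<omega>, path t \<omega> - path s \<omega>))
        = distr M (borel \<Otimes>\<^sub>M borel) (\<lambda>\<omega>. (X s \<omega> - X 0 \<omega>, X t \<omega> - X s \<omega>))"
    proof (rule distr_cong_AE)
      show "AE \<omega> in M. (path s \<omega>, path t \<omega> - path s \<omega>) = (X s \<omega> - X 0 \<omega>, X t \<omega> - X s \<omega>)"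
        using start by eventually_elim (use s in \<open>simp add: path_def\<close>)
      show "(\<lambda>\<omega>. (path s \<omega>, path t \<omega> - path s \<omega>)) \<in> measurable M (borel \<Otimes>\<^sub>M borel)"
        using s t by (simp add: path_def)
    qed (auto intro!: measurable_Pair)
    also have "\<dots> = distr M borel (\<lambda>\<omega>. X s \<omega> - X 0 \<omega>) \<Otimes>\<^sub>M distr M borel (\<lambda>\<omega>. X t \<omega> - X s \<omega>)"
      using indep_increments_two(1)[of s t] s unfolding indep_var_distribution_eq by simp
    also have "\<dots> = cauchy_law s \<Otimes>\<^sub>M cauchy_law (t - s)"
      using distr_increment[of 0 s] distr_increment[of s t] s by simp
    finally show ?thesis .
  qed
  ultimately show ?thesis unfolding cauchy_path_def using path_measurable prob_space_axioms by blast
qed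

definition reversed :: "real \<Rightarrow> real \<Rightarrow> 'w \<Rightarrow> real" where
  "reversed t s \<omega> = path (t - s) \<omega> - path t \<omega>"

lemma path_measurable_compose:
  assumes [measurable]: "f \<in> borel_measurable N" "g \<in> measurable N M"
  shows "(\<lambda>x. path (f x) (g x)) \<in> borel_measurable N"
proof -
  have "(\<lambda>x. (f x, g x)) \<in> measurable N (borel \<Otimes>\<^sub>M M)" by measurable
  from measurable_compose[OF this path_measurable] show ?thesis by simp
qed

text \<open>The increments of the reversed path are the negated increments of \<open>X\<close> in
  the opposite order. Independence survives the exchange, and the Cauchy law is symmetric.\<close>

lemma reversed_path:
  assumes t: "0 < t"
  shows "cauchy_path M t (reversed t)"
proof -
  note [measurable (raw)] = path_measurable_compose
  have [measurable]: "X 0 \<in> borel_measurable M" "X t \<in> borel_measurable M"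
    using random_variable t by auto
  have "distr M borel (reversed t t) = distr M borel (\<lambda>\<omega>. - X t \<omega>)"
  proof (rule distr_cong_AE)
    show "AE \<omega> in M. reversed t t \<omega> = - X t \<omega>"
      using start by eventually_elim (use t in \<open>simp add: reversed_def path_def\<close>)
    show "reversed t t \<in> borel_measurable M" unfolding reversed_def[abs_def] by measurable
  qed auto
  then have 1: "distr M borel (reversed t t) = cauchy_law t"
    using distr_uminus_cauchy[OF t _ distr_X[OF t]] by simp
  have 2: "distr M (borel \<Otimes>\<^sub>M borel) (\<lambda>\<omega>. (reversed t s \<omega>, reversed t t \<omega> - reversed t s \<omega>)) = cauchy_law s \<Otimes>\<^sub>M cauchy_law (t - s)"
    if s: "0 < s" "s < t" for s
  proof -
    define r where "r = t - s"
    have r: "0 < r" "r < t" using s by (auto simp: r_def)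
    have [measurable]: "X r \<in> borel_measurable M" using random_variable r by auto
    have iv: "indep_var borel (\<lambda>\<omega>. X t \<omega> - X r \<omega>) borel (\<lambda>\<omega>. X r \<omega> - X 0 \<omega>)"
      by (rule indep_increments_two(2)) (use r in auto)
    have "indep_var borel (uminus \<circ> (\<lambda>\<omega>. X t \<omega> - X r \<omega>)) borel (uminus \<circ> (\<lambda>\<omega>. X r \<omega> - X 0 \<omega>))"
      by (rule indep_var_compose[OF iv]) auto
    then have iv2: "indep_var borel (\<lambda>\<omega>. - (X t \<omega> - X r \<omega>)) borel (\<lambda>\<omega>. - (X r \<omega> - X 0 \<omega>))"
      by (simp only: comp_def)
    have "distr M (borel \<Otimes>\<^sub>M borel) (\<lambda>\<omega>. (reversed t s \<omega>, reversed t t \<omega> - reversed t s \<omega>))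
        = distr M (borel \<Otimes>\<^sub>M borel) (\<lambda>\<omega>. (- (X t \<omega> - X r \<omega>), - (X r \<omega> - X 0 \<omega>)))"
      using r s t by (intro distr_cong) (auto simp: reversed_def path_def r_def)
    also have "\<dots> = distr M borel (\<lambda>\<omega>. - (X t \<omega> - X r \<omega>)) \<Otimes>\<^sub>M distr M borel (\<lambda>\<omega>. - (X r \<omega> - X 0 \<omega>))"
      using iv2 unfolding indep_var_distribution_eq by simp
    also have "distr M borel (\<lambda>\<omega>. - (X t \<omega> - X r \<omega>)) = cauchy_law s"
    proof (rule distr_uminus_cauchy[OF s(1)])
      have "t - r = s" by (simp add: r_def)
      then show "distr M borel (\<lambda>\<omega>. X t \<omega> - X r \<omega>) = cauchy_law s"
        using distr_increment[of r t] r by simp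
    qed measurable
    also have "distr M borel (\<lambda>\<omega>. - (X r \<omega> - X 0 \<omega>)) = cauchy_law r"
      by (rule distr_uminus_cauchy[OF r(1)]) (use distr_increment[of 0 r] r in auto)
    finally show ?thesis by (simp only: r_def)
  qed
  have "(\<lambda>p. reversed t (fst p) (snd p)) \<in> borel_measurable (borel \<Otimes>\<^sub>M M)"
    unfolding reversed_def by measurable
  with 1 2 show ?thesis unfolding cauchy_path_def using prob_space_axioms by blast
qed

lemma feynman_kac_path:
  assumes "0 \<le> t"
  shows "feynman_kac M X t f x = feynman_kac M path t f x"
proof -
  have "(LBINT s:{0..t}. (x + X s \<omega>)\<^sup>2) = (LBINT s:{0..t}. (x + path s \<omega>)\<^sup>2)" for \<omega>
    by (rule set_lebesgue_integral_cong) (auto simp: path_def)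
  then show ?thesis using assms by (simp add: feynman_kac_def path_def)
qed

end

section \<open>The generator on transforms of profiles\<close>

lemma feynman_kac_measurable:
  assumes p: "cauchy_path M t Y" and [measurable]: "\<phi> \<in> borel_measurable borel"
  shows "(\<lambda>x. feynman_kac M Y t \<phi> x) \<in> borel_measurable borel"
proof -
  interpret prob_space M using p by (simp add: cauchy_path_def)
  note [measurable (raw)] = cauchy_path_measurable[OF p]
  show ?thesis unfolding feynman_kac_def set_lebesgue_integral_def by measurable
qed

lemma ft_hamiltonian_symbol:
  assumes p: "profile u u' u''"
  shows "ft (\<lambda>k. \<bar>k\<bar> * u k - u'' k) x = ft (\<lambda>k. \<bar>k\<bar> * u k) x + of_real (x\<^sup>2) * ft u x"
  unfolding ft_diff[OF profile_abs_mult_integrable[OF p] profile_integrable(3)[OF p]] ft_profile_second[OF p]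
  by simp

lemma ft_profile_measurable: "profile u u' u'' \<Longrightarrow> ft u \<in> borel_measurable borel"
  by (rule ft_measurable) (rule profile_measurable)

context cauchy_process
begin

text \<open>The error falls into a free part, estimated in momentum space, and a potential part,
  estimated along paths.\<close>

lemma generator_split:
  assumes p: "profile u u' u''" and t: "0 < t" and Y: "cauchy_path M t Y"
  shows "(ft u x - feynman_kac M Y t (ft u) x) / of_real t - ft (\<lambda>k. \<bar>k\<bar> * u k - u'' k) x
    = ft (\<lambda>k. u k * ((1 - exp (- t * \<bar>k\<bar>)) / t - \<bar>k\<bar>)) x
      + (((LINT \<omega>|M. ft u (x + Y t \<omega>)) - feynman_kac M Y t (ft u) x) / of_real t - of_real (x\<^sup>2) * ft u x)"
proof -
  note iu = profile_integrable(1)[OF p] and iau = profile_abs_mult_integrable[OF p]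
  have ie: "integrable lborel (\<lambda>k. u k * exp (- t * \<bar>k\<bar>))"
    by (rule Bochner_Integration.integrable_bound[OF iu])
       (use profile_measurable[OF p] t in \<open>auto simp: abs_mult mult_left_le\<close>)
  have "ft (\<lambda>k. u k * ((1 - exp (- t * \<bar>k\<bar>)) / t - \<bar>k\<bar>)) x
      = ft (\<lambda>k. (1 / t) * (u k - u k * exp (- t * \<bar>k\<bar>)) - \<bar>k\<bar> * u k) x"
    by (rule arg_cong[where f = "\<lambda>g. ft g x"]) (auto simp: algebra_simps diff_divide_distrib)
  also have "\<dots> = ft (\<lambda>k. (1 / t) * (u k - u k * exp (- t * \<bar>k\<bar>))) x - ft (\<lambda>k. \<bar>k\<bar> * u k) x"
    by (rule ft_diff) (use iu ie iau in auto)
  also have "ft (\<lambda>k. (1 / t) * (u k - u k * exp (- t * \<bar>k\<bar>))) x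
      = of_real (1 / t) * (ft u x - ft (\<lambda>k. u k * exp (- t * \<bar>k\<bar>)) x)"
    unfolding ft_cmult ft_diff[OF iu ie] ..
  also have "ft (\<lambda>k. u k * exp (- t * \<bar>k\<bar>)) x = (LINT \<omega>|M. ft u (x + Y t \<omega>))"
    by (rule cauchy_path_expectation_ft[OF Y char_cauchy_law[OF t] t iu, symmetric])
  finally show ?thesis
    unfolding ft_hamiltonian_symbol[OF p] using t by (simp add: field_simps)
qed

text \<open>The first bound is the square integrable majorant, the second gives convergence at each
  point. Both are uniform over all Cauchy paths, so that one constant serves the process and its
  reversals at every horizon.\<close>

lemma generator_bounds:
  assumes p: "profile u u' u''"
  obtains C where "C > 0"
    "\<And>t Y x. 0 < t \<Longrightarrow> t \<le> 1 \<Longrightarrow> cauchy_path M t Y \<Longrightarrow>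
      norm ((ft u x - feynman_kac M Y t (ft u) x) / of_real t - ft (\<lambda>k. \<bar>k\<bar> * u k - u'' k) x) \<le> C / (1 + \<bar>x\<bar>)"
    "\<And>t Y x K. 0 < t \<Longrightarrow> cauchy_path M t Y \<Longrightarrow> K \<ge> 1 \<Longrightarrow> x\<^sup>2 \<le> K \<Longrightarrow>
      norm ((ft u x - feynman_kac M Y t (ft u) x) / of_real t - ft (\<lambda>k. \<bar>k\<bar> * u k - u'' k) x)
        \<le> C * t + (C * (8 / sqrt K + 4 * t) + C * K\<^sup>2 * t / 2 + 12 * C * K * sqrt t)"
proof -
  obtain C1 where C1: "C1 > 0" "\<And>x. norm (ft u x) \<le> C1 / (1 + \<bar>x\<bar>) ^ 3"
    using ft_profile_decay[OF p] by blast
  obtain C2 where C2: "C2 > 0" "\<And>x y. norm (ft u x - ft u y) \<le> C2 * \<bar>x - y\<bar>"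
    using ft_profile_lipschitz[OF p] by blast
  obtain C3 where C3: "C3 > 0"
    "\<And>t x. 0 < t \<Longrightarrow> norm (ft (\<lambda>k. u k * ((1 - exp (- t * \<bar>k\<bar>)) / t - \<bar>k\<bar>)) x) \<le> C3 * t / (1 + \<bar>x\<bar>)"
    using ft_profile_generator_error[OF p] by blast
  define C0 where "C0 = C1 + C2"
  \<comment> \<open>57 = 56 + 1: the bound of \<open>feynman_kac_dominated\<close> and the term
    \<open>x\<^sup>2 * ft u x\<close>; \<open>C3\<close> belongs to the free part.\<close>
  define C where "C = 57 * C0 + C3"
  have C0: "C0 > 0" using C1 C2 by (simp add: C0_def)
  have C: "C > 0" "C3 \<le> C" "C0 \<le> C" using C0 C3 by (auto simp: C_def)
  have m: "ft u \<in> borel_measurable borel" by (rule ft_profile_measurable[OF p])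
  have b: "norm (ft u z) \<le> C0 * weight z" for z
  proof -
    have "C1 * weight z \<le> C0 * weight z"
      by (rule mult_right_mono) (use C2 weight_pos[of z] in \<open>auto simp: C0_def\<close>)
    then show ?thesis using C1(2)[of z] by (simp add: weight_def)
  qed
  have lip: "norm (ft u y - ft u z) \<le> C0 * \<bar>y - z\<bar>" for y z
  proof -
    have "C2 * \<bar>y - z\<bar> \<le> C0 * \<bar>y - z\<bar>" by (rule mult_right_mono) (use C1 in \<open>auto simp: C0_def\<close>)
    then show ?thesis using C2(2)[of y z] by linarith
  qed
  show ?thesis
  proof (rule that[OF C(1)])
    fix t Y x assume t: "0 < t" "t \<le> 1" and Y: "cauchy_path M t Y"
    have "norm (ft (\<lambda>k. u k * ((1 - exp (- t * \<bar>k\<bar>)) / t - \<bar>k\<bar>)) x) \<le> C3 / (1 + \<bar>x\<bar>)"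
    proof -
      have "C3 * t / (1 + \<bar>x\<bar>) \<le> C3 * 1 / (1 + \<bar>x\<bar>)"
        by (intro divide_right_mono mult_left_mono) (use t C3 in auto)
      then show ?thesis using C3(2)[OF t(1), of x] by simp
    qed
    moreover have "norm (((LINT \<omega>|M. ft u (x + Y t \<omega>)) - feynman_kac M Y t (ft u) x) / of_real t) \<le> 56 * C0 / (1 + \<bar>x\<bar>)"
    proof -
      have "norm ((LINT \<omega>|M. ft u (x + Y t \<omega>)) - feynman_kac M Y t (ft u) x) \<le> t * (56 * C0 / (1 + \<bar>x\<bar>))"
        by (rule feynman_kac_dominated[OF Y t m b C0])
      then show ?thesis using t by (simp add: norm_divide pos_divide_le_eq mult.commute)
    qed
    moreover have "norm (of_real (x\<^sup>2) * ft u x) \<le> C0 / (1 + \<bar>x\<bar>)"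
    proof -
      have "x\<^sup>2 \<le> (1 + \<bar>x\<bar>)\<^sup>2" by (simp add: power2_sum)
      then have "x\<^sup>2 * norm (ft u x) \<le> (1 + \<bar>x\<bar>)\<^sup>2 * (C0 * weight x)"
        by (intro mult_mono b) auto
      also have "\<dots> = C0 / (1 + \<bar>x\<bar>)"
      proof -
        have "1 + \<bar>x\<bar> > 0" by simp
        then show ?thesis by (simp add: weight_def power2_eq_square power3_eq_cube)
      qed
      finally show ?thesis by (simp add: norm_mult norm_power)
    qed
    moreover have "norm (a + (b - c)) \<le> norm a + norm b + norm c" for a b c :: complex
      using norm_triangle_ineq[of a "b - c"] norm_triangle_ineq4[of b c] by linarith
    ultimately have "norm ((ft u x - feynman_kac M Y t (ft u) x) / of_real t - ft (\<lambda>k. \<bar>k\<bar> * u k - u'' k) x)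
        \<le> C3 / (1 + \<bar>x\<bar>) + 56 * C0 / (1 + \<bar>x\<bar>) + C0 / (1 + \<bar>x\<bar>)"
      unfolding generator_split[OF p t(1) Y] by (smt (verit))
    also have "\<dots> = C / (1 + \<bar>x\<bar>)" by (simp add: C_def add_divide_distrib[symmetric])
    finally show "norm ((ft u x - feynman_kac M Y t (ft u) x) / of_real t - ft (\<lambda>k. \<bar>k\<bar> * u k - u'' k) x) \<le> C / (1 + \<bar>x\<bar>)" .
  next
    fix t Y and x K :: real assume t: "0 < t" and Y: "cauchy_path M t Y" and K: "K \<ge> 1" "x\<^sup>2 \<le> K"
    have "norm (ft (\<lambda>k. u k * ((1 - exp (- t * \<bar>k\<bar>)) / t - \<bar>k\<bar>)) x) \<le> C * t"
    proof -
      have "C3 * t / (1 + \<bar>x\<bar>) \<le> C3 * t / 1"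
        by (intro divide_left_mono) (use t C3 in auto)
      also have "\<dots> \<le> C * t" using C t by simp
      finally show ?thesis using C3(2)[OF t, of x] by linarith
    qed
    moreover have "norm (((LINT \<omega>|M. ft u (x + Y t \<omega>)) - feynman_kac M Y t (ft u) x) / of_real t - of_real (x\<^sup>2) * ft u x)
        \<le> C * (8 / sqrt K + 4 * t) + C * K\<^sup>2 * t / 2 + 12 * C * K * sqrt t"
    proof (rule feynman_kac_pointwise[OF Y t m _ _ C(1) K])
      show "norm (ft u z) \<le> C * weight z" for z
        using b[of z] mult_right_mono[OF C(3) less_imp_le[OF weight_pos[of z]]] by linarith
      show "norm (ft u y - ft u z) \<le> C * \<bar>y - z\<bar>" for y z
        using lip[of y z] mult_right_mono[OF C(3) abs_ge_zero[of "y - z"]] by linarith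
    qed
    ultimately show "norm ((ft u x - feynman_kac M Y t (ft u) x) / of_real t - ft (\<lambda>k. \<bar>k\<bar> * u k - u'' k) x)
        \<le> C * t + (C * (8 / sqrt K + 4 * t) + C * K\<^sup>2 * t / 2 + 12 * C * K * sqrt t)"
      unfolding generator_split[OF p t Y] by (rule norm_triangle_mono)
  qed
qed

text \<open>Dominated convergence along sequences. The path may depend on the horizon
  \<open>t\<close>, as the reversed one does.\<close>

lemma generator_L2_limit:
  assumes p: "profile u u' u''" and Y: "\<And>t. 0 < t \<Longrightarrow> cauchy_path M t (Y t)"
  shows "((\<lambda>t. \<integral>\<^sup>+x. ennreal ((norm ((ft u x - feynman_kac M (Y t) t (ft u) x) / of_real t
      - ft (\<lambda>k. \<bar>k\<bar> * u k - u'' k) x))\<^sup>2) \<partial>lborel) \<longlongrightarrow> 0) (at_right 0)"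
proof -
  obtain C where C: "C > 0"
    and dom: "\<And>t Y x. 0 < t \<Longrightarrow> t \<le> 1 \<Longrightarrow> cauchy_path M t Y \<Longrightarrow>
      norm ((ft u x - feynman_kac M Y t (ft u) x) / of_real t - ft (\<lambda>k. \<bar>k\<bar> * u k - u'' k) x) \<le> C / (1 + \<bar>x\<bar>)"
    and pt: "\<And>t Y x K. 0 < t \<Longrightarrow> cauchy_path M t Y \<Longrightarrow> K \<ge> 1 \<Longrightarrow> x\<^sup>2 \<le> K \<Longrightarrow>
      norm ((ft u x - feynman_kac M Y t (ft u) x) / of_real t - ft (\<lambda>k. \<bar>k\<bar> * u k - u'' k) x)
        \<le> C * t + (C * (8 / sqrt K + 4 * t) + C * K\<^sup>2 * t / 2 + 12 * C * K * sqrt t)"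
    using generator_bounds[OF p] by blast
  define D where "D = (\<lambda>t x. (ft u x - feynman_kac M (Y t) t (ft u) x) / of_real t - ft (\<lambda>k. \<bar>k\<bar> * u k - u'' k) x)"
  have [measurable]: "ft u \<in> borel_measurable borel" by (rule ft_profile_measurable[OF p])
  have [measurable]: "ft (\<lambda>k. \<bar>k\<bar> * u k - u'' k) \<in> borel_measurable borel"
    by (rule ft_measurable) (use profile_measurable[OF p] in measurable)
  have Dm [measurable]: "D t \<in> borel_measurable borel" if "0 < t" for t
  proof -
    have [measurable]: "(\<lambda>x. feynman_kac M (Y t) t (ft u) x) \<in> borel_measurable borel"
      by (rule feynman_kac_measurable[OF Y[OF that]]) measurable
    show ?thesis unfolding D_def by measurable
  qed
  have lim: "((\<lambda>t. norm (D t x)) \<longlongrightarrow> 0) (at_right 0)" for x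
  proof (rule tendstoI)
    fix e :: real assume e: "e > 0"
    \<comment> \<open>Makes \<open>C * (8 / sqrt K)\<close> at most \<open>e / 2\<close>; the
      remaining terms vanish with \<open>t\<close> once \<open>K\<close> is fixed.\<close>
    define K where "K = max 1 (max (x\<^sup>2) ((16 * C / e)\<^sup>2))"
    have K: "K \<ge> 1" "x\<^sup>2 \<le> K" "(16 * C / e)\<^sup>2 \<le> K" by (auto simp: K_def)
    have sK: "16 * C / e \<le> sqrt K" using real_sqrt_le_mono[OF K(3)] C e by simp
    have "sqrt K > 0" using K by simp
    then have small: "C * (8 / sqrt K) < e" using sK C e by (simp add: field_simps)
    have "((\<lambda>t. C * t + (C * (8 / sqrt K + 4 * t) + C * K\<^sup>2 * t / 2 + 12 * C * K * sqrt t)) \<longlongrightarrow>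
        C * 0 + (C * (8 / sqrt K + 4 * 0) + C * K\<^sup>2 * 0 / 2 + 12 * C * K * sqrt 0)) (at_right 0)"
      by (intro tendsto_intros) auto
    then have "\<forall>\<^sub>F t in at_right 0. C * t + (C * (8 / sqrt K + 4 * t) + C * K\<^sup>2 * t / 2 + 12 * C * K * sqrt t) < e"
      by (rule order_tendstoD) (use small in simp)
    then show "\<forall>\<^sub>F t in at_right 0. dist (norm (D t x)) 0 < e"
      using eventually_at_right_less[of "0::real"]
    proof eventually_elim
      case (elim t)
      have "norm (D t x) \<le> C * t + (C * (8 / sqrt K + 4 * t) + C * K\<^sup>2 * t / 2 + 12 * C * K * sqrt t)"
        unfolding D_def by (rule pt[OF elim(2) Y[OF elim(2)] K(1,2)])
      then show ?case using elim(1) by simp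
    qed
  qed
  have "((\<lambda>t. \<integral>\<^sup>+x. ennreal ((norm (D t x))\<^sup>2) \<partial>lborel) \<longlongrightarrow> 0) (at_right 0)"
  proof (rule tendsto_at_right_sequentially[of 0 1])
    fix S :: "nat \<Rightarrow> real" assume S: "\<And>n. 0 < S n" "\<And>n. S n < 1" "S \<longlonglongrightarrow> 0"
    have fS: "filterlim S (at_right 0) sequentially"
      unfolding filterlim_at using S(1,3) by (auto intro!: always_eventually simp: less_le)
    have "(\<lambda>n. \<integral>\<^sup>+x. ennreal ((norm (D (S n) x))\<^sup>2) \<partial>lborel) \<longlonglongrightarrow> integral\<^sup>N lborel (\<lambda>x::real. 0)"
    proof (rule nn_integral_dominated_convergence[where w = "\<lambda>x::real. ennreal (C\<^sup>2 * (1 / (1 + \<bar>x\<bar>)\<^sup>2))"])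
      show "(\<lambda>x. ennreal ((norm (D (S n) x))\<^sup>2)) \<in> borel_measurable lborel" for n
        using Dm[OF S(1)[of n]] by measurable
      show "AE x in lborel. ennreal ((norm (D (S n) x))\<^sup>2) \<le> ennreal (C\<^sup>2 * (1 / (1 + \<bar>x\<bar>)\<^sup>2))" for n
      proof (intro AE_I2 ennreal_leI)
        fix x
        have "norm (D (S n) x) \<le> C / (1 + \<bar>x\<bar>)"
          unfolding D_def by (rule dom[OF S(1) less_imp_le[OF S(2)] Y[OF S(1)]])
        from power_mono[OF this norm_ge_zero, of 2]
        show "(norm (D (S n) x))\<^sup>2 \<le> C\<^sup>2 * (1 / (1 + \<bar>x\<bar>)\<^sup>2)" by (simp add: power_divide)
      qed
      have "(\<integral>\<^sup>+x. ennreal (C\<^sup>2 * (1 / (1 + \<bar>x\<bar>)\<^sup>2)) \<partial>lborel) = ennreal (LINT x|lborel. C\<^sup>2 * (1 / (1 + \<bar>x::real\<bar>)\<^sup>2))"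
        by (rule nn_integral_eq_integral[OF integrable_mult_right[OF integrable_inverse_square]]) simp
      then show "(\<integral>\<^sup>+x. ennreal (C\<^sup>2 * (1 / (1 + \<bar>x\<bar>)\<^sup>2)) \<partial>lborel) < \<infinity>" by simp
      show "AE x in lborel. (\<lambda>n. ennreal ((norm (D (S n) x))\<^sup>2)) \<longlonglongrightarrow> 0"
      proof (rule AE_I2)
        fix x
        have "(\<lambda>n. norm (D (S n) x)) \<longlonglongrightarrow> 0" by (rule filterlim_compose[OF lim fS])
        then have "(\<lambda>n. (norm (D (S n) x))\<^sup>2) \<longlonglongrightarrow> 0\<^sup>2" by (rule tendsto_power)
        from tendsto_ennrealI[OF this] show "(\<lambda>n. ennreal ((norm (D (S n) x))\<^sup>2)) \<longlonglongrightarrow> 0" by simp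
      qed
    qed measurable
    then show "(\<lambda>n. \<integral>\<^sup>+x. ennreal ((norm (D (S n) x))\<^sup>2) \<partial>lborel) \<longlonglongrightarrow> 0" by simp
  qed simp
  then show ?thesis by (simp only: D_def)
qed

end

section \<open>Pairings in L2 and duality of Feynman-Kac operators\<close>

lemma norm_mult_le_squares:
  fixes a b :: complex
  assumes d: "d > 0"
  shows "norm (a * b) \<le> (1 / d) * (norm a)\<^sup>2 + d * (norm b)\<^sup>2"
proof -
  have "0 \<le> (norm a - d * norm b)\<^sup>2 + (norm a)\<^sup>2 + (d * norm b)\<^sup>2" by simp
  then have "d * (norm a * norm b) \<le> (norm a)\<^sup>2 + d * (d * (norm b)\<^sup>2)"
    by (simp add: power2_diff power_mult_distrib power2_eq_square[of d] mult_ac)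
  then have "d * (norm a * norm b) \<le> d * ((1 / d) * (norm a)\<^sup>2 + d * (norm b)\<^sup>2)"
    using d by (simp add: distrib_left)
  then show ?thesis using d by (simp add: norm_mult)
qed

text \<open>The product is split by a weighted inequality between squares: the weight
  \<open>d\<close> first makes the share of \<psi> small, then the norm of \<open>g t\<close> is
  small compared with \<open>d\<close>.\<close>

lemma integral_product_tendsto_0:
  fixes g :: "'t \<Rightarrow> real \<Rightarrow> complex"
  assumes lim: "((\<lambda>t. \<integral>\<^sup>+x. ennreal ((norm (g t x))\<^sup>2) \<partial>lborel) \<longlongrightarrow> 0) F"
    and g: "\<forall>\<^sub>F t in F. g t \<in> borel_measurable borel"
    and [measurable]: "\<psi> \<in> borel_measurable borel" and \<psi>: "integrable lborel (\<lambda>x. (norm (\<psi> x))\<^sup>2)"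
  shows "((\<lambda>t. LINT x|lborel. g t x * \<psi> x) \<longlongrightarrow> 0) F"
proof (rule tendstoI)
  fix e :: real assume e: "e > 0"
  define P where "P = (LINT x|lborel. (norm (\<psi> x))\<^sup>2)"
  have P: "P \<ge> 0" unfolding P_def by (rule Bochner_Integration.integral_nonneg) simp
  \<comment> \<open>Leaves at most \<open>e / 2\<close> for \<psi> and \<open>e / 4\<close> for
    \<open>g t\<close>; the added 1 guards against \<open>P = 0\<close>.\<close>
  define d where "d = e / (2 * (P + 1))"
  have d: "d > 0" using e P by (simp add: d_def)
  have dP: "d * P \<le> e / 2" using e P by (simp add: d_def field_simps)
  have "\<forall>\<^sub>F t in F. (\<integral>\<^sup>+x. ennreal ((norm (g t x))\<^sup>2) \<partial>lborel) < ennreal (d * (e / 4))"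
    by (rule order_tendstoD(2)[OF lim]) (use d e in simp)
  with g show "\<forall>\<^sub>F t in F. dist (LINT x|lborel. g t x * \<psi> x) 0 < e"
  proof eventually_elim
    case (elim t)
    note [measurable] = elim(1)
    have "ennreal (norm (LINT x|lborel. g t x * \<psi> x)) \<le> (\<integral>\<^sup>+x. ennreal (norm (g t x * \<psi> x)) \<partial>lborel)"
    proof (cases "integrable lborel (\<lambda>x. g t x * \<psi> x)")
      case True
      then show ?thesis by (rule integral_norm_bound_ennreal)
    qed (simp add: not_integrable_integral_eq)
    also have "\<dots> \<le> (\<integral>\<^sup>+x. ennreal (1 / d) * ennreal ((norm (g t x))\<^sup>2) + ennreal d * ennreal ((norm (\<psi> x))\<^sup>2) \<partial>lborel)"
    proof (rule nn_integral_mono)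
      fix x
      show "ennreal (norm (g t x * \<psi> x)) \<le> ennreal (1 / d) * ennreal ((norm (g t x))\<^sup>2) + ennreal d * ennreal ((norm (\<psi> x))\<^sup>2)"
      proof -
        have "ennreal ((1 / d) * (norm (g t x))\<^sup>2 + d * (norm (\<psi> x))\<^sup>2)
            = ennreal ((1 / d) * (norm (g t x))\<^sup>2) + ennreal (d * (norm (\<psi> x))\<^sup>2)"
          by (rule ennreal_plus) (use d in auto)
        also have "\<dots> = ennreal (1 / d) * ennreal ((norm (g t x))\<^sup>2) + ennreal d * ennreal ((norm (\<psi> x))\<^sup>2)"
          by (intro arg_cong2[where f = "(+)"] ennreal_mult) (use d in auto)
        finally show ?thesis
          using ennreal_leI[OF norm_mult_le_squares[OF d, of "g t x" "\<psi> x"]] by simp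
      qed
    qed
    also have "\<dots> = ennreal (1 / d) * (\<integral>\<^sup>+x. ennreal ((norm (g t x))\<^sup>2) \<partial>lborel) + ennreal d * (\<integral>\<^sup>+x. ennreal ((norm (\<psi> x))\<^sup>2) \<partial>lborel)"
      by (simp add: nn_integral_add nn_integral_cmult)
    also have "(\<integral>\<^sup>+x. ennreal ((norm (\<psi> x))\<^sup>2) \<partial>lborel) = ennreal P"
      unfolding P_def by (rule nn_integral_eq_integral[OF \<psi>]) simp
    also have "ennreal (1 / d) * (\<integral>\<^sup>+x. ennreal ((norm (g t x))\<^sup>2) \<partial>lborel) + ennreal d * ennreal P
        \<le> ennreal (1 / d) * ennreal (d * (e / 4)) + ennreal (e / 2)"
    proof (rule add_mono)
      show "ennreal (1 / d) * (\<integral>\<^sup>+x. ennreal ((norm (g t x))\<^sup>2) \<partial>lborel) \<le> ennreal (1 / d) * ennreal (d * (e / 4))"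
        by (rule mult_left_mono[OF less_imp_le[OF elim(2)]]) simp
      show "ennreal d * ennreal P \<le> ennreal (e / 2)"
        using dP d P by (simp add: ennreal_mult[symmetric] ennreal_leI)
    qed
    also have "\<dots> = ennreal (3 / 4 * e)"
    proof -
      have "ennreal (1 / d) * ennreal (d * (e / 4)) = ennreal (e / 4)"
        using d e by (subst ennreal_mult[symmetric]) auto
      then show ?thesis using e by (simp add: ennreal_plus[symmetric] del: ennreal_plus)
    qed
    finally have "norm (LINT x|lborel. g t x * \<psi> x) \<le> 3 / 4 * e"
      using e by (subst (asm) ennreal_le_iff) auto
    then show ?case using e by simp
  qed
qed

text \<open>Lebesgue measure is translation invariant, so the norm of the shifted factor is the same
  for every \<omega> and the inner integral is bounded by a constant.\<close>

lemma pair_integrable_of_shift: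
  fixes a b :: "real \<Rightarrow> complex"
  assumes "prob_space M" and H [measurable]: "H \<in> borel_measurable (M \<Otimes>\<^sub>M lborel)"
    and [measurable]: "z \<in> borel_measurable M" "a \<in> borel_measurable borel" "b \<in> borel_measurable borel"
    and a: "integrable lborel (\<lambda>x. (norm (a x))\<^sup>2)" and b: "integrable lborel (\<lambda>x. (norm (b x))\<^sup>2)"
    and bound: "\<And>\<omega> x. norm (H (\<omega>, x)) \<le> norm (a x * b (x + z \<omega>))"
  shows "integrable (M \<Otimes>\<^sub>M lborel) (H :: 'w \<times> real \<Rightarrow> complex)"
proof -
  interpret prob_space M by fact
  interpret P: pair_sigma_finite M lborel ..
  have bs: "integrable lborel (\<lambda>x. (norm (b (x + z \<omega>)))\<^sup>2)"
    "(LINT x|lborel. (norm (b (x + z \<omega>)))\<^sup>2) = (LINT x|lborel. (norm (b x))\<^sup>2)" for \<omega>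
    using lborel_integrable_real_affine[OF b, of 1 "z \<omega>"] lborel_integral_real_affine[of 1 "\<lambda>x. (norm (b x))\<^sup>2" "z \<omega>"]
    by (simp_all add: add.commute)
  have le: "norm (H (\<omega>, x)) \<le> (norm (a x))\<^sup>2 + (norm (b (x + z \<omega>)))\<^sup>2" for \<omega> x
    using order_trans[OF bound norm_mult_le_squares[of 1]] by simp
  have Hi: "integrable lborel (\<lambda>x. H (\<omega>, x))" if "\<omega> \<in> space M" for \<omega>
    by (rule Bochner_Integration.integrable_bound[OF Bochner_Integration.integrable_add[OF a bs(1)[of \<omega>]]])
       (use le that in auto)
  show ?thesis
  proof (rule P.Fubini_integrable[OF H])
    define B where "B = (LINT x|lborel. (norm (a x))\<^sup>2) + (LINT x|lborel. (norm (b x))\<^sup>2)"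
    show "integrable M (\<lambda>\<omega>. LINT x|lborel. norm (H (\<omega>, x)))"
    proof (rule integrable_const_bound[of _ B])
      show "AE \<omega> in M. norm (LINT x|lborel. norm (H (\<omega>, x))) \<le> B"
      proof (rule AE_I2)
        fix \<omega> assume w: "\<omega> \<in> space M"
        have "(LINT x|lborel. norm (H (\<omega>, x))) \<le> (LINT x|lborel. (norm (a x))\<^sup>2 + (norm (b (x + z \<omega>)))\<^sup>2)"
          by (rule Bochner_Integration.integral_mono) (use Hi[OF w] a bs le in auto)
        also have "\<dots> = B" using a bs by (simp add: B_def)
        finally show "norm (LINT x|lborel. norm (H (\<omega>, x))) \<le> B"
          by simp
      qed
    qed measurable
    show "AE \<omega> in M. integrable lborel (\<lambda>x. H (\<omega>, x))" by (rule AE_I2) (rule Hi)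
  qed
qed

context cauchy_process
begin

text \<open>For each \<omega>, translation by the endpoint of the path preserves Lebesgue measure
  and turns start into end; the path read backwards from its end collects the same action. Fubini
  then exchanges expectation and integral.\<close>

lemma feynman_kac_duality:
  assumes t: "0 < t" and [measurable]: "f \<in> borel_measurable borel" "\<phi> \<in> borel_measurable borel"
    and f: "integrable lborel (\<lambda>x. (norm (f x))\<^sup>2)" and \<phi>: "integrable lborel (\<lambda>x. (norm (\<phi> x))\<^sup>2)"
  shows "integrable lborel (\<lambda>x. feynman_kac M path t f x * \<phi> x)"
    "integrable lborel (\<lambda>x. f x * feynman_kac M (reversed t) t \<phi> x)"
    "(LINT x|lborel. feynman_kac M path t f x * \<phi> x) = (LINT x|lborel. f x * feynman_kac M (reversed t) t \<phi> x)"
proof -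
  note [measurable (raw)] = path_measurable_compose
  interpret P: pair_sigma_finite M lborel ..
  define e where "e = (\<lambda>x \<omega>. exp (- (LBINT s:{0..t}. (x + path s \<omega>)\<^sup>2)))"
  have e: "0 \<le> e x \<omega>" "e x \<omega> \<le> 1" for x \<omega>
  proof -
    have "(LBINT s:{0..t}. (x + path s \<omega>)\<^sup>2) \<ge> 0"
      unfolding set_lebesgue_integral_def by (rule Bochner_Integration.integral_nonneg) simp
    then show "0 \<le> e x \<omega>" "e x \<omega> \<le> 1" by (simp_all add: e_def)
  qed
  define z where "z = path t"
  have [measurable]: "z \<in> borel_measurable M" unfolding z_def by measurable
  define F where "F = (\<lambda>\<omega> x. complex_of_real (e x \<omega>) * f (x + z \<omega>) * \<phi> x)"
  define G where "G = (\<lambda>\<omega> x. complex_of_real (e (x - z \<omega>) \<omega>) * \<phi> (x - z \<omega>) * f x)"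
  have e1m: "(\<lambda>p. e (snd p) (fst p)) \<in> borel_measurable (M \<Otimes>\<^sub>M lborel)"
    unfolding e_def set_lebesgue_integral_def by measurable
  have e2m: "(\<lambda>p. e (snd p - z (fst p)) (fst p)) \<in> borel_measurable (M \<Otimes>\<^sub>M lborel)"
    unfolding e_def set_lebesgue_integral_def by measurable
  have Fm: "case_prod F \<in> borel_measurable (M \<Otimes>\<^sub>M lborel)"
    unfolding F_def case_prod_beta' using e1m by measurable
  have Gm: "case_prod G \<in> borel_measurable (M \<Otimes>\<^sub>M lborel)"
    unfolding G_def case_prod_beta' using e2m by measurable
  have iF: "integrable (M \<Otimes>\<^sub>M lborel) (case_prod F)"
  proof (rule pair_integrable_of_shift[OF prob_space_axioms Fm, where z = z and a = \<phi> and b = f])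
    fix \<omega> x
    have "e x \<omega> * (norm (f (x + z \<omega>)) * norm (\<phi> x)) \<le> 1 * (norm (f (x + z \<omega>)) * norm (\<phi> x))"
      by (rule mult_right_mono) (use e in auto)
    then show "norm (case_prod F (\<omega>, x)) \<le> norm (\<phi> x * f (x + z \<omega>))"
      using e by (simp add: F_def norm_mult mult_ac)
  qed (use f \<phi> in auto)
  have iG: "integrable (M \<Otimes>\<^sub>M lborel) (case_prod G)"
  proof (rule pair_integrable_of_shift[OF prob_space_axioms Gm, where z = "\<lambda>\<omega>. - z \<omega>" and a = f and b = \<phi>])
    fix \<omega> x
    have "e (x - z \<omega>) \<omega> * (norm (\<phi> (x - z \<omega>)) * norm (f x)) \<le> 1 * (norm (\<phi> (x - z \<omega>)) * norm (f x))"
      by (rule mult_right_mono) (use e in auto)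
    then show "norm (case_prod G (\<omega>, x)) \<le> norm (f x * \<phi> (x + - z \<omega>))"
      using e by (simp add: G_def norm_mult mult_ac)
  qed (use f \<phi> in auto)
  have eqF: "feynman_kac M path t f x * \<phi> x = (LINT \<omega>|M. F \<omega> x)" for x
    unfolding feynman_kac_def F_def e_def z_def by simp
  \<comment> \<open>The substitution of \<open>t - s\<close> for \<open>s\<close>; the start is
    shifted by the endpoint \<open>z \<omega>\<close>.\<close>
  have reflect: "(LBINT s:{0..t}. (x + reversed t s \<omega>)\<^sup>2) = (LBINT s:{0..t}. (x - z \<omega> + path s \<omega>)\<^sup>2)" for x \<omega>
  proof -
    have "(LBINT s:{0..t}. (x - z \<omega> + path s \<omega>)\<^sup>2) = (LINT s|lborel. indicator {0..t} (t + - 1 * s) *\<^sub>R (x - z \<omega> + path (t + - 1 * s) \<omega>)\<^sup>2)"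
      unfolding set_lebesgue_integral_def
      by (subst lborel_integral_real_affine[of "- 1" _ t]) simp_all
    also have "\<dots> = (LBINT s:{0..t}. (x + reversed t s \<omega>)\<^sup>2)"
      unfolding set_lebesgue_integral_def
      by (rule Bochner_Integration.integral_cong) (auto simp: reversed_def z_def indicator_def algebra_simps)
    finally show ?thesis ..
  qed
  have eqG: "f x * feynman_kac M (reversed t) t \<phi> x = (LINT \<omega>|M. G \<omega> x)" for x
  proof -
    have mr: "(\<lambda>\<omega>. complex_of_real (e (x - z \<omega>) \<omega>)) \<in> borel_measurable M"
      using measurable_compose[OF _ e2m, of "\<lambda>\<omega>. (\<omega>, x)" M] by simp
    have rt [measurable]: "reversed t t \<in> borel_measurable M" unfolding reversed_def[abs_def] by measurable
    have "feynman_kac M (reversed t) t \<phi> x = (LINT \<omega>|M. complex_of_real (e (x - z \<omega>) \<omega>) * \<phi> (x + reversed t t \<omega>))"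
      unfolding feynman_kac_def e_def reflect ..
    also have "\<dots> = (LINT \<omega>|M. complex_of_real (e (x - z \<omega>) \<omega>) * \<phi> (x - z \<omega>))"
    proof (rule integral_cong_AE)
      show "AE \<omega> in M. complex_of_real (e (x - z \<omega>) \<omega>) * \<phi> (x + reversed t t \<omega>) = complex_of_real (e (x - z \<omega>) \<omega>) * \<phi> (x - z \<omega>)"
        using start by eventually_elim (simp add: reversed_def path_def z_def)
    qed (use mr in measurable)
    finally show ?thesis unfolding G_def by (simp add: mult.commute)
  qed
  show "integrable lborel (\<lambda>x. feynman_kac M path t f x * \<phi> x)"
    unfolding eqF by (rule P.integrable_snd[OF iF])
  show "integrable lborel (\<lambda>x. f x * feynman_kac M (reversed t) t \<phi> x)"
    unfolding eqG by (rule P.integrable_snd[OF iG])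
  have "(LINT x|lborel. feynman_kac M path t f x * \<phi> x) = (LINT \<omega>|M. LINT x|lborel. F \<omega> x)"
    unfolding eqF by (rule P.Fubini_integral[OF iF])
  also have "\<dots> = (LINT \<omega>|M. LINT x|lborel. G \<omega> x)"
  proof (rule Bochner_Integration.integral_cong[OF refl])
    fix \<omega>
    have "(LINT x|lborel. F \<omega> x) = (LINT x|lborel. F \<omega> (- z \<omega> + 1 * x))"
      by (subst lborel_integral_real_affine[of 1 _ "- z \<omega>"]) simp_all
    also have "\<dots> = (LINT x|lborel. G \<omega> x)"
      by (rule Bochner_Integration.integral_cong) (simp_all add: F_def G_def mult_ac)
    finally show "(LINT x|lborel. F \<omega> x) = (LINT x|lborel. G \<omega> x)" .
  qed
  also have "\<dots> = (LINT x|lborel. f x * feynman_kac M (reversed t) t \<phi> x)"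
    unfolding eqG by (rule P.Fubini_integral[OF iG, symmetric])
  finally show "(LINT x|lborel. feynman_kac M path t f x * \<phi> x) = (LINT x|lborel. f x * feynman_kac M (reversed t) t \<phi> x)" .
qed

end

section \<open>The spectral gap\<close>

lemma ft_profile_square_integrable:
  assumes p: "profile u u' u''"
  shows "integrable lborel (\<lambda>x. (norm (ft u x))\<^sup>2)"
proof -
  obtain C where C: "C > 0" "\<And>x. norm (ft u x) \<le> C / (1 + \<bar>x\<bar>) ^ 3"
    using ft_profile_decay[OF p] by blast
  show ?thesis
  proof (rule square_integrable_of_bound[OF ft_profile_measurable[OF p]])
    fix x :: real
    have "(1 + \<bar>x\<bar>) ^ 1 \<le> (1 + \<bar>x\<bar>) ^ 3" by (rule power_increasing) auto
    then have "C / (1 + \<bar>x\<bar>) ^ 3 \<le> C / (1 + \<bar>x\<bar>)"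
      using C(1) by (intro divide_left_mono) auto
    with C(2)[of x] show "norm (ft u x) \<le> C / (1 + \<bar>x\<bar>)" by linarith
  qed
qed

lemma ft_profile_L2: "profile u u' u'' \<Longrightarrow> ft u \<in> L2"
  by (simp add: L2_def ft_profile_measurable ft_profile_square_integrable)

lemma L2_D:
  assumes "f \<in> L2"
  shows "f \<in> borel_measurable borel" "integrable lborel (\<lambda>x. (norm (f x))\<^sup>2)"
  using assms by (auto simp: L2_def)

lemma tent_product_integrable:
  assumes "f \<in> L2"
  shows "integrable lborel (\<lambda>x. f x * ft (tent a) x)"
  by (rule product_integrable) (use L2_D[OF assms] ft_tent_square_integrable in auto)

context cauchy_process
begin

lemma eigenfunction_of_profile:
  assumes p: "profile u u' (\<lambda>k. (\<bar>k\<bar> - \<mu>) * u k)"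
  shows "ft u \<in> eigenspace (hamiltonian M X) \<mu>"
proof -
  have "ft (\<lambda>k. \<bar>k\<bar> * u k - (\<bar>k\<bar> - \<mu>) * u k) x = of_real \<mu> * ft u x" for x
    unfolding ft_cmult[symmetric] by (simp add: left_diff_distrib)
  then have "((\<lambda>t. \<integral>\<^sup>+x. ennreal ((norm ((ft u x - feynman_kac M path t (ft u) x) / of_real t
      - of_real \<mu> * ft u x))\<^sup>2) \<partial>lborel) \<longlongrightarrow> 0) (at_right 0)"
    using generator_L2_limit[OF p forward_path] by simp
  moreover have "\<forall>\<^sub>F t in at_right 0. (\<integral>\<^sup>+x. ennreal ((norm ((ft u x - feynman_kac M path t (ft u) x) / of_real t
      - of_real \<mu> * ft u x))\<^sup>2) \<partial>lborel) = (\<integral>\<^sup>+x. ennreal ((norm ((ft u x - feynman_kac M X t (ft u) x) / of_real t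
      - of_real \<mu> * ft u x))\<^sup>2) \<partial>lborel)"
    using eventually_at_right_less[of "0::real"]
    by eventually_elim (simp add: feynman_kac_path)
  ultimately have "((\<lambda>t. \<integral>\<^sup>+x. ennreal ((norm ((ft u x - feynman_kac M X t (ft u) x) / of_real t
      - of_real \<mu> * ft u x))\<^sup>2) \<partial>lborel) \<longlongrightarrow> 0) (at_right 0)"
    by (rule Lim_transform_eventually)
  moreover have "(\<lambda>x. of_real \<mu> * ft u x) \<in> L2"
    using L2_D[OF ft_profile_L2[OF p]] by (simp add: L2_def norm_mult power_mult_distrib)
  ultimately show ?thesis
    using ft_profile_L2[OF p] by (simp add: eigenspace_def hamiltonian_def)
qed

text \<open>
  The adjoint of the Feynman-Kac operator is the Feynman-Kac operator of the reversed path, so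
  testing the eigenvalue equation needs the generator only on transforms of profiles.
\<close>

lemma eigenfunction_weak:
  assumes f: "f \<in> eigenspace (hamiltonian M X) \<mu>" and p: "profile u u' u''"
  shows "(LINT x|lborel. f x * (ft (\<lambda>k. \<bar>k\<bar> * u k - u'' k) x - of_real \<mu> * ft u x)) = 0"
proof -
  define \<phi> where "\<phi> = ft u"
  define h where "h = ft (\<lambda>k. \<bar>k\<bar> * u k - u'' k)"
  have fL: "f \<in> L2" and flim: "((\<lambda>t. \<integral>\<^sup>+x. ennreal ((norm ((f x - feynman_kac M X t f x) / of_real t - of_real \<mu> * f x))\<^sup>2) \<partial>lborel) \<longlongrightarrow> 0) (at_right 0)"
    using f by (auto simp: eigenspace_def hamiltonian_def)
  note [measurable] = L2_D(1)[OF fL]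
  note f2 = L2_D(2)[OF fL]
  have [measurable]: "\<phi> \<in> borel_measurable borel" unfolding \<phi>_def by (rule ft_profile_measurable[OF p])
  have \<phi>2: "integrable lborel (\<lambda>x. (norm (\<phi> x))\<^sup>2)" unfolding \<phi>_def by (rule ft_profile_square_integrable[OF p])
  have [measurable]: "h \<in> borel_measurable borel"
    unfolding h_def by (rule ft_measurable) (use profile_measurable[OF p] in measurable)
  have a: "((\<lambda>t. LINT x|lborel. ((f x - feynman_kac M X t f x) / of_real t - of_real \<mu> * f x) * \<phi> x) \<longlongrightarrow> 0) (at_right 0)"
  proof (rule integral_product_tendsto_0[OF flim _ _ \<phi>2])
    show "\<forall>\<^sub>F t in at_right 0. (\<lambda>x. (f x - feynman_kac M X t f x) / of_real t - of_real \<mu> * f x) \<in> borel_measurable borel"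
      using eventually_at_right_less[of "0::real"]
    proof eventually_elim
      case (elim t)
      have [measurable]: "(\<lambda>x. feynman_kac M X t f x) \<in> borel_measurable borel"
        using feynman_kac_measurable[OF forward_path[OF elim], of f] elim by (simp add: feynman_kac_path)
      show ?case by measurable
    qed
  qed measurable
  have b: "((\<lambda>t. LINT x|lborel. ((\<phi> x - feynman_kac M (reversed t) t \<phi> x) / of_real t - h x) * f x) \<longlongrightarrow> 0) (at_right 0)"
  proof (rule integral_product_tendsto_0[OF _ _ _ f2])
    show "((\<lambda>t. \<integral>\<^sup>+x. ennreal ((norm ((\<phi> x - feynman_kac M (reversed t) t \<phi> x) / of_real t - h x))\<^sup>2) \<partial>lborel) \<longlongrightarrow> 0) (at_right 0)"
      unfolding \<phi>_def h_def by (rule generator_L2_limit[OF p reversed_path])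
    show "\<forall>\<^sub>F t in at_right 0. (\<lambda>x. (\<phi> x - feynman_kac M (reversed t) t \<phi> x) / of_real t - h x) \<in> borel_measurable borel"
      using eventually_at_right_less[of "0::real"]
    proof eventually_elim
      case (elim t)
      have [measurable]: "(\<lambda>x. feynman_kac M (reversed t) t \<phi> x) \<in> borel_measurable borel"
        by (rule feynman_kac_measurable[OF reversed_path[OF elim]]) measurable
      show ?case by measurable
    qed
  qed measurable
  have f\<phi>: "integrable lborel (\<lambda>x. f x * \<phi> x)" by (rule product_integrable[OF _ _ f2 \<phi>2]) auto
  \<comment> \<open>At the fixed time 1, \<open>h\<close> equals \<phi> minus its reversed
    Feynman-Kac image minus \<open>D\<close>. The product of \<open>f\<close> with each of these is
    integrable, by square integrability, by duality, and by the bound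
    \<open>C / (1 + \<bar>x\<bar>)\<close> for \<open>D\<close>.\<close>
  have fh: "integrable lborel (\<lambda>x. f x * h x)"
  proof -
    obtain C where C: "C > 0" and dom: "\<And>t Y x. 0 < t \<Longrightarrow> t \<le> 1 \<Longrightarrow> cauchy_path M t Y \<Longrightarrow>
        norm ((ft u x - feynman_kac M Y t (ft u) x) / of_real t - ft (\<lambda>k. \<bar>k\<bar> * u k - u'' k) x) \<le> C / (1 + \<bar>x\<bar>)"
      and "\<And>t Y x K. 0 < t \<Longrightarrow> cauchy_path M t Y \<Longrightarrow> K \<ge> 1 \<Longrightarrow> x\<^sup>2 \<le> K \<Longrightarrow>
        norm ((ft u x - feynman_kac M Y t (ft u) x) / of_real t - ft (\<lambda>k. \<bar>k\<bar> * u k - u'' k) x)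
          \<le> C * t + (C * (8 / sqrt K + 4 * t) + C * K\<^sup>2 * t / 2 + 12 * C * K * sqrt t)"
      using generator_bounds[OF p] by blast
    define D where "D = (\<lambda>x. (\<phi> x - feynman_kac M (reversed 1) 1 \<phi> x) - h x)"
    have [measurable]: "(\<lambda>x. feynman_kac M (reversed 1) 1 \<phi> x) \<in> borel_measurable borel"
      by (rule feynman_kac_measurable[OF reversed_path]) auto
    have Dm [measurable]: "D \<in> borel_measurable borel" unfolding D_def by measurable
    have "integrable lborel (\<lambda>x. (norm (D x))\<^sup>2)"
      by (rule square_integrable_of_bound[OF Dm]) (use dom[of 1 "reversed 1"] reversed_path[of 1] in \<open>auto simp: D_def \<phi>_def h_def\<close>)
    then have "integrable lborel (\<lambda>x. f x * D x)" by (intro product_integrable[OF _ _ f2]) auto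
    moreover have "integrable lborel (\<lambda>x. f x * feynman_kac M (reversed 1) 1 \<phi> x)"
      by (rule feynman_kac_duality(2)[OF _ _ _ f2 \<phi>2]) auto
    ultimately have "integrable lborel (\<lambda>x. f x * \<phi> x - f x * feynman_kac M (reversed 1) 1 \<phi> x - f x * D x)"
      using f\<phi> by (intro Bochner_Integration.integrable_diff)
    then show ?thesis by (simp add: D_def algebra_simps)
  qed
  \<comment> \<open>By duality the difference quotients cancel for every \<open>t > 0\<close>, so
    the difference of the two vanishing pairings does not depend on \<open>t\<close>.\<close>
  have "\<forall>\<^sub>F t in at_right 0. (LINT x|lborel. ((f x - feynman_kac M X t f x) / of_real t - of_real \<mu> * f x) * \<phi> x)
      - (LINT x|lborel. ((\<phi> x - feynman_kac M (reversed t) t \<phi> x) / of_real t - h x) * f x)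
      = (LINT x|lborel. f x * h x) - of_real \<mu> * (LINT x|lborel. f x * \<phi> x)"
    using eventually_at_right_less[of "0::real"]
  proof eventually_elim
    case (elim t)
    note dual = feynman_kac_duality[OF elim _ _ f2 \<phi>2, simplified]
    have fk: "feynman_kac M X t f x = feynman_kac M path t f x" for x
      by (rule feynman_kac_path) (use elim in simp)
    have "(LINT x|lborel. ((f x - feynman_kac M X t f x) / of_real t - of_real \<mu> * f x) * \<phi> x)
        = (LINT x|lborel. (1 / of_real t) * (f x * \<phi> x) - (1 / of_real t) * (feynman_kac M path t f x * \<phi> x) - of_real \<mu> * (f x * \<phi> x))"
      unfolding fk by (rule Bochner_Integration.integral_cong) (simp_all add: algebra_simps diff_divide_distrib)
    also have "\<dots> = (1 / of_real t) * (LINT x|lborel. f x * \<phi> x) - (1 / of_real t) * (LINT x|lborel. feynman_kac M path t f x * \<phi> x)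
        - of_real \<mu> * (LINT x|lborel. f x * \<phi> x)"
      using f\<phi> dual(1) by simp
    finally have 1: "(LINT x|lborel. ((f x - feynman_kac M X t f x) / of_real t - of_real \<mu> * f x) * \<phi> x) = \<dots>" .
    have "(LINT x|lborel. ((\<phi> x - feynman_kac M (reversed t) t \<phi> x) / of_real t - h x) * f x)
        = (LINT x|lborel. (1 / of_real t) * (f x * \<phi> x) - (1 / of_real t) * (f x * feynman_kac M (reversed t) t \<phi> x) - f x * h x)"
      by (rule Bochner_Integration.integral_cong) (simp_all add: algebra_simps diff_divide_distrib)
    also have "\<dots> = (1 / of_real t) * (LINT x|lborel. f x * \<phi> x) - (1 / of_real t) * (LINT x|lborel. f x * feynman_kac M (reversed t) t \<phi> x)
        - (LINT x|lborel. f x * h x)"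
      using f\<phi> fh dual(2) by simp
    finally have 2: "(LINT x|lborel. ((\<phi> x - feynman_kac M (reversed t) t \<phi> x) / of_real t - h x) * f x) = \<dots>" .
    show ?case unfolding 1 2 dual(3) by simp
  qed
  from Lim_transform_eventually[OF tendsto_diff[OF a b] this]
  have "((\<lambda>t::real. (LINT x|lborel. f x * h x) - of_real \<mu> * (LINT x|lborel. f x * \<phi> x)) \<longlongrightarrow> 0) (at_right 0)"
    by simp
  then have "(LINT x|lborel. f x * h x) - of_real \<mu> * (LINT x|lborel. f x * \<phi> x) = 0"
    by (simp add: tendsto_const_iff)
  moreover have "(LINT x|lborel. f x * (h x - of_real \<mu> * \<phi> x)) = (LINT x|lborel. f x * h x - of_real \<mu> * (f x * \<phi> x))"
    by (rule Bochner_Integration.integral_cong) (simp_all add: algebra_simps)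
  moreover have "\<dots> = (LINT x|lborel. f x * h x) - of_real \<mu> * (LINT x|lborel. f x * \<phi> x)"
    using f\<phi> fh by simp
  ultimately show ?thesis by (simp add: \<phi>_def h_def)
qed

end

section \<open>From vanishing pairings to multiplicities\<close>

lemma not_AE_outside_interval:
  fixes a b :: real
  assumes "a < b"
  shows "\<not> (AE x in lborel. x \<notin> {a..b})"
proof
  assume "AE x in lborel. x \<notin> {a..b}"
  then have "{a..b} \<in> null_sets lborel" by (subst AE_iff_null_sets) auto
  then have "emeasure lborel {a..b} = 0" by (rule null_setsD1)
  then show False using assms by simp
qed

lemma integral_pos_of_tent:
  assumes p: "profile u u' u''" and pos: "\<And>k. u k > 0"
  shows "(LINT k|lborel. u k) > 0" "integrable lborel (\<lambda>k. u k * tent a k)" "(LINT k|lborel. u k * tent 0 k) > 0"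
proof -
  have iu: "integrable lborel u" by (rule profile_integrable[OF p])
  have [measurable]: "u \<in> borel_measurable borel" by (rule profile_measurable[OF p])
  have t: "0 \<le> tent b k" "tent b k \<le> 1" for b k by (simp_all add: tent_def)
  have it: "integrable lborel (\<lambda>k. u k * tent b k)" for b
  proof (rule Bochner_Integration.integrable_bound[OF iu])
    show "AE k in lborel. norm (u k * tent b k) \<le> norm (u k)"
      using t by (intro AE_I2) (simp add: abs_mult mult_left_le)
  qed measurable
  then show "integrable lborel (\<lambda>k. u k * tent a k)" .
  have "(LINT k|lborel. u k * tent 0 k) \<noteq> 0"
  proof
    assume "(LINT k|lborel. u k * tent 0 k) = 0"
    then have "AE k in lborel. u k * tent 0 k = 0"
      using integral_nonneg_eq_0_iff_AE[OF it[of 0]] pos t by (simp add: less_imp_le)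
    then have "AE k in lborel. k \<notin> {- (1/2)..1/2::real}"
    proof eventually_elim
      case (elim k)
      then show ?case using pos[of k] by (auto simp: tent_def max_def split: if_splits)
    qed
    then show False using not_AE_outside_interval[of "- (1/2)" "1/2"] by simp
  qed
  moreover have "(LINT k|lborel. u k * tent 0 k) \<ge> 0"
    by (rule Bochner_Integration.integral_nonneg) (use pos t in \<open>simp add: less_imp_le\<close>)
  ultimately show p0: "(LINT k|lborel. u k * tent 0 k) > 0" by linarith
  have "(LINT k|lborel. u k * tent 0 k) \<le> (LINT k|lborel. u k)"
    by (rule Bochner_Integration.integral_mono[OF it iu]) (use pos t in \<open>simp add: less_imp_le mult_left_le\<close>)
  with p0 show "(LINT k|lborel. u k) > 0" by linarith
qed

text \<open>The transform at 0 is the integral of \<open>u\<close>, which is positive, and the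
  Lipschitz bound keeps it away from 0 on an interval.\<close>

lemma ft_positive_profile_nonzero:
  assumes p: "profile u u' u''" and pos: "\<And>k. u k > 0"
  shows "\<not> (AE x in lborel. ft u x = 0)"
proof
  assume z: "AE x in lborel. ft u x = 0"
  obtain C where C: "C > 0" "\<And>x y. norm (ft u x - ft u y) \<le> C * \<bar>x - y\<bar>"
    using ft_profile_lipschitz[OF p] by blast
  define c where "c = (LINT k|lborel. u k)"
  have c: "c > 0" unfolding c_def by (rule integral_pos_of_tent[OF p pos])
  have f0: "ft u 0 = complex_of_real c" by (simp add: ft_def c_def)
  define d where "d = c / (2 * C)"
  have d: "d > 0" using c C by (simp add: d_def)
  have "AE x in lborel. x \<notin> {- d..d}"
    using z
  proof eventually_elim
    case (elim x)
    show ?case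
    proof
      assume "x \<in> {- d..d}"
      then have "C * \<bar>x\<bar> \<le> C * d" using C(1) by (intro mult_left_mono) auto
      moreover have "c \<le> C * \<bar>x\<bar>" using C(2)[of 0 x] elim c by (simp add: f0)
      moreover have "C * d < c" using C(1) c by (simp add: d_def)
      ultimately show False by linarith
    qed
  qed
  then show False using not_AE_outside_interval[of "- d" d] d by simp
qed

lemma L2_independent_nonzero:
  assumes "L2_independent n f" "i < n"
  shows "\<not> (AE x in lborel. f i x = 0)"
proof
  assume z: "AE x in lborel. f i x = 0"
  define c :: "nat \<Rightarrow> complex" where "c = (\<lambda>j. if j = i then 1 else 0)"
  have "(\<Sum>j<n. c j * f j x) = f i x" for x
    using assms(2) by (simp add: c_def if_distrib[of "\<lambda>z. z * _"] cong: if_cong)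
  then have "AE x in lborel. (\<Sum>j<n. c j * f j x) = 0" using z by simp
  then have "c i = 0" using assms unfolding L2_independent_def by blast
  then show False by (simp add: c_def)
qed

lemma L2_independent_pair:
  assumes "L2_independent n f" "n \<ge> 2" and z: "AE x in lborel. a * f 0 x + b * f 1 x = 0"
  shows "a = 0" "b = 0"
proof -
  define c :: "nat \<Rightarrow> complex" where "c = (\<lambda>j. if j = 0 then a else if j = 1 then b else 0)"
  have "(\<Sum>j<n. c j * f j x) = (\<Sum>j\<in>{0, 1}. c j * f j x)" for x
    by (rule sum.mono_neutral_right) (use assms(2) in \<open>auto simp: c_def\<close>)
  then have "(\<Sum>j<n. c j * f j x) = a * f 0 x + b * f 1 x" for x by (simp add: c_def)
  then have "AE x in lborel. (\<Sum>j<n. c j * f j x) = 0" using z by simp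
  then have "\<forall>i<n. c i = 0" using assms(1) unfolding L2_independent_def by blast
  then have "c 0 = 0" "c 1 = 0" using assms(2) by auto
  then show "a = 0" "b = 0" by (simp_all add: c_def)
qed

lemma eigenvalue_multiplicity_eqI:
  assumes ub: "\<And>n f. (\<And>i. i < n \<Longrightarrow> f i \<in> eigenspace H \<mu>) \<Longrightarrow> L2_independent n f \<Longrightarrow> n \<le> m"
    and ex: "\<And>i. i < m \<Longrightarrow> f i \<in> eigenspace H \<mu>" "L2_independent m f"
  shows "eigenvalue_multiplicity H \<mu> = enat m"
proof (rule antisym)
  show "eigenvalue_multiplicity H \<mu> \<le> enat m"
    unfolding eigenvalue_multiplicity_def
  proof (rule Sup_least)
    fix x assume "x \<in> {enat n |n. \<exists>f. (\<forall>i<n. f i \<in> eigenspace H \<mu>) \<and> L2_independent n f}"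
    then obtain n g where "x = enat n" "\<forall>i<n. g i \<in> eigenspace H \<mu>" "L2_independent n g" by blast
    then show "x \<le> enat m" using ub[of n g] by simp
  qed
  show "enat m \<le> eigenvalue_multiplicity H \<mu>"
    unfolding eigenvalue_multiplicity_def by (rule Sup_upper) (use ex in blast)
qed

context cauchy_process
begin

text \<open>Away from \<open>l\<close> every tent is an admissible right-hand side, so all pairings
  of an eigenfunction with tents vanish. At \<open>l\<close> one linear condition is imposed on the
  right-hand side, which leaves a single free number \<open>F f 0\<close> for each
  eigenfunction.\<close>

lemma eigenvalue_gap:
  obtains l where "eigenvalue_multiplicity (hamiltonian M X) l = enat 1"
    "\<And>\<mu>. \<mu> < l + 121/100 \<Longrightarrow> \<mu> \<noteq> l \<Longrightarrow> eigenvalue_multiplicity (hamiltonian M X) \<mu> = enat 0"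
proof -
  define H where "H = hamiltonian M X"
  obtain l v v' where v: "profile v v' (\<lambda>k. (\<bar>k\<bar> - l) * v k)" "\<And>k. v k > 0"
    and res: "\<And>\<mu> h L K. \<mu> < l + 121/100 \<Longrightarrow> (\<And>x y. \<bar>h x - h y\<bar> \<le> L * \<bar>x - y\<bar>) \<Longrightarrow> K \<ge> 0 \<Longrightarrow>
       (\<And>k. \<bar>k\<bar> \<ge> K \<Longrightarrow> h k = 0) \<Longrightarrow> \<mu> \<noteq> l \<or> (LINT k|lborel. v k * h k) = 0 \<Longrightarrow>
       \<exists>u u'. profile u u' (\<lambda>k. (\<bar>k\<bar> - \<mu>) * u k - h k)"
    by (rule airy_spectral_gap) blast
  have weak: "(LINT x|lborel. f x * ft h x) = 0"
    if f: "f \<in> eigenspace H \<mu>" and u: "profile u u' (\<lambda>k. (\<bar>k\<bar> - \<mu>) * u k - h k)" and h: "integrable lborel h" for f \<mu> u u' h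
  proof -
    have iu: "integrable lborel (\<lambda>k. \<mu> * u k)" using profile_integrable(1)[OF u] by simp
    have "ft (\<lambda>k. \<bar>k\<bar> * u k - ((\<bar>k\<bar> - \<mu>) * u k - h k)) x - of_real \<mu> * ft u x = ft h x" for x
    proof -
      have "ft (\<lambda>k. \<bar>k\<bar> * u k - ((\<bar>k\<bar> - \<mu>) * u k - h k)) x = ft (\<lambda>k. \<mu> * u k + h k) x"
        by (rule arg_cong[where f = "\<lambda>g. ft g x"]) (auto simp: algebra_simps)
      also have "\<dots> = of_real \<mu> * ft u x + ft h x"
        unfolding ft_add[OF iu h] ft_cmult ..
      finally show ?thesis by simp
    qed
    then show ?thesis using eigenfunction_weak[OF f[unfolded H_def] u] by simp
  qed
  have eL2: "f \<in> L2" if "f \<in> eigenspace H \<mu>" for f \<mu>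
    using that by (simp add: H_def eigenspace_def hamiltonian_def)
  have zero: "AE x in lborel. f x = 0" if \<mu>: "\<mu> < l + 121/100" "\<mu> \<noteq> l" and f: "f \<in> eigenspace H \<mu>" for f \<mu>
  proof (rule zero_of_tent_orthogonal[OF L2_D[OF eL2[OF f]]])
    fix a
    have "\<exists>u u'. profile u u' (\<lambda>k. (\<bar>k\<bar> - \<mu>) * u k - tent a k)"
      by (rule res[OF \<mu>(1) tent_lipschitz _ tent_eq_0]) (use \<mu> in auto)
    then obtain u u' where "profile u u' (\<lambda>k. (\<bar>k\<bar> - \<mu>) * u k - tent a k)" by blast
    from weak[OF f this tent_integrable] show "(LINT x|lborel. f x * ft (tent a) x) = 0" .
  qed
  define F where "F = (\<lambda>f a. LINT x|lborel. f x * ft (tent a) x)"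
  \<comment> \<open>\<open>tent a - c a * tent 0\<close> is orthogonal to the ground state
    \<open>v\<close>, so the equation with this right-hand side is solvable.\<close>
  define c where "c = (\<lambda>a. (LINT k|lborel. v k * tent a k) / (LINT k|lborel. v k * tent 0 k))"
  have vt: "(LINT k|lborel. v k * tent 0 k) > 0" "integrable lborel (\<lambda>k. v k * tent a k)" for a
    by (rule integral_pos_of_tent[OF v])+
  have ratio: "F f a = complex_of_real (c a) * F f 0" if f: "f \<in> eigenspace H l" for f a
  proof -
    define h where "h = (\<lambda>k. tent a k - c a * tent 0 k)"
    have hi: "integrable lborel h" unfolding h_def using tent_integrable by simp
    have "\<exists>u u'. profile u u' (\<lambda>k. (\<bar>k\<bar> - l) * u k - h k)"
    proof (rule res[of l h "1 + \<bar>c a\<bar>" "\<bar>a\<bar> + 1"])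
      fix x y
      have "h x - h y = (tent a x - tent a y) - c a * (tent 0 x - tent 0 y)" by (simp add: h_def algebra_simps)
      then have "\<bar>h x - h y\<bar> \<le> \<bar>tent a x - tent a y\<bar> + \<bar>c a\<bar> * \<bar>tent 0 x - tent 0 y\<bar>"
        using abs_triangle_ineq4[of "tent a x - tent a y" "c a * (tent 0 x - tent 0 y)"] by (simp add: abs_mult)
      also have "\<dots> \<le> 1 * \<bar>x - y\<bar> + \<bar>c a\<bar> * (1 * \<bar>x - y\<bar>)"
        by (intro add_mono mult_left_mono tent_lipschitz) simp
      finally show "\<bar>h x - h y\<bar> \<le> (1 + \<bar>c a\<bar>) * \<bar>x - y\<bar>" by (simp add: algebra_simps)
    next
      fix k assume "\<bar>a\<bar> + 1 \<le> \<bar>k\<bar>"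
      then show "h k = 0" unfolding h_def using tent_eq_0[of a k] tent_eq_0[of 0 k] by simp
    next
      have "(LINT k|lborel. v k * h k) = (LINT k|lborel. v k * tent a k - c a * (v k * tent 0 k))"
        by (rule Bochner_Integration.integral_cong) (auto simp: h_def algebra_simps)
      also have "\<dots> = 0" using vt by (simp add: c_def)
      finally show "l \<noteq> l \<or> (LINT k|lborel. v k * h k) = 0" by simp
    qed auto
    then obtain u u' where u: "profile u u' (\<lambda>k. (\<bar>k\<bar> - l) * u k - h k)" by blast
    have "0 = (LINT x|lborel. f x * ft h x)" using weak[OF f u hi] by simp
    also have "\<dots> = (LINT x|lborel. f x * ft (tent a) x - of_real (c a) * (f x * ft (tent 0) x))"
    proof (rule Bochner_Integration.integral_cong[OF refl])
      fix x
      have "ft h x = ft (tent a) x - of_real (c a) * ft (tent 0) x"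
        unfolding h_def by (subst ft_diff) (use tent_integrable in \<open>simp_all add: ft_cmult\<close>)
      then show "f x * ft h x = f x * ft (tent a) x - of_real (c a) * (f x * ft (tent 0) x)"
        by (simp only: right_diff_distrib mult.left_commute)
    qed
    also have "\<dots> = F f a - of_real (c a) * F f 0"
      unfolding F_def using tent_product_integrable[OF eL2[OF f]] by simp
    finally show ?thesis by simp
  qed
  have zeroF: "AE x in lborel. f x = 0" if "f \<in> L2" "\<And>a. F f a = 0" for f
    by (rule zero_of_tent_orthogonal[OF L2_D[OF that(1)]]) (use that(2) in \<open>simp add: F_def\<close>)
  have "eigenvalue_multiplicity H l = enat 1"
  proof (rule eigenvalue_multiplicity_eqI[where f = "\<lambda>_. ft v"])
    fix n f assume f: "\<And>i. i < n \<Longrightarrow> f i \<in> eigenspace H l" and ind: "L2_independent n f"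
    show "n \<le> 1"
    proof (rule ccontr)
      assume "\<not> n \<le> 1"
      then have n: "n \<ge> 2" by simp
      have f0: "f 0 \<in> eigenspace H l" and f1: "f 1 \<in> eigenspace H l" using f n by auto
      note [measurable] = L2_D(1)[OF eL2[OF f0]] L2_D(1)[OF eL2[OF f1]]
      \<comment> \<open>The combination with these coefficients has vanishing pairing with every
        tent. Independence then forces \<open>F (f 0) 0 = 0\<close>, hence \<open>f 0\<close> itself
        vanishes almost everywhere.\<close>
      define A B where "A = F (f 1) 0" and "B = - F (f 0) 0"
      have int: "integrable lborel (\<lambda>x. A * f 0 x * ft (tent a) x)" "integrable lborel (\<lambda>x. B * f 1 x * ft (tent a) x)" for a
        using tent_product_integrable[OF eL2[OF f0], of a] tent_product_integrable[OF eL2[OF f1], of a]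
        by (simp_all add: mult.assoc)
      have "AE x in lborel. A * f 0 x + B * f 1 x = 0"
      proof (rule zero_of_tent_orthogonal)
        show "integrable lborel (\<lambda>x. (norm (A * f 0 x + B * f 1 x))\<^sup>2)"
        proof (rule Bochner_Integration.integrable_bound)
          show "integrable lborel (\<lambda>x. 2 * ((norm A)\<^sup>2 * (norm (f 0 x))\<^sup>2) + 2 * ((norm B)\<^sup>2 * (norm (f 1 x))\<^sup>2))"
            using L2_D(2)[OF eL2[OF f0]] L2_D(2)[OF eL2[OF f1]] by simp
          have "(norm (z + w))\<^sup>2 \<le> 2 * (norm z)\<^sup>2 + 2 * (norm w)\<^sup>2" for z w :: complex
          proof -
            have "(norm (z + w))\<^sup>2 \<le> (norm z + norm w)\<^sup>2" by (rule power_mono[OF norm_triangle_ineq]) simp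
            also have "\<dots> \<le> 2 * (norm z)\<^sup>2 + 2 * (norm w)\<^sup>2"
              using zero_le_power2[of "norm z - norm w"] by (simp add: power2_sum power2_diff)
            finally show ?thesis .
          qed
          from this[of "A * f 0 _" "B * f 1 _"]
          show "AE x in lborel. norm ((norm (A * f 0 x + B * f 1 x))\<^sup>2) \<le> norm (2 * ((norm A)\<^sup>2 * (norm (f 0 x))\<^sup>2) + 2 * ((norm B)\<^sup>2 * (norm (f 1 x))\<^sup>2))"
            by (simp add: norm_mult power_mult_distrib)
        qed measurable
        fix a
        have "(LINT x|lborel. (A * f 0 x + B * f 1 x) * ft (tent a) x) = (LINT x|lborel. A * f 0 x * ft (tent a) x + B * f 1 x * ft (tent a) x)"
          by (simp add: distrib_right)
        also have "\<dots> = A * F (f 0) a + B * F (f 1) a"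
          using int[of a] by (simp add: F_def mult.assoc)
        also have "\<dots> = 0" unfolding ratio[OF f0, of a] ratio[OF f1, of a] by (simp add: A_def B_def)
        finally show "(LINT x|lborel. (A * f 0 x + B * f 1 x) * ft (tent a) x) = 0" .
      qed measurable
      from L2_independent_pair(2)[OF ind n this] have "F (f 0) 0 = 0" by (simp add: B_def)
      then have "F (f 0) a = 0" for a using ratio[OF f0, of a] by simp
      then have "AE x in lborel. f 0 x = 0" by (rule zeroF[OF eL2[OF f0]])
      then show False using L2_independent_nonzero[OF ind, of 0] n by simp
    qed
  next
    show "ft v \<in> eigenspace H l" unfolding H_def by (rule eigenfunction_of_profile[OF v(1)])
    show "L2_independent 1 (\<lambda>_. ft v)"
      unfolding L2_independent_def
    proof (intro allI impI)
      fix d :: "nat \<Rightarrow> complex" and i :: nat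
      assume z: "AE x in lborel. (\<Sum>j<1. d j * ft v x) = 0" and i: "i < 1"
      show "d i = 0"
      proof (rule ccontr)
        assume "d i \<noteq> 0"
        then have "AE x in lborel. ft v x = 0" using z i by simp
        then show False using ft_positive_profile_nonzero[OF v] by simp
      qed
    qed
  qed
  \<comment> \<open>For multiplicity 0 the witness family \<open>ft v\<close> is a dummy: no member
    of it has to be an eigenfunction, and the empty family is independent.\<close>
  moreover have "eigenvalue_multiplicity H \<mu> = enat 0" if \<mu>: "\<mu> < l + 121/100" "\<mu> \<noteq> l" for \<mu>
  proof (rule eigenvalue_multiplicity_eqI[where f = "\<lambda>_. ft v"])
    fix n f assume f: "\<And>i. i < n \<Longrightarrow> f i \<in> eigenspace H \<mu>" and ind: "L2_independent n f"
    show "n \<le> 0"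
    proof (rule ccontr)
      assume "\<not> n \<le> 0"
      then have "AE x in lborel. f 0 x = 0" by (intro zero[OF \<mu>] f) simp
      then show False using L2_independent_nonzero[OF ind, of 0] \<open>\<not> n \<le> 0\<close> by simp
    qed
  qed (simp_all add: L2_independent_def)
  ultimately show ?thesis using that unfolding H_def by blast
qed

end

lemma eigenvalue_enumeration_gap:
  assumes lam: "eigenvalue_enumeration H lam" and l: "eigenvalue_multiplicity H l = enat 1"
    and gap: "\<And>\<mu>. \<mu> < l + d \<Longrightarrow> \<mu> \<noteq> l \<Longrightarrow> eigenvalue_multiplicity H \<mu> = enat 0" and d: "d > 0"
  shows "lam 2 - lam 1 \<ge> d"
proof -
  have mono: "lam n \<le> lam (Suc n)" if "n \<ge> 1" for n using lam that by (simp add: eigenvalue_enumeration_def)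
  have card: "eigenvalue_multiplicity H \<mu> = enat (card {n. 1 \<le> n \<and> lam n = \<mu>})" for \<mu>
    using lam by (simp add: eigenvalue_enumeration_def)
  \<comment> \<open>An infinite set has \<open>card\<close> 0, so multiplicity 0 means absence from
    the list only once finiteness is known; it follows from divergence of
    \<open>lam\<close>.\<close>
  have fin: "finite {n. 1 \<le> n \<and> lam n = \<mu>}" for \<mu>
  proof -
    have "filterlim lam at_top sequentially" using lam by (simp add: eigenvalue_enumeration_def)
    then have "\<forall>\<^sub>F n in sequentially. lam n > \<mu>" by (simp add: filterlim_at_top_dense)
    then obtain N where N: "\<And>n. n \<ge> N \<Longrightarrow> lam n > \<mu>" by (auto simp: eventually_sequentially)
    have "{n. 1 \<le> n \<and> lam n = \<mu>} \<subseteq> {..<N}"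
    proof
      fix n assume "n \<in> {n. 1 \<le> n \<and> lam n = \<mu>}"
      then show "n \<in> {..<N}" using N[of n] by (cases "n \<ge> N") auto
    qed
    then show ?thesis by (rule finite_subset) simp
  qed
  have dich: "lam n = l \<or> lam n \<ge> l + d" if n: "n \<ge> 1" for n
  proof (rule ccontr)
    assume "\<not> (lam n = l \<or> lam n \<ge> l + d)"
    then have "card {m. 1 \<le> m \<and> lam m = lam n} = 0" using gap[of "lam n"] card[of "lam n"] by simp
    then have "{m. 1 \<le> m \<and> lam m = lam n} = {}" using fin[of "lam n"] by simp
    then show False using n by blast
  qed
  have c1: "card {n. 1 \<le> n \<and> lam n = l} = 1" using l card[of l] by simp
  then obtain m where m: "{n. 1 \<le> n \<and> lam n = l} = {m}" by (auto simp: card_1_singleton_iff)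
  then have m1: "1 \<le> m" "lam m = l" by auto
  have "lam 1 \<le> lam m" using m1(1)
  proof (induction m rule: dec_induct)
    case (step n)
    then show ?case using mono[of n] by simp
  qed simp
  then have 1: "lam 1 = l" using dich[of 1] m1 d by auto
  then have "1 = m" using m by blast
  have "lam 2 \<noteq> l"
  proof
    assume "lam 2 = l"
    then have "2 \<in> {n. 1 \<le> n \<and> lam n = l}" by simp
    then show False unfolding m using \<open>1 = m\<close> by simp
  qed
  then show ?thesis using dich[of 2] 1 by simp
qed

section \<open>Rational bounds for the claimed constant\<close>

lemma pi_less_315: "pi < 315 / 100"
proof (rule ccontr)
  assume "\<not> pi < 315 / 100"
  \<comment> \<open>525/1000 is a sixth of 315/100. Its sine would be at most
    \<open>sin (pi / 6) = 1 / 2\<close>, but the Taylor polynomial with its error term exceeds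
    1/2.\<close>
  then have le: "(525 / 1000 :: real) \<le> pi / 6" by simp
  have "sin (525 / 1000 :: real) \<le> sin (pi / 6)"
    by (rule sin_monotone_2pi_le) (use le pi_gt_zero in auto)
  then have "sin (525 / 1000 :: real) \<le> 1 / 2" by (simp add: sin_30)
  moreover have "(\<Sum>m<5. sin_coeff m * x ^ m) = x - x ^ 3 / 6" for x :: real
  proof -
    have "{..<5::nat} = {0, 1, 2, 3, 4}" by auto
    then show ?thesis by (simp add: sin_coeff_def fact_numeral)
  qed
  then have "\<bar>sin (525 / 1000 :: real) - (525 / 1000 - (525 / 1000) ^ 3 / 6)\<bar> \<le> inverse (fact 5) * \<bar>525 / 1000\<bar> ^ 5"
    using Maclaurin_sin_bound[of "525 / 1000" 5] by simp
  then have "sin (525 / 1000 :: real) \<ge> 525 / 1000 - (525 / 1000) ^ 3 / 6 - inverse (fact 5) * \<bar>525 / 1000\<bar> ^ 5"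
    unfolding abs_le_iff by argo
  moreover have "525 / 1000 - (525 / 1000) ^ 3 / 6 - inverse (fact 5) * \<bar>525 / 1000\<bar> ^ 5 > (1 / 2 :: real)"
    by (simp add: fact_numeral power_numeral_reduce)
  ultimately show False by linarith
qed

text \<open>An upper bound \<open>y\<close> for the power \<open>2 / 3\<close> of \<open>x\<close>
  amounts to \<open>x\<^sup>2 \<le> y ^ 3\<close>, a rational inequality once \<pi> is
  bounded.\<close>

lemma gap_constant_le: "(3 * pi / 8) powr (2 / 3) * (3 powr (2 / 3) - 1) \<le> 121 / 100"
proof -
  have cube: "x powr (2 / 3) \<le> y" if "x > 0" "y > 0" "x\<^sup>2 \<le> y ^ 3" for x y :: real
  proof -
    have "x powr (2 / 3) = (x powr 2) powr (1 / 3)" by (simp add: powr_powr)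
    also have "x powr 2 = x\<^sup>2" using that by simp
    also have "(x\<^sup>2) powr (1 / 3) \<le> (y ^ 3) powr (1 / 3)" by (rule powr_mono2) (use that in auto)
    also have "y ^ 3 = y powr 3" using that by simp
    also have "(y powr 3) powr (1 / 3) = y" unfolding powr_powr using that by simp
    finally show ?thesis .
  qed
  \<comment> \<open>The bounds 1.119 and 2.081 for the two powers give the product 1.209639, just
    below 1.21.\<close>
  have "(3 * pi / 8) powr (2 / 3) \<le> 1119 / 1000"
  proof (rule cube)
    have "(3 * pi / 8)\<^sup>2 \<le> (3 * (315 / 100) / 8)\<^sup>2" by (rule power_mono) (use pi_less_315 pi_gt_zero in auto)
    also have "\<dots> \<le> (1119 / 1000 :: real) ^ 3" by (simp add: power2_eq_square power3_eq_cube)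
    finally show "(3 * pi / 8)\<^sup>2 \<le> (1119 / 1000) ^ 3" .
  qed auto
  moreover have "3 powr (2 / 3) \<le> (2081 / 1000 :: real)"
    by (rule cube) (simp_all add: power2_eq_square power3_eq_cube)
  moreover have "(1 :: real) \<le> 3 powr (2 / 3)" by (rule ge_one_powr_ge_zero) auto
  ultimately have "(3 * pi / 8) powr (2 / 3) * (3 powr (2 / 3) - 1) \<le> 1119 / 1000 * (2081 / 1000 - 1)"
    by (intro mult_mono) auto
  then show ?thesis by simp
qed

theorem corollary3p9:
  fixes M :: "'w measure" and X :: "real \<Rightarrow> 'w \<Rightarrow> real" and lam :: "nat \<Rightarrow> real"
  assumes "cauchy_process M X"
    and "eigenvalue_enumeration (hamiltonian M X) lam"
  shows "lam 2 - lam 1 \<ge> (3 * pi / 8) powr (2 / 3) * (3 powr (2 / 3) - 1)"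
proof -
  interpret cauchy_process M X by fact
  obtain l where "eigenvalue_multiplicity (hamiltonian M X) l = enat 1"
    "\<And>\<mu>. \<mu> < l + 121/100 \<Longrightarrow> \<mu> \<noteq> l \<Longrightarrow> eigenvalue_multiplicity (hamiltonian M X) \<mu> = enat 0"
    using eigenvalue_gap by blast
  then have "lam 2 - lam 1 \<ge> 121 / 100"
    by (intro eigenvalue_enumeration_gap[OF assms(2), of l]) auto
  with gap_constant_le show ?thesis by linarith
qed

end
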